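(* For $C^*$-algebras $A$ and $B$, $\mathcal{Z}(A\otimes^\gamma B)=\mathcal{Z}(A)\otimes^\gamma\mathcal{Z}(B)$, where $\mathcal{Z}(A)\otimes^\gamma\mathcal{Z}(B)$ is regarded as a closed $*$-subalgebra of $A\otimes^\gamma B$ (the closure of $\mathcal{Z}(A)\otimes\mathcal{Z}(B)$).
   Context: $A\otimes^\gamma B$ is the Banach space projective tensor product, the completion of the algebraic tensor product $A\otimes B$ in the norm $\|u\|_\gamma=\inf\{\sum_i\|a_i\|\,\|b_i\| : u=\sum_i a_i\otimes b_i\}$ (finite sums); it is a Banach $*$-algebra with $(a\otimes b)(c\otimes d)=ac\otimes bd$, $(a\otimes b)^*=a^*\otimes b^*$. $\mathcal{Z}(C)$ denotes the center of an algebra $C$. For $C^*$-subalgebras $A_1\subseteq A$, $B_1\subseteq B$, the identity on $A_1\otimes B_1$ extends to an isometric $*$-homomorphism of $A_1\otimes^\gamma B_1$ onto the closure of $A_1\otimes B_1$ in $A\otimes^\gamma B$, and the two are identified. *)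

theory Defs
  imports "HOL-Analysis.Analysis" "HOL-Library.Multiset"
begin

section \<open>Complex *-algebras, Banach *-algebras and C*-algebras (not necessarily unital)\<close>

class complex_vector = real_vector +
  fixes scaleC :: "complex \<Rightarrow> 'a \<Rightarrow> 'a"  (infixr "*\<^sub>C" 75)
  assumes scaleC_add_right: "c *\<^sub>C (x + y) = c *\<^sub>C x + c *\<^sub>C y"
    and scaleC_add_left: "(c + d) *\<^sub>C x = c *\<^sub>C x + d *\<^sub>C x"
    and scaleC_scaleC: "c *\<^sub>C d *\<^sub>C x = (c * d) *\<^sub>C x"
    and scaleC_one: "1 *\<^sub>C x = x"
    and scaleR_scaleC: "r *\<^sub>R x = complex_of_real r *\<^sub>C x"

global_interpretation complex_vector: vector_space "scaleC :: complex \<Rightarrow> 'a \<Rightarrow> 'a::complex_vector"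
  by unfold_locales (simp_all add: scaleC_add_right scaleC_add_left scaleC_scaleC scaleC_one)

class star_algebra = complex_vector + real_algebra +
  fixes star :: "'a \<Rightarrow> 'a"
  assumes mult_scaleC_left: "(c *\<^sub>C x) * y = c *\<^sub>C (x * y)"
    and mult_scaleC_right: "x * (c *\<^sub>C y) = c *\<^sub>C (x * y)"
    and star_add: "star (x + y) = star x + star y"
    and star_scaleC: "star (c *\<^sub>C x) = cnj c *\<^sub>C star x"
    and star_mult: "star (x * y) = star y * star x"
    and star_star: "star (star x) = x"

class banach_star_algebra = star_algebra + real_normed_algebra + banach +
  assumes norm_scaleC: "norm (c *\<^sub>C x) = cmod c * norm x"
    and norm_star: "norm (star x) = norm x"

class cstar_algebra = banach_star_algebra +
  assumes cstar_identity: "norm (star x * x) = (norm x)\<^sup>2"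

definition center :: "'a::semigroup_mult set"
  where "center = {z. \<forall>x. z * x = x * z}"


section \<open>The algebraic tensor product over the complex numbers\<close>

text \<open>
  A finite multiset of pairs stands for the formal sum of the elementary tensors \<open>a \<otimes> b\<close>. The
  tensor product is the quotient by the least additive congruence that makes \<open>\<otimes>\<close> biadditive and
  balanced over the complex scalars. The last rule is needed because multisets have no
  cancellation; with it, \<open>(- a) \<otimes> b\<close> becomes an additive inverse of \<open>a \<otimes> b\<close>.
\<close>

inductive tensor_cong ::
  "('a::complex_vector \<times> 'b::complex_vector) multiset \<Rightarrow> ('a \<times> 'b) multiset \<Rightarrow> bool"
where
  refl: "tensor_cong M M"
| sym: "tensor_cong M N \<Longrightarrow> tensor_cong N M"
| trans: "tensor_cong M N \<Longrightarrow> tensor_cong N K \<Longrightarrow> tensor_cong M K"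
| add: "tensor_cong M N \<Longrightarrow> tensor_cong M' N' \<Longrightarrow> tensor_cong (M + M') (N + N')"
| add_left: "tensor_cong {#(a + a', b)#} {#(a, b), (a', b)#}"
| add_right: "tensor_cong {#(a, b + b')#} {#(a, b), (a, b')#}"
| balanced: "tensor_cong {#(c *\<^sub>C a, b)#} {#(a, c *\<^sub>C b)#}"
| zero: "tensor_cong {#(0, b)#} {#}"

quotient_type (overloaded) ('a, 'b) atensor =
  "('a::complex_vector \<times> 'b::complex_vector) multiset" / tensor_cong
  by (rule equivpI) (auto simp: reflp_def symp_def transp_def intro: tensor_cong.intros)

lift_definition atensor :: "'a::complex_vector \<Rightarrow> 'b::complex_vector \<Rightarrow> ('a, 'b) atensor"
    (infixr "\<otimes>" 72)
  is "\<lambda>a b. {#(a, b)#}" .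

lemma tensor_cong_image:
  assumes "tensor_cong M N"
    and "\<And>a a' b. tensor_cong {#f (a + a', b)#} {#f (a, b), f (a', b)#}"
    and "\<And>a b b'. tensor_cong {#f (a, b + b')#} {#f (a, b), f (a, b')#}"
    and "\<And>c a b. tensor_cong {#f (c *\<^sub>C a, b)#} {#f (a, c *\<^sub>C b)#}"
    and "\<And>b. tensor_cong {#f (0, b)#} {#}"
  shows "tensor_cong (image_mset f M) (image_mset f N)"
  using assms(1)
  by (induction rule: tensor_cong.induct) (auto intro: tensor_cong.intros assms(2-))

instantiation atensor :: (complex_vector, complex_vector) ab_group_add
begin

lift_definition zero_atensor :: "('a, 'b) atensor" is "{#}" .

lift_definition plus_atensor :: "('a, 'b) atensor \<Rightarrow> ('a, 'b) atensor \<Rightarrow> ('a, 'b) atensor"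
  is "(+)" by (rule tensor_cong.add)

lift_definition uminus_atensor :: "('a, 'b) atensor \<Rightarrow> ('a, 'b) atensor"
  is "image_mset (\<lambda>(a, b). (- a, b))"
proof (erule tensor_cong_image, goal_cases)
  case (1 M N a a' b)
  show ?case using tensor_cong.add_left[of "- a" "- a'" b] by simp
next
  case (3 M N c a b)
  show ?case using tensor_cong.balanced[of c "- a" b] by simp
qed (auto intro: tensor_cong.intros)

definition minus_atensor :: "('a, 'b) atensor \<Rightarrow> ('a, 'b) atensor \<Rightarrow> ('a, 'b) atensor"
  where "minus_atensor x y = x + - y"

instance
proof
  fix x y z :: "('a, 'b) atensor"
  show "x + y + z = x + (y + z)" by transfer (simp add: add.assoc tensor_cong.refl)
  show "x + y = y + x" by transfer (simp add: add.commute tensor_cong.refl)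
  show "0 + x = x" by transfer (simp add: tensor_cong.refl)
  show "- x + x = 0"
  proof transfer
    fix M :: "('a \<times> 'b) multiset"
    show "tensor_cong (image_mset (\<lambda>(a, b). (- a, b)) M + M) {#}"
    proof (induction M)
      case empty
      then show ?case by (simp add: tensor_cong.refl)
    next
      case (add p M)
      obtain a b where p: "p = (a, b)" by force
      have "tensor_cong {#(- a, b), (a, b)#} {#(- a + a, b)#}"
        by (rule tensor_cong.sym, rule tensor_cong.add_left)
      moreover have "tensor_cong {#(- a + a, b)#} {#}"
        by (simp add: tensor_cong.zero)
      ultimately have "tensor_cong {#(- a, b), (a, b)#} {#}"
        by (rule tensor_cong.trans)
      from tensor_cong.add[OF this add.IH] show ?case
        by (simp add: p add_mset_commute)
    qed
  qed
  show "x - y = x + - y" by (rule minus_atensor_def)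
qed

end

lemma atensor_add_left: "(a + a') \<otimes> b = a \<otimes> b + a' \<otimes> b"
  by transfer (simp add: tensor_cong.add_left add_mset_commute)

lemma atensor_add_right: "a \<otimes> (b + b') = a \<otimes> b + a \<otimes> b'"
  by transfer (simp add: tensor_cong.add_right add_mset_commute)

lemma atensor_balanced: "(c *\<^sub>C a) \<otimes> b = a \<otimes> (c *\<^sub>C b)"
  by transfer (rule tensor_cong.balanced)

lemma abs_atensor_eq_sum: "abs_atensor M = (\<Sum>(a, b)\<in>#M. a \<otimes> b)"
proof (induction M)
  case empty
  then show ?case by (simp add: zero_atensor_def)
next
  case (add p M)
  have "abs_atensor (add_mset p M) = abs_atensor {#p#} + abs_atensor M"
    by (simp add: plus_atensor.abs_eq)
  with add show ?case by (cases p) (simp add: atensor.abs_eq)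
qed

lemma atensor_is_sum: obtains M where "x = (\<Sum>(a, b)\<in>#M. a \<otimes> b)"
  using atensor.abs_induct[of "\<lambda>x. \<exists>M. x = (\<Sum>(a, b)\<in>#M. a \<otimes> b)" x]
  by (metis abs_atensor_eq_sum)

lemma atensor_induct [case_names zero tensor add, induct type: atensor]:
  assumes "P 0" "\<And>a b. P (a \<otimes> b)" "\<And>x y. P x \<Longrightarrow> P y \<Longrightarrow> P (x + y)"
  shows "P x"
proof -
  obtain M where x: "x = (\<Sum>(a, b)\<in>#M. a \<otimes> b)" by (rule atensor_is_sum)
  show ?thesis unfolding x by (induction M) (auto intro: assms)
qed

instantiation atensor :: (complex_vector, complex_vector) complex_vector
begin

lift_definition scaleC_atensor :: "complex \<Rightarrow> ('a, 'b) atensor \<Rightarrow> ('a, 'b) atensor"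
  is "\<lambda>c. image_mset (\<lambda>(a, b). (c *\<^sub>C a, b))"
proof (erule tensor_cong_image, goal_cases)
  case (3 k M N c a b)
  show ?case
    using tensor_cong.balanced[of c "k *\<^sub>C a" b] by (simp add: mult.commute)
qed (auto intro: tensor_cong.intros simp: complex_vector.scale_right_distrib)

definition scaleR_atensor :: "real \<Rightarrow> ('a, 'b) atensor \<Rightarrow> ('a, 'b) atensor"
  where "scaleR_atensor r x = complex_of_real r *\<^sub>C x"

lemma scaleC_atensor_add: "c *\<^sub>C (x + y) = c *\<^sub>C x + c *\<^sub>C (y :: ('a, 'b) atensor)"
  by transfer (simp add: tensor_cong.refl)

lemma scaleC_atensor_zero: "c *\<^sub>C 0 = (0 :: ('a, 'b) atensor)"
  by transfer (simp add: tensor_cong.refl)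

lemma scaleC_atensor: "c *\<^sub>C (a \<otimes> b) = (c *\<^sub>C a) \<otimes> b"
  by transfer (simp add: tensor_cong.refl)

lemmas scaleC_atensor_simps = scaleC_atensor_add scaleC_atensor_zero scaleC_atensor

instance
proof
  fix c d :: complex and r s :: real and x y :: "('a, 'b) atensor"
  show 1: "c *\<^sub>C (x + y) = c *\<^sub>C x + c *\<^sub>C y" for c and x y :: "('a, 'b) atensor" by (rule scaleC_atensor_add)
  show 2: "(c + d) *\<^sub>C x = c *\<^sub>C x + d *\<^sub>C x" for c d and x :: "('a, 'b) atensor"
    by (induction x)
      (auto simp: scaleC_atensor_simps complex_vector.scale_left_distrib atensor_add_left)
  show 3: "c *\<^sub>C d *\<^sub>C x = (c * d) *\<^sub>C x" for c d and x :: "('a, 'b) atensor"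
    by (induction x) (auto simp: scaleC_atensor_simps)
  show 4: "1 *\<^sub>C x = x" for x :: "('a, 'b) atensor"
    by (induction x) (auto simp: scaleC_atensor_simps)
  show "r *\<^sub>R x = complex_of_real r *\<^sub>C x" for r and x :: "('a, 'b) atensor" by (rule scaleR_atensor_def)
  show "r *\<^sub>R (x + y) = r *\<^sub>R x + r *\<^sub>R y" by (simp add: scaleR_atensor_def 1)
  show "(r + s) *\<^sub>R x = r *\<^sub>R x + s *\<^sub>R x" by (simp add: scaleR_atensor_def 2)
  show "r *\<^sub>R s *\<^sub>R x = (r * s) *\<^sub>R x" by (simp add: scaleR_atensor_def 3)
  show "1 *\<^sub>R x = x" by (simp add: scaleR_atensor_def 4)
qed

end

lemma atensor_universal:
  fixes f :: "'a::complex_vector \<Rightarrow> 'b::complex_vector \<Rightarrow> 'c::complex_vector"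
  assumes "\<And>a a' b. f (a + a') b = f a b + f a' b"
    and "\<And>a b b'. f a (b + b') = f a b + f a b'"
    and "\<And>c a b. f (c *\<^sub>C a) b = c *\<^sub>C f a b"
    and "\<And>c a b. f a (c *\<^sub>C b) = c *\<^sub>C f a b"
  shows "\<exists>!g. (\<forall>x y. g (x + y) = g x + g y) \<and> (\<forall>c x. g (c *\<^sub>C x) = c *\<^sub>C g x) \<and>
    (\<forall>a b. g (a \<otimes> b) = f a b)"
proof -
  define F where "F M = (\<Sum>(a, b)\<in>#M. f a b)" for M
  have f0: "f 0 b = 0" for b using assms(1)[of 0 0 b] by simp
  have F: "F M = F N" if "tensor_cong M N" for M N
    using that
    by (induction rule: tensor_cong.induct) (auto simp: F_def assms f0)
  define g where "g x = F (rep_atensor x)" for x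
  have g_abs: "g (abs_atensor M) = F M" for M
    unfolding g_def
    by (rule F) (rule Quotient3_rep_abs[OF Quotient3_atensor tensor_cong.refl])
  have g_tensor: "g (a \<otimes> b) = f a b" for a b
    by (simp add: atensor.abs_eq g_abs F_def)
  have g_add: "g (x + y) = g x + g y" for x y
  proof -
    obtain M N where "x = abs_atensor M" "y = abs_atensor N"
      by (metis Quotient3_abs_rep[OF Quotient3_atensor])
    then show ?thesis by (simp add: plus_atensor.abs_eq g_abs F_def)
  qed
  have g_0: "g 0 = 0" using g_add[of 0 0] by simp
  have g_scaleC: "g (c *\<^sub>C x) = c *\<^sub>C g x" for c x
    by (induction x)
      (auto simp: g_0 g_add g_tensor assms scaleC_atensor complex_vector.scale_right_distrib)
  have "h = g" if h: "\<forall>x y. h (x + y) = h x + h y" "\<forall>a b. h (a \<otimes> b) = f a b" for h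
  proof
    fix x
    have "h 0 = 0" using h(1)[rule_format, of 0 0] by simp
    then show "h x = g x"
      by (induction x) (auto simp: g_0 g_add g_tensor h)
  qed
  then show ?thesis using g_tensor g_add g_scaleC by (intro ex1I[of _ g]) auto
qed

lemma tensor_cong_mult_right:
  assumes "tensor_cong N N'"
  shows "tensor_cong (image_mset (\<lambda>(c, d). (a * c, b * d)) N)
    (image_mset (\<lambda>(c, d). ((a :: 'a::star_algebra) * c, (b :: 'b::star_algebra) * d)) N')"
  using assms
  by (rule tensor_cong_image)
    (auto intro: tensor_cong.intros simp: mult_scaleC_right distrib_left)

instantiation atensor :: (star_algebra, star_algebra) star_algebra
begin

lift_definition times_atensor :: "('a, 'b) atensor \<Rightarrow> ('a, 'b) atensor \<Rightarrow> ('a, 'b) atensor"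
  is "\<lambda>M N. \<Sum>(a, b)\<in>#M. image_mset (\<lambda>(c, d). (a * c, b * d)) N"
proof -
  let ?m = "\<lambda>M N. \<Sum>(a, b)\<in>#M. image_mset (\<lambda>(c, d). (a * c, b * d)) N"
  fix M M' N N' :: "('a \<times> 'b) multiset"
  assume M: "tensor_cong M M'" and N: "tensor_cong N N'"
  have "tensor_cong (?m M N) (?m M' N)"
    using M
  proof (induction rule: tensor_cong.induct)
    case (add_left a a' b)
    show ?case
    proof (induction N)
      case (add p N)
      obtain c d where p: "p = (c, d)" by force
      have "tensor_cong {#((a + a') * c, b * d)#} {#(a * c, b * d), (a' * c, b * d)#}"
        by (simp add: distrib_right tensor_cong.add_left)
      from tensor_cong.add[OF this add] show ?case by (simp add: p add_mset_commute)
    qed (simp add: tensor_cong.refl)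
  next
    case (add_right a b b')
    show ?case
    proof (induction N)
      case (add p N)
      obtain c d where p: "p = (c, d)" by force
      have "tensor_cong {#(a * c, (b + b') * d)#} {#(a * c, b * d), (a * c, b' * d)#}"
        by (simp add: distrib_right tensor_cong.add_right)
      from tensor_cong.add[OF this add] show ?case by (simp add: p add_mset_commute)
    qed (simp add: tensor_cong.refl)
  next
    case (balanced k a b)
    show ?case
    proof (induction N)
      case (add p N)
      obtain c d where p: "p = (c, d)" by force
      have "tensor_cong {#((k *\<^sub>C a) * c, b * d)#} {#(a * c, (k *\<^sub>C b) * d)#}"
        by (simp add: mult_scaleC_left tensor_cong.balanced)
      from tensor_cong.add[OF this add] show ?case by (simp add: p add_mset_commute)
    qed (simp add: tensor_cong.refl)
  next
    case (zero b)
    show ?case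
    proof (induction N)
      case (add p N)
      obtain c d where p: "p = (c, d)" by force
      have "tensor_cong {#(0 * c, b * d)#} {#}"
        by (simp add: tensor_cong.zero)
      from tensor_cong.add[OF this add] show ?case by (simp add: p add_mset_commute)
    qed (simp add: tensor_cong.refl)
  qed (auto intro: tensor_cong.intros)
  moreover have "tensor_cong (?m M' N) (?m M' N')"
    by (induction M') (auto intro: tensor_cong.refl tensor_cong.add tensor_cong_mult_right[OF N])
  ultimately show "tensor_cong (?m M N) (?m M' N')" by (rule tensor_cong.trans)
qed

lift_definition star_atensor :: "('a, 'b) atensor \<Rightarrow> ('a, 'b) atensor"
  is "image_mset (\<lambda>(a, b). (star a, star b))"
proof (erule tensor_cong_image, goal_cases)
  case (4 M N b)
  have "star (0 :: 'a) = 0" using star_add[of "0 :: 'a" 0] by simp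
  then show ?case by (simp add: tensor_cong.zero)
qed (auto intro: tensor_cong.intros simp: star_add star_scaleC)

lemma atensor_mult: "(a \<otimes> b) * (c \<otimes> d) = (a * c) \<otimes> (b * d :: 'b)" for a c :: 'a
  by transfer (simp add: tensor_cong.refl)

lemma star_atensor: "star (a \<otimes> b) = star a \<otimes> (star b :: 'b)" for a :: 'a
  by transfer (simp add: tensor_cong.refl)

lemma atensor_distrib_left: "x * (y + z) = x * y + x * (z :: ('a, 'b) atensor)"
proof transfer
  fix M N K :: "('a \<times> 'b) multiset"
  show "tensor_cong (\<Sum>(a, b)\<in>#M. image_mset (\<lambda>(c, d). (a * c, b * d)) (N + K))
    ((\<Sum>(a, b)\<in>#M. image_mset (\<lambda>(c, d). (a * c, b * d)) N) +
     (\<Sum>(a, b)\<in>#M. image_mset (\<lambda>(c, d). (a * c, b * d)) K))"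
  proof (induction M)
    case (add p M)
    obtain a b where p: "p = (a, b)" by force
    have "tensor_cong (image_mset (\<lambda>(c, d). (a * c, b * d)) (N + K))
      (image_mset (\<lambda>(c, d). (a * c, b * d)) (N + K))"
      by (rule tensor_cong.refl)
    from tensor_cong.add[OF this add] show ?case by (simp add: p ac_simps)
  qed (simp add: tensor_cong.refl)
qed

lemma atensor_distrib_right: "(x + y) * z = x * z + y * (z :: ('a, 'b) atensor)"
  by transfer (simp add: tensor_cong.refl)

lemma atensor_mult_zero_left: "0 * x = (0 :: ('a, 'b) atensor)"
  using atensor_distrib_right[of 0 0 x] by simp

lemma atensor_mult_zero_right: "x * 0 = (0 :: ('a, 'b) atensor)"
  using atensor_distrib_left[of x 0 0] by simp

lemma star_atensor_add: "star (x + y) = star x + star (y :: ('a, 'b) atensor)"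
  by transfer (simp add: tensor_cong.refl)

lemma star_atensor_zero: "star 0 = (0 :: ('a, 'b) atensor)"
  using star_atensor_add[of 0 0] by simp

lemmas atensor_algebra_simps = atensor_mult atensor_distrib_left atensor_distrib_right
  atensor_mult_zero_left atensor_mult_zero_right star_atensor star_atensor_add star_atensor_zero
  scaleC_atensor complex_vector.scale_right_distrib complex_vector.scale_zero_right

instance
proof
  fix c :: complex and r :: real and x y z :: "('a, 'b) atensor"
  show 1: "(c *\<^sub>C x) * y = c *\<^sub>C (x * y)" for c and x y :: "('a, 'b) atensor"
  proof (induction x)
    case (tensor a b)
    show ?case by (induction y) (simp_all add: atensor_algebra_simps mult_scaleC_left)
  qed (simp_all add: atensor_algebra_simps)
  show 2: "x * (c *\<^sub>C y) = c *\<^sub>C (x * y)" for c and x y :: "('a, 'b) atensor"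
  proof (induction x)
    case (tensor a b)
    show ?case by (induction y) (simp_all add: atensor_algebra_simps mult_scaleC_right)
  qed (simp_all add: atensor_algebra_simps)
  show "(r *\<^sub>R x) * y = r *\<^sub>R (x * y)" by (simp add: scaleR_scaleC 1)
  show "x * (r *\<^sub>R y) = r *\<^sub>R (x * y)" by (simp add: scaleR_scaleC 2)
  show "x * (y + z) = x * y + x * z" by (rule atensor_distrib_left)
  show "(x + y) * z = x * z + y * z" by (rule atensor_distrib_right)
  show "x * y * z = x * (y * z)"
  proof (induction x)
    case (tensor a b)
    show ?case
    proof (induction y)
      case (tensor a' b')
      show ?case by (induction z) (simp_all add: atensor_algebra_simps mult.assoc)
    qed (simp_all add: atensor_algebra_simps)
  qed (simp_all add: atensor_algebra_simps)
  show "star (x + y) = star x + star y" by (rule star_atensor_add)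
  show "star (c *\<^sub>C x) = cnj c *\<^sub>C star x"
    by (induction x) (simp_all add: atensor_algebra_simps star_scaleC)
  show "star (x * y) = star y * star x"
  proof (induction x)
    case (tensor a b)
    show ?case by (induction y) (simp_all add: atensor_algebra_simps star_mult)
  qed (simp_all add: atensor_algebra_simps)
  show "star (star x) = x"
    by (induction x) (simp_all add: atensor_algebra_simps star_star)
qed

end


section \<open>Completion of a seminormed *-algebra\<close>

class seminormed_star_algebra = star_algebra +
  fixes pnorm :: "'a \<Rightarrow> real"
  assumes pnorm_triangle: "pnorm (x + y) \<le> pnorm x + pnorm y"
    and pnorm_scaleC: "pnorm (c *\<^sub>C x) = cmod c * pnorm x"
    and pnorm_mult: "pnorm (x * y) \<le> pnorm x * pnorm y"
    and pnorm_star: "pnorm (star x) = pnorm x"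
begin

lemma pnorm_zero [simp]: "pnorm 0 = 0"
proof -
  have "0 *\<^sub>C (0 :: 'a) = 0"
    using scaleC_add_left[of 0 0 "0 :: 'a"] by simp
  then show ?thesis using pnorm_scaleC[of 0 0] by simp
qed

lemma pnorm_minus [simp]: "pnorm (- x) = pnorm x"
proof -
  have "- x = (-1) *\<^sub>R x"
    using scaleR_add_left[of 1 "-1" x] scaleR_add_left[of 0 0 x]
    by (intro minus_unique) (simp add: scaleR_one)
  then show ?thesis using pnorm_scaleC[of "-1" x] by (simp add: scaleR_scaleC)
qed

lemma pnorm_nonneg [simp]: "0 \<le> pnorm x"
  using pnorm_triangle[of x "- x"] by simp

lemma pnorm_diff_commute: "pnorm (x - y) = pnorm (y - x)"
  using pnorm_minus[of "x - y"] by simp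

lemma pnorm_triangle_diff: "pnorm (x - z) \<le> pnorm (x - y) + pnorm (y - z)"
proof -
  have "x - z = (x - y) + (y - z)" by (simp add: algebra_simps)
  then show ?thesis by (metis pnorm_triangle)
qed

lemma pnorm_diff_ineq: "\<bar>pnorm x - pnorm y\<bar> \<le> pnorm (x - y)"
  using pnorm_triangle[of "x - y" y] pnorm_triangle[of "y - x" x] pnorm_diff_commute[of x y]
  by (simp add: abs_le_iff)

lemma pnorm_add_diff: "pnorm ((x + y) - (x' + y')) \<le> pnorm (x - x') + pnorm (y - y')"
proof -
  have "(x + y) - (x' + y') = (x - x') + (y - y')" by (simp add: algebra_simps)
  then show ?thesis by (metis pnorm_triangle)
qed

lemma pnorm_mult_diff:
  "pnorm (x * y - x' * y') \<le> pnorm x * pnorm (y - y') + pnorm (x - x') * pnorm y'"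
proof -
  have "x * y - x' * y' = x * (y - y') + (x - x') * y'"
    by (simp add: algebra_simps)
  then have "pnorm (x * y - x' * y') \<le> pnorm (x * (y - y')) + pnorm ((x - x') * y')"
    by (metis pnorm_triangle)
  also have "\<dots> \<le> pnorm x * pnorm (y - y') + pnorm (x - x') * pnorm y'"
    by (intro add_mono pnorm_mult)
  finally show ?thesis .
qed

lemma star_diff: "star (x - y) = star x - star y"
  using star_add[of "x - y" y] by (simp add: algebra_simps)

end

lemma pnorm_scaleC_diff: "pnorm (c *\<^sub>C x - c *\<^sub>C y) = cmod c * pnorm (x - y)"
  by (metis complex_vector.scale_right_diff_distrib pnorm_scaleC)

lemma pnorm_star_diff: "pnorm (star x - star y) = pnorm (x - y)"
  by (metis star_diff pnorm_star)

definition pcauchy :: "(nat \<Rightarrow> 'a::seminormed_star_algebra) \<Rightarrow> bool"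
  where "pcauchy X \<longleftrightarrow> (\<forall>e>0. \<exists>N. \<forall>m\<ge>N. \<forall>n\<ge>N. pnorm (X m - X n) < e)"

definition pequiv :: "(nat \<Rightarrow> 'a::seminormed_star_algebra) \<Rightarrow> (nat \<Rightarrow> 'a) \<Rightarrow> bool"
  where "pequiv X Y \<longleftrightarrow> pcauchy X \<and> pcauchy Y \<and> (\<lambda>n. pnorm (X n - Y n)) \<longlonglongrightarrow> 0"

lemma pequiv_refl_iff: "pequiv X X \<longleftrightarrow> pcauchy X"
  by (simp add: pequiv_def)

lemma pcauchy_const: "pcauchy (\<lambda>n. x)"
  by (simp add: pcauchy_def)

lemma pequiv_sym: "pequiv X Y \<Longrightarrow> pequiv Y X"
  by (simp add: pequiv_def pnorm_diff_commute)

lemma tendsto_zero_le: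
  assumes "\<And>n. 0 \<le> f n" "\<And>n. f n \<le> g n" "g \<longlonglongrightarrow> (0 :: real)"
  shows "f \<longlonglongrightarrow> 0"
  by (rule tendsto_sandwich[OF _ _ tendsto_const assms(3)]) (auto simp: assms)

lemma pequiv_trans:
  assumes "pequiv X Y" "pequiv Y Z"
  shows "pequiv X Z"
proof -
  have *: "(\<lambda>n. pnorm (X n - Y n) + pnorm (Y n - Z n)) \<longlonglongrightarrow> 0"
    using assms by (intro tendsto_add_zero) (auto simp: pequiv_def)
  have "(\<lambda>n. pnorm (X n - Z n)) \<longlonglongrightarrow> 0"
    by (rule tendsto_zero_le[OF _ _ *]) (auto intro: pnorm_triangle_diff)
  with assms show ?thesis by (simp add: pequiv_def)
qed

quotient_type (overloaded) 'a completion =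
  "nat \<Rightarrow> 'a::seminormed_star_algebra" / partial: pequiv
proof (rule part_equivpI)
  show "\<exists>X :: nat \<Rightarrow> 'a. pequiv X X"
    using pcauchy_const pequiv_refl_iff by blast
qed (auto simp: symp_def transp_def intro: pequiv_sym pequiv_trans)

lemma pcauchy_Cauchy_pnorm:
  assumes "pcauchy X"
  shows "Cauchy (\<lambda>n. pnorm (X n))"
proof (rule metric_CauchyI)
  fix e :: real assume "0 < e"
  with assms obtain N where "\<forall>m\<ge>N. \<forall>n\<ge>N. pnorm (X m - X n) < e"
    unfolding pcauchy_def by blast
  then show "\<exists>N. \<forall>m\<ge>N. \<forall>n\<ge>N. dist (pnorm (X m)) (pnorm (X n)) < e"
    unfolding dist_real_def using pnorm_diff_ineq le_less_trans by blast
qed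

lemma pcauchy_pnorm_lim:
  "pcauchy X \<Longrightarrow> (\<lambda>n. pnorm (X n)) \<longlonglongrightarrow> lim (\<lambda>n. pnorm (X n))"
  using pcauchy_Cauchy_pnorm[of X] Cauchy_convergent convergent_LIMSEQ_iff by blast

lemma pcauchy_bounded:
  assumes "pcauchy X"
  obtains B where "B > 0" "\<And>n. pnorm (X n) \<le> B"
proof -
  have "Bseq (\<lambda>n. pnorm (X n))"
    by (rule Cauchy_Bseq[OF pcauchy_Cauchy_pnorm[OF assms]])
  then obtain B where "B > 0" "\<And>n. norm (pnorm (X n)) \<le> B"
    using BseqE by blast
  with that[of B] show ?thesis by simp
qed

lemma pcauchy_add:
  assumes "pcauchy X" "pcauchy Y"
  shows "pcauchy (\<lambda>n. X n + Y n)"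
  unfolding pcauchy_def
proof (intro allI impI)
  fix e :: real assume e: "0 < e"
  obtain N where N: "\<forall>m\<ge>N. \<forall>n\<ge>N. pnorm (X m - X n) < e / 2"
    using assms(1) e unfolding pcauchy_def by (meson half_gt_zero)
  obtain M where M: "\<forall>m\<ge>M. \<forall>n\<ge>M. pnorm (Y m - Y n) < e / 2"
    using assms(2) e unfolding pcauchy_def by (meson half_gt_zero)
  have "pnorm ((X m + Y m) - (X n + Y n)) < e" if "m \<ge> max N M" "n \<ge> max N M" for m n
  proof -
    have "pnorm (X m - X n) < e / 2" "pnorm (Y m - Y n) < e / 2"
      using N M that by auto
    then show ?thesis using pnorm_add_diff[of "X m" "Y m" "X n" "Y n"] by linarith
  qed
  then show "\<exists>N. \<forall>m\<ge>N. \<forall>n\<ge>N. pnorm ((X m + Y m) - (X n + Y n)) < e" by blast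
qed

lemma pcauchy_lipschitz:
  assumes "pcauchy X" "\<And>x y. pnorm (f x - f y) \<le> B * pnorm (x - y)"
  shows "pcauchy (\<lambda>n. f (X n))"
  unfolding pcauchy_def
proof (intro allI impI)
  fix e :: real assume e: "0 < e"
  have "0 < e / (\<bar>B\<bar> + 1)" using e by simp
  then obtain N where N: "\<forall>m\<ge>N. \<forall>n\<ge>N. pnorm (X m - X n) < e / (\<bar>B\<bar> + 1)"
    using assms(1) unfolding pcauchy_def by blast
  have "pnorm (f (X m) - f (X n)) < e" if "m \<ge> N" "n \<ge> N" for m n
  proof -
    have "pnorm (X m - X n) < e / (\<bar>B\<bar> + 1)" using N that by blast
    then have "(\<bar>B\<bar> + 1) * pnorm (X m - X n) < e" by (simp add: field_simps)
    moreover have "B * pnorm (X m - X n) \<le> (\<bar>B\<bar> + 1) * pnorm (X m - X n)"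
      by (intro mult_right_mono) auto
    ultimately show ?thesis using assms(2)[of "X m" "X n"] by linarith
  qed
  then show "\<exists>N. \<forall>m\<ge>N. \<forall>n\<ge>N. pnorm (f (X m) - f (X n)) < e" by blast
qed

lemma pcauchy_scaleC: "pcauchy X \<Longrightarrow> pcauchy (\<lambda>n. c *\<^sub>C X n)"
  by (erule pcauchy_lipschitz[where B = "cmod c"]) (simp add: pnorm_scaleC_diff)

lemma pcauchy_minus: "pcauchy X \<Longrightarrow> pcauchy (\<lambda>n. - X n)"
  using pcauchy_scaleC[of X "-1"] by simp

lemma pcauchy_star: "pcauchy X \<Longrightarrow> pcauchy (\<lambda>n. star (X n))"
  by (erule pcauchy_lipschitz[where B = 1]) (simp add: pnorm_star_diff)

lemma pcauchy_mult:
  assumes "pcauchy X" "pcauchy Y"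
  shows "pcauchy (\<lambda>n. X n * Y n)"
  unfolding pcauchy_def
proof (intro allI impI)
  fix e :: real assume e: "0 < e"
  obtain B where B: "B > 0" "\<And>n. pnorm (X n) \<le> B" using pcauchy_bounded[OF assms(1)] by blast
  obtain C where C: "C > 0" "\<And>n. pnorm (Y n) \<le> C" using pcauchy_bounded[OF assms(2)] by blast
  have e': "0 < e / (2 * C)" "0 < e / (2 * B)" using e B C by simp_all
  obtain N where N: "\<forall>m\<ge>N. \<forall>n\<ge>N. pnorm (X m - X n) < e / (2 * C)"
    using assms(1) e' unfolding pcauchy_def by blast
  obtain M where M: "\<forall>m\<ge>M. \<forall>n\<ge>M. pnorm (Y m - Y n) < e / (2 * B)"
    using assms(2) e' unfolding pcauchy_def by blast
  have "pnorm (X m * Y m - X n * Y n) < e" if mn: "m \<ge> max N M" "n \<ge> max N M" for m n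
  proof -
    have 1: "pnorm (X m - X n) < e / (2 * C)" and 2: "pnorm (Y m - Y n) < e / (2 * B)"
      using N M mn by auto
    have "pnorm (X m) * pnorm (Y m - Y n) \<le> B * pnorm (Y m - Y n)"
      by (intro mult_right_mono B) simp
    also have "\<dots> < B * (e / (2 * B))" using 2 B(1) by (rule mult_strict_left_mono)
    also have "\<dots> = e / 2" using B(1) by simp
    finally have 3: "pnorm (X m) * pnorm (Y m - Y n) < e / 2" .
    have "pnorm (X m - X n) * pnorm (Y n) \<le> pnorm (X m - X n) * C"
      by (intro mult_left_mono C) simp
    also have "\<dots> < e / (2 * C) * C" using 1 C(1) by (rule mult_strict_right_mono)
    also have "\<dots> = e / 2" using C(1) by simp
    finally show ?thesis using 3 pnorm_mult_diff[of "X m" "Y m" "X n" "Y n"] by linarith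
  qed
  then show "\<exists>N. \<forall>m\<ge>N. \<forall>n\<ge>N. pnorm (X m * Y m - X n * Y n) < e" by blast
qed

lemma pequiv_add:
  assumes "pequiv X X'" "pequiv Y Y'"
  shows "pequiv (\<lambda>n. X n + Y n) (\<lambda>n. X' n + Y' n)"
proof -
  have *: "(\<lambda>n. pnorm (X n - X' n) + pnorm (Y n - Y' n)) \<longlonglongrightarrow> 0"
    using assms by (intro tendsto_add_zero) (auto simp: pequiv_def)
  have "(\<lambda>n. pnorm ((X n + Y n) - (X' n + Y' n))) \<longlonglongrightarrow> 0"
    by (rule tendsto_zero_le[OF _ _ *]) (auto intro: pnorm_add_diff)
  with assms show ?thesis by (simp add: pequiv_def pcauchy_add)
qed

lemma pequiv_scaleC:
  assumes "pequiv X Y"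
  shows "pequiv (\<lambda>n. c *\<^sub>C X n) (\<lambda>n. c *\<^sub>C Y n)"
  using assms tendsto_mult_right_zero[of "\<lambda>n. pnorm (X n - Y n)" sequentially "cmod c"]
  by (simp add: pequiv_def pcauchy_scaleC pnorm_scaleC_diff)

lemma pequiv_minus: "pequiv X Y \<Longrightarrow> pequiv (\<lambda>n. - X n) (\<lambda>n. - Y n)"
  using pequiv_scaleC[of X Y "-1"] by simp

lemma pequiv_star: "pequiv X Y \<Longrightarrow> pequiv (\<lambda>n. star (X n)) (\<lambda>n. star (Y n))"
  by (simp add: pequiv_def pcauchy_star pnorm_star_diff)

lemma pequiv_mult:
  assumes "pequiv X X'" "pequiv Y Y'"
  shows "pequiv (\<lambda>n. X n * Y n) (\<lambda>n. X' n * Y' n)"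
proof -
  have X: "pcauchy X" "pcauchy X'" and Y: "pcauchy Y" "pcauchy Y'"
    using assms by (auto simp: pequiv_def)
  have *: "(\<lambda>n. pnorm (X n) * pnorm (Y n - Y' n) + pnorm (X n - X' n) * pnorm (Y' n))
      \<longlonglongrightarrow> lim (\<lambda>n. pnorm (X n)) * 0 + 0 * lim (\<lambda>n. pnorm (Y' n))"
    using assms X Y by (intro tendsto_intros pcauchy_pnorm_lim) (auto simp: pequiv_def)
  have "(\<lambda>n. pnorm (X n * Y n - X' n * Y' n)) \<longlonglongrightarrow> 0"
    by (rule tendsto_zero_le[OF _ _ *[unfolded mult_zero_left mult_zero_right add_0_left]])
      (auto intro: pnorm_mult_diff)
  with X Y show ?thesis by (simp add: pequiv_def pcauchy_mult)
qed

lemma pequiv_lim_pnorm: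
  assumes "pequiv X Y"
  shows "lim (\<lambda>n. pnorm (X n)) = lim (\<lambda>n. pnorm (Y n))"
proof -
  have XY: "pcauchy X" "pcauchy Y" "(\<lambda>n. pnorm (X n - Y n)) \<longlonglongrightarrow> 0"
    using assms by (auto simp: pequiv_def)
  have "(\<lambda>n. \<bar>pnorm (X n) - pnorm (Y n)\<bar>) \<longlonglongrightarrow> 0"
    by (rule tendsto_zero_le[OF _ _ XY(3)]) (auto simp: pnorm_diff_ineq)
  moreover have "(\<lambda>n. \<bar>pnorm (X n) - pnorm (Y n)\<bar>)
      \<longlonglongrightarrow> \<bar>lim (\<lambda>n. pnorm (X n)) - lim (\<lambda>n. pnorm (Y n))\<bar>"
    using XY by (intro tendsto_intros pcauchy_pnorm_lim)
  ultimately show ?thesis using LIMSEQ_unique by fastforce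
qed

instantiation completion :: (seminormed_star_algebra) star_algebra
begin

lift_definition zero_completion :: "'a completion" is "\<lambda>n. 0"
  by (simp add: pequiv_refl_iff pcauchy_const)

lift_definition plus_completion :: "'a completion \<Rightarrow> 'a completion \<Rightarrow> 'a completion"
  is "\<lambda>X Y n. X n + Y n" by (rule pequiv_add)

lift_definition uminus_completion :: "'a completion \<Rightarrow> 'a completion"
  is "\<lambda>X n. - X n" by (rule pequiv_minus)

definition minus_completion :: "'a completion \<Rightarrow> 'a completion \<Rightarrow> 'a completion"
  where "minus_completion x y = x + - y"

lift_definition scaleC_completion :: "complex \<Rightarrow> 'a completion \<Rightarrow> 'a completion"
  is "\<lambda>c X n. c *\<^sub>C X n" by (rule pequiv_scaleC)

definition scaleR_completion :: "real \<Rightarrow> 'a completion \<Rightarrow> 'a completion"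
  where "scaleR_completion r x = complex_of_real r *\<^sub>C x"

lift_definition times_completion :: "'a completion \<Rightarrow> 'a completion \<Rightarrow> 'a completion"
  is "\<lambda>X Y n. X n * Y n" by (rule pequiv_mult)

lift_definition star_completion :: "'a completion \<Rightarrow> 'a completion"
  is "\<lambda>X n. star (X n)" by (rule pequiv_star)

lemmas pcauchy_intros =
  pcauchy_const pcauchy_add pcauchy_minus pcauchy_scaleC pcauchy_mult pcauchy_star

instance
proof
  fix c d :: complex and r s :: real and x y z :: "'a completion"
  show "x + y + z = x + (y + z)"
    by transfer (simp add: add.assoc pequiv_refl_iff pcauchy_intros)
  show "x + y = y + x"
    by transfer (simp add: add.commute pequiv_refl_iff pcauchy_intros)
  show "0 + x = x" by transfer simp
  show "- x + x = 0"
    by transfer (simp add: pequiv_refl_iff pcauchy_intros)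
  show "x - y = x + - y" by (rule minus_completion_def)
  show 1: "c *\<^sub>C (x + y) = c *\<^sub>C x + c *\<^sub>C y" for c and x y :: "'a completion"
    by transfer
      (simp add: complex_vector.scale_right_distrib pequiv_refl_iff pcauchy_intros)
  show 2: "(c + d) *\<^sub>C x = c *\<^sub>C x + d *\<^sub>C x" for c d and x :: "'a completion"
    by transfer
      (simp add: complex_vector.scale_left_distrib pequiv_refl_iff pcauchy_intros)
  show 3: "c *\<^sub>C d *\<^sub>C x = (c * d) *\<^sub>C x" for c d and x :: "'a completion"
    by transfer (simp add: pequiv_refl_iff pcauchy_intros)
  show 4: "1 *\<^sub>C x = x" for x :: "'a completion"
    by transfer simp
  show "r *\<^sub>R x = complex_of_real r *\<^sub>C x" for r and x :: "'a completion"
    by (rule scaleR_completion_def)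
  show "r *\<^sub>R (x + y) = r *\<^sub>R x + r *\<^sub>R y" by (simp add: scaleR_completion_def 1)
  show "(r + s) *\<^sub>R x = r *\<^sub>R x + s *\<^sub>R x" by (simp add: scaleR_completion_def 2)
  show "r *\<^sub>R s *\<^sub>R x = (r * s) *\<^sub>R x" by (simp add: scaleR_completion_def 3)
  show "1 *\<^sub>R x = x" by (simp add: scaleR_completion_def 4)
  show 5: "(c *\<^sub>C x) * y = c *\<^sub>C (x * y)" for c and x y :: "'a completion"
    by transfer (simp add: mult_scaleC_left pequiv_refl_iff pcauchy_intros)
  show 6: "x * (c *\<^sub>C y) = c *\<^sub>C (x * y)" for c and x y :: "'a completion"
    by transfer (simp add: mult_scaleC_right pequiv_refl_iff pcauchy_intros)
  show "(r *\<^sub>R x) * y = r *\<^sub>R (x * y)" by (simp add: scaleR_completion_def 5)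
  show "x * (r *\<^sub>R y) = r *\<^sub>R (x * y)" by (simp add: scaleR_completion_def 6)
  show "x * (y + z) = x * y + x * z"
    by transfer (simp add: distrib_left pequiv_refl_iff pcauchy_intros)
  show "(x + y) * z = x * z + y * z"
    by transfer (simp add: distrib_right pequiv_refl_iff pcauchy_intros)
  show "x * y * z = x * (y * z)"
    by transfer (simp add: mult.assoc pequiv_refl_iff pcauchy_intros)
  show "star (x + y) = star x + star y"
    by transfer (simp add: star_add pequiv_refl_iff pcauchy_intros)
  show "star (c *\<^sub>C x) = cnj c *\<^sub>C star x"
    by transfer (simp add: star_scaleC pequiv_refl_iff pcauchy_intros)
  show "star (x * y) = star y * star x"
    by transfer (simp add: star_mult pequiv_refl_iff pcauchy_intros)
  show "star (star x) = x"
    by transfer (simp add: star_star)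
qed

end

instantiation completion :: (seminormed_star_algebra) real_normed_algebra
begin

lift_definition norm_completion :: "'a completion \<Rightarrow> real"
  is "\<lambda>X. lim (\<lambda>n. pnorm (X n))" by (rule pequiv_lim_pnorm)

definition dist_completion :: "'a completion \<Rightarrow> 'a completion \<Rightarrow> real"
  where "dist_completion x y = norm (x - y)"

definition sgn_completion :: "'a completion \<Rightarrow> 'a completion"
  where "sgn_completion x = inverse (norm x) *\<^sub>R x"

definition uniformity_completion :: "('a completion \<times> 'a completion) filter"
  where "uniformity_completion = (INF e\<in>{0 <..}. principal {(x, y). dist x y < e})"

definition open_completion :: "'a completion set \<Rightarrow> bool"
  where "open_completion S = (\<forall>x\<in>S. \<forall>\<^sub>F (x', y) in uniformity. x' = x \<longrightarrow> y \<in> S)"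

lemma norm_completion_scaleC: "norm (c *\<^sub>C x) = cmod c * norm (x :: 'a completion)"
proof transfer
  fix c and X :: "nat \<Rightarrow> 'a" assume "pequiv X X"
  then have "(\<lambda>n. pnorm (c *\<^sub>C X n)) \<longlonglongrightarrow> cmod c * lim (\<lambda>n. pnorm (X n))"
    unfolding pnorm_scaleC pequiv_refl_iff by (intro tendsto_intros pcauchy_pnorm_lim)
  then show "lim (\<lambda>n. pnorm (c *\<^sub>C X n)) = cmod c * lim (\<lambda>n. pnorm (X n))"
    by (rule limI)
qed

instance
proof
  fix r :: real and x y :: "'a completion" and S :: "'a completion set"
  show "dist x y = norm (x - y)" by (rule dist_completion_def)
  show "sgn x = inverse (norm x) *\<^sub>R x" by (rule sgn_completion_def)
  show "uniformity = (INF e\<in>{0 <..}. principal {(x, y :: 'a completion). dist x y < e})"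
    by (rule uniformity_completion_def)
  show "open S = (\<forall>x\<in>S. \<forall>\<^sub>F (x', y) in uniformity. x' = x \<longrightarrow> y \<in> S)"
    by (rule open_completion_def)
  show "(norm x = 0) = (x = 0)"
  proof transfer
    fix X :: "nat \<Rightarrow> 'a" assume "pequiv X X"
    then have X: "pcauchy X" by (simp add: pequiv_refl_iff)
    have "pequiv X (\<lambda>n. 0) \<longleftrightarrow> (\<lambda>n. pnorm (X n)) \<longlonglongrightarrow> 0"
      by (simp add: pequiv_def X pcauchy_const)
    then show "(lim (\<lambda>n. pnorm (X n)) = 0) = pequiv X (\<lambda>n. 0)"
      using pcauchy_pnorm_lim[OF X] LIMSEQ_unique by metis
  qed
  show "norm (x + y) \<le> norm x + norm y"
  proof transfer
    fix X Y :: "nat \<Rightarrow> 'a" assume "pequiv X X" "pequiv Y Y"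
    then have "pcauchy X" "pcauchy Y" by (auto simp: pequiv_refl_iff)
    then show "lim (\<lambda>n. pnorm (X n + Y n)) \<le> lim (\<lambda>n. pnorm (X n)) + lim (\<lambda>n. pnorm (Y n))"
      by (intro LIMSEQ_le[OF pcauchy_pnorm_lim tendsto_add[OF pcauchy_pnorm_lim pcauchy_pnorm_lim]])
        (auto simp: pcauchy_add pnorm_triangle)
  qed
  show "norm (x * y) \<le> norm x * norm y"
  proof transfer
    fix X Y :: "nat \<Rightarrow> 'a" assume "pequiv X X" "pequiv Y Y"
    then have "pcauchy X" "pcauchy Y" by (auto simp: pequiv_refl_iff)
    then show "lim (\<lambda>n. pnorm (X n * Y n)) \<le> lim (\<lambda>n. pnorm (X n)) * lim (\<lambda>n. pnorm (Y n))"
      by (intro LIMSEQ_le[OF pcauchy_pnorm_lim tendsto_mult[OF pcauchy_pnorm_lim pcauchy_pnorm_lim]])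
        (auto simp: pcauchy_mult pnorm_mult)
  qed
  show "norm (r *\<^sub>R x) = \<bar>r\<bar> * norm x"
    by (simp add: scaleR_scaleC norm_completion_scaleC)
qed

end

lift_definition embed :: "'a::seminormed_star_algebra \<Rightarrow> 'a completion" is "\<lambda>x n. x"
  by (simp add: pequiv_refl_iff pcauchy_const)

lemma embed_add: "embed (x + y) = embed x + embed y"
  by transfer (simp add: pequiv_refl_iff pcauchy_const)

lemma embed_minus: "embed (- x) = - embed x"
  by transfer (simp add: pequiv_refl_iff pcauchy_const)

lemma embed_diff: "embed (x - y) = embed x - embed y"
  using embed_add[of x "- y"] by (simp add: embed_minus)

lemma embed_scaleC: "embed (c *\<^sub>C x) = c *\<^sub>C embed x"
  by transfer (simp add: pequiv_refl_iff pcauchy_const)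

lemma embed_mult: "embed (x * y) = embed x * embed y"
  by transfer (simp add: pequiv_refl_iff pcauchy_const)

lemma embed_star: "embed (star x) = star (embed x)"
  by transfer (simp add: pequiv_refl_iff pcauchy_const)

lemma norm_embed: "norm (embed x) = pnorm x"
  by transfer (rule limI[OF tendsto_const])

lemma embed_limit:
  assumes "pcauchy X"
  shows "(\<lambda>n. embed (X n)) \<longlonglongrightarrow> abs_completion X"
proof (rule metric_LIMSEQ_I)
  fix e :: real assume e: "0 < e"
  then obtain N where N: "\<forall>m\<ge>N. \<forall>n\<ge>N. pnorm (X m - X n) < e / 2"
    using assms unfolding pcauchy_def by (meson half_gt_zero)
  have "dist (embed (X m)) (abs_completion X) < e" if "m \<ge> N" for m
  proof -
    have c: "pcauchy (\<lambda>n. X m - X n)"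
      using pcauchy_add[OF pcauchy_const pcauchy_minus[OF assms]] by simp
    have "embed (X m) - abs_completion X = abs_completion (\<lambda>n. X m - X n)"
      by (simp add: minus_completion_def embed.abs_eq plus_completion.abs_eq
          uminus_completion.abs_eq pequiv_refl_iff pcauchy_const assms pcauchy_minus)
    then have "dist (embed (X m)) (abs_completion X) = lim (\<lambda>n. pnorm (X m - X n))"
      by (simp add: dist_norm norm_completion.abs_eq pequiv_refl_iff c)
    also have "\<dots> \<le> e / 2"
      by (rule LIMSEQ_le_const2[OF pcauchy_pnorm_lim[OF c]])
        (use N that in \<open>auto intro!: exI[of _ N] less_imp_le\<close>)
    finally show ?thesis using e by simp
  qed
  then show "\<exists>N. \<forall>m\<ge>N. dist (embed (X m)) (abs_completion X) < e" by blast
qed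

lemma closure_range_embed: "closure (range embed) = UNIV"
proof (intro equalityI subsetI UNIV_I)
  fix x :: "'a completion"
  obtain X where X: "pequiv X X" "x = abs_completion X"
    by (metis Quotient_completion Quotient_def)
  then have "(\<lambda>n. embed (X n)) \<longlonglongrightarrow> x"
    using embed_limit by (simp add: pequiv_refl_iff)
  then show "x \<in> closure (range embed)"
    unfolding closure_sequential by (intro exI[of _ "\<lambda>n. embed (X n)"]) simp
qed

instance completion :: (seminormed_star_algebra) banach_star_algebra
proof
  fix c :: complex and x :: "'a completion" and F :: "nat \<Rightarrow> 'a completion"
  show "norm (c *\<^sub>C x) = cmod c * norm x" by (rule norm_completion_scaleC)
  show "norm (star x) = norm x" by transfer (simp add: pnorm_star)
  assume F: "Cauchy F"
  have "\<exists>x. dist (F k) (embed x) < inverse (real (Suc k))" for k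
  proof -
    have "F k \<in> closure (range embed)" by (simp add: closure_range_embed)
    then obtain y where "y \<in> range embed" "dist y (F k) < inverse (real (Suc k))"
      unfolding closure_approachable by (meson inverse_positive_iff_positive of_nat_0_less_iff zero_less_Suc)
    then show ?thesis by (auto simp: dist_commute)
  qed
  then obtain X where X: "\<And>k. dist (F k) (embed (X k)) < inverse (real (Suc k))" by metis
  have FX: "(\<lambda>k. dist (F k) (embed (X k))) \<longlonglongrightarrow> 0"
    by (rule tendsto_zero_le[OF _ _ LIMSEQ_inverse_real_of_nat])
      (rule zero_le_dist, rule less_imp_le, rule X)
  have "pcauchy X"
    unfolding pcauchy_def
  proof (intro allI impI)
    fix e :: real assume e: "0 < e"
    obtain N where N: "\<forall>m\<ge>N. \<forall>n\<ge>N. dist (F m) (F n) < e / 3"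
      using metric_CauchyD[OF F, of "e / 3"] e by auto
    obtain M where M: "\<forall>n\<ge>M. dist (F n) (embed (X n)) < e / 3"
      using metric_LIMSEQ_D[OF FX, of "e / 3"] e by auto
    have "pnorm (X m - X n) < e" if "m \<ge> max N M" "n \<ge> max N M" for m n
    proof -
      have "pnorm (X m - X n) = dist (embed (X m)) (embed (X n))"
        by (simp add: dist_norm norm_embed flip: embed_diff)
      also have "\<dots> \<le> dist (F m) (embed (X m)) + dist (F m) (F n) + dist (F n) (embed (X n))"
        by metric
      also have "\<dots> < e / 3 + e / 3 + e / 3"
        using N M that by (intro add_strict_mono) auto
      finally show ?thesis by simp
    qed
    then show "\<exists>N. \<forall>m\<ge>N. \<forall>n\<ge>N. pnorm (X m - X n) < e" by blast
  qed
  then have "(\<lambda>n. embed (X n)) \<longlonglongrightarrow> abs_completion X" by (rule embed_limit)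
  moreover have "(\<lambda>n. F n - embed (X n)) \<longlonglongrightarrow> 0"
    using FX by (simp add: dist_norm tendsto_norm_zero_iff)
  ultimately have "(\<lambda>n. (F n - embed (X n)) + embed (X n)) \<longlonglongrightarrow> 0 + abs_completion X"
    by (intro tendsto_add)
  then show "convergent F" by (auto simp: convergent_def)
qed


section \<open>The Banach space projective tensor product\<close>

text \<open>
  The completion is Hausdorff by construction, so that it does not have to be known beforehand
  that the seminorm below is a norm.
\<close>

lemma sum_norm_nonneg:
  fixes M :: "('a::real_normed_vector \<times> 'b::real_normed_vector) multiset"
  shows "0 \<le> (\<Sum>(a, b)\<in>#M. norm a * norm b)"
  by (induction M) auto

instantiation atensor :: (banach_star_algebra, banach_star_algebra) seminormed_star_algebra
begin

definition pnorm_atensor :: "('a, 'b) atensor \<Rightarrow> real"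
  where "pnorm_atensor u =
    Inf {(\<Sum>(a, b)\<in>#M. norm a * norm b) | M. u = (\<Sum>(a, b)\<in>#M. a \<otimes> b)}"

lemma pnorm_atensor_le:
  fixes M :: "('a \<times> 'b) multiset"
  shows "pnorm (\<Sum>(a, b)\<in>#M. a \<otimes> b) \<le> (\<Sum>(a, b)\<in>#M. norm a * norm b)"
  unfolding pnorm_atensor_def
  by (rule cInf_lower) (auto intro!: bdd_belowI[of _ 0] sum_norm_nonneg)

lemma pnorm_atensor_approx:
  fixes u :: "('a, 'b) atensor"
  assumes "0 < e"
  obtains M where "u = (\<Sum>(a, b)\<in>#M. a \<otimes> b)"
    "(\<Sum>(a, b)\<in>#M. norm a * norm b) < pnorm u + e"
proof -
  let ?S = "{(\<Sum>(a, b)\<in>#M. norm a * norm b) | M. u = (\<Sum>(a, b)\<in>#M. a \<otimes> b)}"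
  have "?S \<noteq> {}" using atensor_is_sum[of u] by blast
  moreover have "Inf ?S < pnorm u + e"
    using assms by (simp add: pnorm_atensor_def)
  ultimately obtain t where "t \<in> ?S" "t < pnorm u + e" using cInf_lessD[of ?S "pnorm u + e"] by auto
  then obtain M where "t = (\<Sum>(a, b)\<in>#M. norm a * norm b)" "u = (\<Sum>(a, b)\<in>#M. a \<otimes> b)"
    by (elim CollectE exE conjE)
  with \<open>t < pnorm u + e\<close> show ?thesis using that[of M] by metis
qed

lemma pnorm_atensor_greatest:
  fixes u :: "('a, 'b) atensor"
  assumes "\<And>M. u = (\<Sum>(a, b)\<in>#M. a \<otimes> b) \<Longrightarrow> r \<le> (\<Sum>(a, b)\<in>#M. norm a * norm b)"
  shows "r \<le> pnorm u"
proof (rule field_le_epsilon)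
  fix e :: real assume "0 < e"
  then obtain M where "u = (\<Sum>(a, b)\<in>#M. a \<otimes> b)"
    "(\<Sum>(a, b)\<in>#M. norm a * norm b) < pnorm u + e"
    by (rule pnorm_atensor_approx)
  with assms[of M] show "r \<le> pnorm u + e" by linarith
qed

lemma pnorm_atensor_nonneg: "0 \<le> pnorm (u :: ('a, 'b) atensor)"
  by (rule pnorm_atensor_greatest) (auto intro!: sum_norm_nonneg)

lemma pnorm_atensor_scaleC_le: "pnorm (c *\<^sub>C u) \<le> cmod c * pnorm (u :: ('a, 'b) atensor)"
proof (cases "c = 0")
  case True
  then show ?thesis using pnorm_atensor_le[of "{#}"] by simp
next
  case False
  have "pnorm (c *\<^sub>C u) / cmod c \<le> pnorm u"
  proof (rule pnorm_atensor_greatest)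
    fix M assume u: "u = (\<Sum>(a, b)\<in>#M. a \<otimes> b)"
    let ?M = "image_mset (\<lambda>(a, b). (c *\<^sub>C a, b)) M"
    have 1: "c *\<^sub>C u = (\<Sum>(a, b)\<in>#?M. a \<otimes> b)"
      unfolding u by (induction M) (auto simp: complex_vector.scale_right_distrib scaleC_atensor)
    have 2: "(\<Sum>(a, b)\<in>#?M. norm a * norm b) = cmod c * (\<Sum>(a, b)\<in>#M. norm a * norm b)"
      by (induction M) (auto simp: norm_scaleC algebra_simps)
    show "pnorm (c *\<^sub>C u) / cmod c \<le> (\<Sum>(a, b)\<in>#M. norm a * norm b)"
      using pnorm_atensor_le[of ?M] False unfolding 1[symmetric] 2 by (simp add: field_simps)
  qed
  then show ?thesis using False by (simp add: field_simps)
qed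

lemma pnorm_atensor_star_le: "pnorm (star u) \<le> pnorm (u :: ('a, 'b) atensor)"
proof (rule pnorm_atensor_greatest)
  fix M assume u: "u = (\<Sum>(a, b)\<in>#M. a \<otimes> b)"
  let ?M = "image_mset (\<lambda>(a, b). (star a, star b)) M"
  have 1: "star u = (\<Sum>(a, b)\<in>#?M. a \<otimes> b)"
    unfolding u by (induction M) (auto simp: star_atensor_zero star_atensor star_atensor_add)
  have 2: "(\<Sum>(a, b)\<in>#?M. norm a * norm b) = (\<Sum>(a, b)\<in>#M. norm a * norm b)"
    by (induction M) (auto simp: norm_star)
  show "pnorm (star u) \<le> (\<Sum>(a, b)\<in>#M. norm a * norm b)"
    using pnorm_atensor_le[of ?M] unfolding 1[symmetric] 2 .
qed

lemma pnorm_atensor_triangle: "pnorm (u + v) \<le> pnorm u + pnorm (v :: ('a, 'b) atensor)"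
proof (rule field_le_epsilon)
  fix e :: real assume e: "0 < e"
  obtain M where M: "u = (\<Sum>(a, b)\<in>#M. a \<otimes> b)"
    "(\<Sum>(a, b)\<in>#M. norm a * norm b) < pnorm u + e / 2"
    by (rule pnorm_atensor_approx[OF half_gt_zero[OF e]])
  obtain N where N: "v = (\<Sum>(a, b)\<in>#N. a \<otimes> b)"
    "(\<Sum>(a, b)\<in>#N. norm a * norm b) < pnorm v + e / 2"
    by (rule pnorm_atensor_approx[OF half_gt_zero[OF e]])
  have "u + v = (\<Sum>(a, b)\<in>#M + N. a \<otimes> b)" using M N by simp
  then show "pnorm (u + v) \<le> pnorm u + pnorm v + e"
    using pnorm_atensor_le[of "M + N"] M(2) N(2) by simp
qed

lemma pnorm_atensor_mult_le_sum:
  fixes M N :: "('a \<times> 'b) multiset"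
  shows "pnorm ((\<Sum>(a, b)\<in>#M. a \<otimes> b) * (\<Sum>(c, d)\<in>#N. c \<otimes> d))
    \<le> (\<Sum>(a, b)\<in>#M. norm a * norm b) * (\<Sum>(c, d)\<in>#N. norm c * norm d)"
proof (induction M)
  case empty
  then show ?case using pnorm_atensor_le[of "{#}"] by simp
next
  case (add p M)
  obtain a b where p: "p = (a, b)" by force
  let ?N = "image_mset (\<lambda>(c, d). (a * c, b * d)) N"
  have 1: "(a \<otimes> b) * (\<Sum>(c, d)\<in>#N. c \<otimes> d) = (\<Sum>(c, d)\<in>#?N. c \<otimes> d)"
    by (induction N) (auto simp: atensor_mult distrib_left)
  have 2: "(\<Sum>(c, d)\<in>#?N. norm c * norm d)
      \<le> (norm a * norm b) * (\<Sum>(c, d)\<in>#N. norm c * norm d)"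
  proof (induction N)
    case (add q N)
    obtain c d where q: "q = (c, d)" by force
    have "norm (a * c) * norm (b * d) \<le> (norm a * norm c) * (norm b * norm d)"
      by (intro mult_mono norm_mult_ineq) auto
    with add show ?case by (simp add: q algebra_simps)
  qed simp
  have "pnorm ((a \<otimes> b) * (\<Sum>(c, d)\<in>#N. c \<otimes> d))
      \<le> (norm a * norm b) * (\<Sum>(c, d)\<in>#N. norm c * norm d)"
    using pnorm_atensor_le[of ?N] 2 unfolding 1 by linarith
  with add.IH show ?case
    using pnorm_atensor_triangle[of "(a \<otimes> b) * (\<Sum>(c, d)\<in>#N. c \<otimes> d)"
        "(\<Sum>(a, b)\<in>#M. a \<otimes> b) * (\<Sum>(c, d)\<in>#N. c \<otimes> d)"]
    by (simp add: p distrib_right)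
qed

instance
proof
  fix c :: complex and u v :: "('a, 'b) atensor"
  show "pnorm (u + v) \<le> pnorm u + pnorm v" by (rule pnorm_atensor_triangle)
  show "pnorm (c *\<^sub>C u) = cmod c * pnorm u"
  proof (cases "c = 0")
    case True
    then show ?thesis
      using pnorm_atensor_scaleC_le[of 0 u] pnorm_atensor_nonneg[of "0 *\<^sub>C u"] by simp
  next
    case False
    have "pnorm u \<le> cmod (inverse c) * pnorm (c *\<^sub>C u)"
      using pnorm_atensor_scaleC_le[of "inverse c" "c *\<^sub>C u"] False by simp
    then have "cmod c * pnorm u \<le> pnorm (c *\<^sub>C u)"
      using False unfolding norm_inverse by (simp add: field_simps)
    with pnorm_atensor_scaleC_le[of c u] show ?thesis by linarith
  qed
  show "pnorm (star u) = pnorm u"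
    using pnorm_atensor_star_le[of u] pnorm_atensor_star_le[of "star u"] by (simp add: star_star)
  show "pnorm (u * v) \<le> pnorm u * pnorm v"
  proof -
    have "(\<lambda>n. (pnorm u + inverse (real (Suc n))) * (pnorm v + inverse (real (Suc n))))
        \<longlonglongrightarrow> (pnorm u + 0) * (pnorm v + 0)"
      by (intro tendsto_intros LIMSEQ_inverse_real_of_nat)
    moreover have "pnorm (u * v)
        \<le> (pnorm u + inverse (real (Suc n))) * (pnorm v + inverse (real (Suc n)))" for n
    proof -
      have e: "0 < inverse (real (Suc n))" by simp
      obtain M where M: "u = (\<Sum>(a, b)\<in>#M. a \<otimes> b)"
        "(\<Sum>(a, b)\<in>#M. norm a * norm b) < pnorm u + inverse (real (Suc n))"
        by (rule pnorm_atensor_approx[OF e])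
      obtain N where N: "v = (\<Sum>(a, b)\<in>#N. a \<otimes> b)"
        "(\<Sum>(a, b)\<in>#N. norm a * norm b) < pnorm v + inverse (real (Suc n))"
        by (rule pnorm_atensor_approx[OF e])
      have "pnorm (u * v)
          \<le> (\<Sum>(a, b)\<in>#M. norm a * norm b) * (\<Sum>(a, b)\<in>#N. norm a * norm b)"
        unfolding M(1) N(1) by (rule pnorm_atensor_mult_le_sum)
      also have "\<dots> \<le> (pnorm u + inverse (real (Suc n))) * (pnorm v + inverse (real (Suc n)))"
        using M(2) N(2) by (intro mult_mono)
          (auto intro!: sum_norm_nonneg add_nonneg_nonneg pnorm_atensor_nonneg)
      finally show ?thesis .
    qed
    ultimately show ?thesis by (auto intro: LIMSEQ_le_const)
  qed
qed

end

type_synonym ('a, 'b) ptensor = "('a, 'b) atensor completion"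

definition ptensor ::
    "'a::banach_star_algebra \<Rightarrow> 'b::banach_star_algebra \<Rightarrow> ('a, 'b) ptensor"
    (infixr "\<otimes>\<^sub>\<gamma>" 72)
  where "a \<otimes>\<^sub>\<gamma> b = embed (a \<otimes> b)"

lemma ptensor_mult: "(a \<otimes>\<^sub>\<gamma> b) * (c \<otimes>\<^sub>\<gamma> d) = (a * c) \<otimes>\<^sub>\<gamma> (b * d)"
  by (simp add: ptensor_def atensor_mult flip: embed_mult)

lemma star_ptensor: "star (a \<otimes>\<^sub>\<gamma> b) = star a \<otimes>\<^sub>\<gamma> star b"
  by (simp add: ptensor_def star_atensor flip: embed_star)

text \<open>
  For subalgebras \<open>S\<close> and \<open>T\<close>, the set below is their projective tensor product, regarded as the
  closure of the algebraic tensor product of \<open>S\<close> and \<open>T\<close> in the large projective tensor product.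
\<close>

definition sub_ptensor ::
    "'a::banach_star_algebra set \<Rightarrow> 'b::banach_star_algebra set \<Rightarrow> ('a, 'b) ptensor set"
  where "sub_ptensor S T = closure (complex_vector.span {a \<otimes>\<^sub>\<gamma> b | a b. a \<in> S \<and> b \<in> T})"

end

theory Submission
  imports Defs "HOL-Computational_Algebra.Polynomial"
begin

text \<open>
  Elementary tensors of central elements are central, and the center is a closed subspace; the
  content is the converse inclusion. Let \<open>z\<close> be central in the projective tensor product of \<open>A\<close> and \<open>B\<close>.

  If \<open>A\<close> had the approximation property, the argument would be short: for a functional \<open>\<phi>\<close> on \<open>A\<close> the slice
  \<open>(\<phi> \<otimes> id) z\<close> is central in \<open>B\<close> (\<open>slice_center\<close>), and for a finite-rank operator \<open>T = \<Sum>\<^sub>i \<phi>\<^sub>i(\<cdot>) p\<^sub>i\<close> close to the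
  identity on the left entries of an approximation of \<open>z\<close>, the tensor \<open>(T \<otimes> id) z = \<Sum>\<^sub>i p\<^sub>i \<otimes> (\<phi>\<^sub>i \<otimes> id) z\<close> is
  close to \<open>z\<close> and has central right entries. C*-algebras need not have the approximation property, but
  \<open>z\<close> itself makes up for it. Since \<open>z\<close> commutes with \<open>A\<close> (\<open>central_left_map_commutes\<close>), it is almost
  fixed by the elementary operators \<open>E(a) = \<Sum> y* a y\<close> whose \<open>\<Sum> y* y\<close> is almost a unit, and it
  suffices that, on a given finite set, one such \<open>E\<close> is almost equal to an operator
  \<open>T(a) = \<Sum> \<phi>\<^sub>y(a) y* y\<close> with contractive functionals \<open>\<phi>\<^sub>y\<close>. This is \<open>nearly_finite_rank\<close>. It holds in
  every closed *-subalgebra \<open>S\<close>, with all \<open>y\<close> in \<open>S\<close>. Used first for \<open>S = A\<close>, it moves \<open>z\<close> into the closed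
  span of the \<open>a \<otimes> b\<close> with \<open>b\<close> central; used then for \<open>S\<close> the center of \<open>B\<close>, it makes the left entries
  central as well and keeps the right ones central. Both steps are \<open>central_mem_sub_ptensor\<close>.

  To find \<open>E\<close>, call \<open>y\<close> excising for self-adjoint \<open>a\<^sub>1, \<dots>, a\<^sub>n\<close> if there are scalars \<open>t\<^sub>i\<close> with
  \<open>- \<delta> y* y \<le> y* (a\<^sub>i - t\<^sub>i) y \<le> \<delta> y* y\<close>. Right multiples of excising elements are excising. If a closed
  ideal \<open>I\<close> of \<open>S\<close> misses some \<open>y\<close>, it misses an excising multiple of \<open>y\<close>: compress \<open>a - t\<close> by \<open>y\<close> and cut
  down to the positive or to the negative part, moving \<open>t\<close> along a grid of mesh \<open>\<delta>\<close>
  (\<open>exists_excising_multiple\<close>). So the \<open>x\<close> in \<open>S\<close> with \<open>x* x\<close> below some \<open>\<Sum> y* y\<close> with excising \<open>y\<close>,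
  which form an ideal, are dense in \<open>S\<close>, and normalising such a sum gives the almost unit
  (\<open>exists_excising_partition\<close>).

  This needs the order of a C*-algebra and functions of a self-adjoint element, which are developed in a
  unital C*-algebra and carried over by adjoining a unit. The functional calculus rests on the
  bound \<open>norm_peval_le\<close> of \<open>q(h)\<close> by the maximum of \<open>q\<close> on \<open>[- \<parallel>h\<parallel>, \<parallel>h\<parallel>]\<close>: after scaling, \<open>h\<close> is the
  imaginary part of a unitary, so that \<open>q(h)\<close> is a trigonometric polynomial in that unitary.
\<close>

section \<open>The polynomial bound for self-adjoint elements\<close>

lemma star_0 [simp]: "star (0 :: 'a::star_algebra) = 0"
  using star_add[of "0 :: 'a" 0] by simp

lemma star_uminus: "star (- x) = - star (x :: 'a::star_algebra)"
  using star_add[of x "- x"] by (simp add: eq_neg_iff_add_eq_0 add.commute)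

lemma star_sub: "star (x - y) = star x - star (y :: 'a::star_algebra)"
  using star_add[of x "- y"] by (simp add: star_uminus)

lemma star_scaleR: "star (r *\<^sub>R x) = r *\<^sub>R star (x :: 'a::star_algebra)"
  by (simp add: scaleR_scaleC star_scaleC)

lemma star_1 [simp]: "star (1 :: 'a::{star_algebra, real_algebra_1}) = 1"
proof -
  have "star (star (1 :: 'a) * 1) = star 1 * star (star 1)" by (rule star_mult)
  then show ?thesis by (simp add: star_star)
qed

lemma star_power: "star (x ^ n) = star (x :: 'a::{star_algebra, real_algebra_1}) ^ n"
  by (induction n) (simp_all add: star_mult power_commutes)

lemma bounded_linear_star: "bounded_linear (star :: 'a::banach_star_algebra \<Rightarrow> 'a)"
  by (rule bounded_linear_intro[of _ 1]) (auto simp: star_add star_scaleR norm_star)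

lemmas continuous_on_star = bounded_linear.continuous_on[OF bounded_linear_star]

lemma bounded_linear_scaleC: "bounded_linear (\<lambda>x :: 'a::banach_star_algebra. c *\<^sub>C x)"
  by (rule bounded_linear_intro[of _ "cmod c"])
    (auto simp: scaleC_add_right norm_scaleC scaleR_scaleC mult.commute)

lemma norm_sq_selfadjoint:
  "star h = h \<Longrightarrow> norm (h * h) = (norm (h :: 'a::cstar_algebra))\<^sup>2"
  using cstar_identity[of h] by simp

lemma norm_power_selfadjoint:
  fixes h :: "'a::{cstar_algebra, real_normed_algebra_1}"
  assumes "star h = h"
  shows "norm (h ^ (2 ^ k)) = norm h ^ (2 ^ k)"
proof (induction k)
  case (Suc k)
  have "norm (h ^ 2 ^ Suc k) = norm (h ^ 2 ^ k * h ^ 2 ^ k)"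
    by (simp add: power_mult mult.commute flip: power_add mult_2)
  also have "\<dots> = (norm h ^ 2 ^ k)\<^sup>2"
    by (subst norm_sq_selfadjoint) (auto simp: star_power assms Suc)
  also have "\<dots> = norm h ^ 2 ^ Suc k"
    by (simp add: mult.commute flip: power_mult)
  finally show ?case .
qed simp

text \<open>
  The equation \<open>(1 - v)\<^sup>2 = 1 - h\<^sup>2\<close> says \<open>v = (h\<^sup>2 + v\<^sup>2) / 2\<close>, and the right-hand side contracts the ball of
  radius \<open>\<parallel>h\<parallel>\<close> with ratio \<open>\<parallel>h\<parallel>\<close>. Its fixed point \<open>v\<close> gives the unitary \<open>u = 1 - v + i h\<close>. The last
  property is \<open>h = (u - u*) / 2i\<close> multiplied by \<open>u\<close>; in this form no adjoint occurs.
\<close>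

lemma exists_unitary_with_imaginary_part:
  fixes h :: "'a::{cstar_algebra, real_normed_algebra_1}"
  assumes h: "star h = h" "norm h < 1"
  obtains u where "star u * u = 1" "u * h = h * u" "u * h = (- \<i> / 2) *\<^sub>C (u * u - 1)"
proof -
  let ?S = "{v :: 'a. star v = v \<and> v * h = h * v \<and> norm v \<le> norm h}"
  let ?f = "\<lambda>v :: 'a. (1/2) *\<^sub>R (h * h + v * v)"
  have "closed ?S"
    by (intro closed_Collect_conj closed_Collect_eq closed_Collect_le continuous_on_star
        continuous_intros)
  then have "complete ?S" by (simp add: complete_eq_closed)
  moreover have "?S \<noteq> {}" by (auto intro!: exI[of _ 0])
  moreover have "?f ` ?S \<subseteq> ?S"
  proof safe
    fix v :: 'a assume v: "star v = v" "v * h = h * v" "norm v \<le> norm h"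
    show "star (?f v) = ?f v" by (simp add: star_scaleR star_add star_mult h v)
    show "?f v * h = h * ?f v"
      by (simp add: algebra_simps v) (metis mult.assoc v(2))
    have "norm (h * h + v * v) \<le> norm h * norm h + norm v * norm v"
      by (intro order_trans[OF norm_triangle_ineq] add_mono norm_mult_ineq)
    also have "\<dots> \<le> norm h * 1 + norm h * 1"
      using v h by (intro add_mono mult_mono) auto
    finally show "norm (?f v) \<le> norm h" by simp
  qed
  moreover have "\<forall>x\<in>?S. \<forall>y\<in>?S. dist (?f x) (?f y) \<le> norm h * dist x y"
  proof safe
    fix v w :: 'a
    assume vw: "norm v \<le> norm h" "norm w \<le> norm h"
    have "norm (v * v - w * w) = norm (v * (v - w) + (v - w) * w)"
      by (simp add: algebra_simps)
    also have "\<dots> \<le> norm v * norm (v - w) + norm (v - w) * norm w"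
      by (intro order_trans[OF norm_triangle_ineq] add_mono norm_mult_ineq)
    also have "\<dots> \<le> norm h * norm (v - w) + norm (v - w) * norm h"
      using vw by (intro add_mono mult_mono) auto
    finally have "norm (v * v - w * w) \<le> 2 * (norm h * norm (v - w))" by simp
    moreover have "?f v - ?f w = (1/2) *\<^sub>R (v * v - w * w)" by (simp add: algebra_simps)
    ultimately show "dist (?f v) (?f w) \<le> norm h * dist v w"
      by (simp add: dist_norm)
  qed
  ultimately have "\<exists>!v. v \<in> ?S \<and> ?f v = v"
    using h(2) by (intro Banach_fix[of ?S "norm h"]) auto
  then obtain v where v: "star v = v" "v * h = h * v" "?f v = v" by blast
  have v2: "h * h + v * v = 2 *\<^sub>R v" using arg_cong[OF v(3), of "\<lambda>x. 2 *\<^sub>R x"] by simp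
  define u where "u = 1 - v + \<i> *\<^sub>C h"
  have su: "star u = 1 - v - \<i> *\<^sub>C h"
    by (simp add: u_def star_add star_sub star_scaleC h v complex_vector.scale_minus_left)
  have vh: "h * v = v * h" using v(2) by simp
  have ii: "\<i> *\<^sub>C \<i> *\<^sub>C x = - x" for x :: 'a
    by (simp add: scaleC_scaleC scaleC_one complex_vector.scale_minus_left)
  have "star u * u = 1 - 2 *\<^sub>R v + (h * h + v * v)"
    unfolding su unfolding u_def
    by (simp add: algebra_simps mult_scaleC_left mult_scaleC_right ii vh scaleR_2)
  then have 1: "star u * u = 1" by (simp add: v2)
  have 2: "u * h = h * u"
    by (simp add: u_def algebra_simps mult_scaleC_left mult_scaleC_right vh)
  have "u * star u = 1 - 2 *\<^sub>R v + (h * h + v * v)"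
    unfolding su unfolding u_def
    by (simp add: algebra_simps mult_scaleC_left mult_scaleC_right ii vh scaleR_2)
  then have 3: "u * star u = 1" by (simp add: v2)
  have "u - star u = 2 *\<^sub>R (\<i> *\<^sub>C h)"
    unfolding su unfolding u_def by (simp add: scaleR_2)
  then have "u * (2 *\<^sub>R (\<i> *\<^sub>C h)) = u * u - 1" by (metis 3 right_diff_distrib)
  then have "u * u - 1 = \<i> *\<^sub>C (2 *\<^sub>R (u * h))"
    by (simp add: mult_scaleC_left mult_scaleC_right scaleR_2 algebra_simps scaleC_add_right)
  then have "- \<i> *\<^sub>C (u * u - 1) = 2 *\<^sub>R (u * h)"
    by (simp add: complex_vector.scale_minus_left ii)
  then have "(1/2) *\<^sub>R (- \<i> *\<^sub>C (u * u - 1)) = u * h" by simp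
  then have "u * h = (- \<i> / 2) *\<^sub>C (u * u - 1)"
    by (simp add: scaleR_scaleC scaleC_scaleC)
  with 1 2 show ?thesis using that[of u] by simp
qed

text \<open>
  Averaging over the roots of unity of order \<open>n + 1\<close>, weighted by \<open>z\<^sup>-\<^sup>k\<close>, isolates the coefficient with
  index \<open>k\<close>. Below, the weight is written as \<open>z\<close> to the power \<open>M - k\<close>.
\<close>

lemma coeff_bound_unit_circle:
  fixes c :: "nat \<Rightarrow> complex"
  assumes "\<And>z. cmod z = 1 \<Longrightarrow> cmod (\<Sum>l\<le>n. c l * z ^ l) \<le> m" and k: "k \<le> n"
  shows "cmod (c k) \<le> m"
proof -
  define M where "M = Suc n"
  define w where "w = exp (2 * of_real pi * \<i> / of_nat M)"
  have wp: "w ^ j = exp (2 * of_real pi * \<i> * of_nat j / of_nat M)" for j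
    by (simp add: w_def exp_of_nat_mult[symmetric] mult_ac)
  have w1: "cmod w = 1" by (simp add: w_def)
  have orth: "(\<Sum>j<M. (w ^ i) ^ j) = (if M dvd i then of_nat M else 0)" for i
  proof (cases "M dvd i")
    case True
    then have "w ^ i = 1" unfolding wp using complex_root_unity_eq_1[of M i] by (simp add: M_def)
    with True show ?thesis by simp
  next
    case False
    then have "w ^ i \<noteq> 1" unfolding wp using complex_root_unity_eq_1[of M i] by (simp add: M_def)
    moreover have "(w ^ i) ^ M = 1"
    proof -
      have "of_nat M \<noteq> (0 :: complex)" unfolding of_nat_eq_0_iff by (simp add: M_def)
      then have "w ^ M = 1" unfolding wp by simp
      then show ?thesis by (metis mult.commute power_mult power_one)
    qed
    ultimately show ?thesis using False by (simp add: geometric_sum)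
  qed
  have "(\<Sum>j<M. (w ^ j) ^ (M - k) * (\<Sum>l\<le>n. c l * (w ^ j) ^ l))
      = (\<Sum>l\<le>n. c l * (\<Sum>j<M. (w ^ (l + (M - k))) ^ j))"
  proof -
    have *: "(w ^ i) ^ j = (w ^ j) ^ i" for i j by (simp add: mult.commute flip: power_mult)
    show ?thesis
      unfolding sum_distrib_left *[of "_ + _"]
      by (subst sum.swap) (simp add: power_add mult_ac)
  qed
  also have "\<dots> = (\<Sum>l\<le>n. if l = k then c l * of_nat M else 0)"
  proof (rule sum.cong[OF HOL.refl])
    fix l assume l: "l \<in> {..n}"
    have "M dvd l + (M - k) \<longleftrightarrow> l = k"
    proof
      assume "M dvd l + (M - k)"
      then obtain q where q: "l + (M - k) = M * q" by (elim dvdE)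
      have "0 < l + (M - k)" "l + (M - k) < M * 2" using l k by (auto simp: M_def)
      then have "0 < M * q" "M * q < M * 2" unfolding q by auto
      then have "q = 1" by (cases q) auto
      then show "l = k" using q k by (simp add: M_def)
    qed (use k in \<open>simp add: M_def\<close>)
    then show "c l * (\<Sum>j<M. (w ^ (l + (M - k))) ^ j) = (if l = k then c l * of_nat M else 0)"
      unfolding orth by auto
  qed
  also have "\<dots> = c k * of_nat M" using k by (simp add: sum.delta)
  finally have "cmod (c k) * real M
      = cmod (\<Sum>j<M. (w ^ j) ^ (M - k) * (\<Sum>l\<le>n. c l * (w ^ j) ^ l))"
    by (simp add: norm_mult)
  also have "\<dots> \<le> (\<Sum>j<M. cmod ((w ^ j) ^ (M - k) * (\<Sum>l\<le>n. c l * (w ^ j) ^ l)))"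
    by (rule norm_sum)
  also have "\<dots> \<le> (\<Sum>j<M. m)"
    by (intro sum_mono) (simp add: norm_mult norm_power w1 assms(1))
  finally show ?thesis by (simp add: M_def mult.commute)
qed

text \<open>
  Horner evaluation, which does not ask the algebra to be commutative.
\<close>

definition peval :: "real poly \<Rightarrow> 'a::real_algebra_1 \<Rightarrow> 'a"
  where "peval p x = fold_coeffs (\<lambda>a y. a *\<^sub>R 1 + x * y) p 0"

lemma peval_0 [simp]: "peval 0 x = 0" by (simp add: peval_def)

lemma peval_pCons [simp]: "peval (pCons a p) x = a *\<^sub>R 1 + x * peval p x"
  by (cases "p = 0 \<and> a = 0") (auto simp: peval_def)

lemma peval_1 [simp]: "peval 1 x = 1" by (simp add: one_pCons)

lemma peval_add [simp]: "peval (p + q) x = peval p x + peval q x"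
  by (induction p q rule: poly_induct2) (simp_all add: algebra_simps)

lemma peval_smult [simp]: "peval (smult a p) x = a *\<^sub>R peval p x"
  by (induction p) (simp_all add: algebra_simps)

lemma peval_minus [simp]: "peval (- p) x = - peval p x"
  by (induction p) simp_all

lemma peval_diff [simp]: "peval (p - q) x = peval p x - peval q x"
  using peval_add[of p "- q" x] by simp

lemma peval_commutes:
  assumes "x * y = y * x"
  shows "peval p x * y = y * peval p x"
proof (induction p)
  case (pCons a p)
  have "x * peval p x * y = x * (y * peval p x)" by (simp add: pCons mult.assoc)
  also have "\<dots> = y * (x * peval p x)" by (metis assms mult.assoc)
  finally show ?case by (simp add: algebra_simps)
qed simp

lemma peval_mult [simp]: "peval (p * q) x = peval p x * peval q x"
proof (induction p)
  case (pCons a p)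
  then show ?case by (simp add: algebra_simps)
qed simp

lemma peval_power [simp]: "peval (p ^ n) x = peval p x ^ n"
  by (induction n) simp_all

lemma peval_pcompose: "peval (pcompose p q) x = peval p (peval q x)"
  by (induction p) (simp_all add: pcompose_pCons)

lemma star_peval:
  fixes h :: "'a::{star_algebra, real_algebra_1}"
  assumes "star h = h" shows "star (peval p h) = peval p h"
proof (induction p)
  case (pCons a p)
  then show ?case
    by (simp add: star_add star_scaleR star_mult assms peval_commutes[of h h])
qed simp

lemma tendsto_peval:
  fixes f :: "'b \<Rightarrow> 'a::{real_normed_algebra_1}"
  assumes "(f \<longlongrightarrow> x) F"
  shows "((\<lambda>t. peval p (f t)) \<longlongrightarrow> peval p x) F"
proof (induction p)
  case (pCons a p)
  then show ?case by (simp add: tendsto_intros assms)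
qed simp


text \<open>
  One sequence of coefficients gives the function \<open>F\<close> of \<open>z\<close> and the element \<open>T\<close> from \<open>u\<close>. Only the unit
  circle matters for \<open>F\<close>, which may therefore contain \<open>Im z\<close>.
\<close>

definition trig_poly ::
    "'a::{complex_vector, real_algebra_1} \<Rightarrow> nat \<Rightarrow> (complex \<Rightarrow> complex) \<Rightarrow> 'a \<Rightarrow> bool"
  where "trig_poly u n F T \<longleftrightarrow> (\<exists>c. (\<forall>z. cmod z = 1 \<longrightarrow> F z = (\<Sum>l\<le>n. c l * z ^ l)) \<and>
    T = (\<Sum>l\<le>n. c l *\<^sub>C u ^ l))"

lemma trig_poly_add:
  assumes "trig_poly u n F T" "trig_poly u n G U"
  shows "trig_poly u n (\<lambda>z. F z + G z) (T + U)"
proof -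
  obtain c d where "\<forall>z. cmod z = 1 \<longrightarrow> F z = (\<Sum>l\<le>n. c l * z ^ l)" "T = (\<Sum>l\<le>n. c l *\<^sub>C u ^ l)"
      "\<forall>z. cmod z = 1 \<longrightarrow> G z = (\<Sum>l\<le>n. d l * z ^ l)" "U = (\<Sum>l\<le>n. d l *\<^sub>C u ^ l)"
    using assms unfolding trig_poly_def by blast
  then show ?thesis unfolding trig_poly_def
    by (intro exI[of _ "\<lambda>l. c l + d l"])
      (simp add: sum.distrib distrib_right scaleC_add_left)
qed

lemma trig_poly_scale:
  assumes "trig_poly u n F T"
  shows "trig_poly u n (\<lambda>z. a * F z) (a *\<^sub>C T)"
proof -
  obtain c where "\<forall>z. cmod z = 1 \<longrightarrow> F z = (\<Sum>l\<le>n. c l * z ^ l)" "T = (\<Sum>l\<le>n. c l *\<^sub>C u ^ l)"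
    using assms unfolding trig_poly_def by blast
  then show ?thesis unfolding trig_poly_def
    by (intro exI[of _ "\<lambda>l. a * c l"])
      (simp add: sum_distrib_left mult.assoc complex_vector.scale_sum_right)
qed

lemma trig_poly_shift:
  fixes u :: "'a::{star_algebra, real_algebra_1}"
  assumes "trig_poly u n F T"
  shows "trig_poly u (Suc n) (\<lambda>z. z * F z) (u * T)"
proof -
  obtain c where "\<forall>z. cmod z = 1 \<longrightarrow> F z = (\<Sum>l\<le>n. c l * z ^ l)" "T = (\<Sum>l\<le>n. c l *\<^sub>C u ^ l)"
    using assms unfolding trig_poly_def by blast
  then show ?thesis unfolding trig_poly_def
    by (intro exI[of _ "\<lambda>l. case l of 0 \<Rightarrow> 0 | Suc l \<Rightarrow> c l"])
      (simp add: sum.atMost_Suc_shift sum_distrib_left mult_scaleC_right mult_ac del: sum.atMost_Suc)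
qed

lemma trig_poly_mono:
  assumes "trig_poly u n F T" "n \<le> k"
  shows "trig_poly u k F T"
proof -
  obtain c where c: "\<forall>z. cmod z = 1 \<longrightarrow> F z = (\<Sum>l\<le>n. c l * z ^ l)" "T = (\<Sum>l\<le>n. c l *\<^sub>C u ^ l)"
    using assms unfolding trig_poly_def by blast
  have "(\<Sum>l\<le>k. (if l \<le> n then c l else 0) * z ^ l) = (\<Sum>l\<le>n. c l * z ^ l)" for z
    by (intro sum.mono_neutral_cong_right) (use assms(2) in auto)
  moreover have "(\<Sum>l\<le>k. (if l \<le> n then c l else 0) *\<^sub>C u ^ l) = (\<Sum>l\<le>n. c l *\<^sub>C u ^ l)"
    by (intro sum.mono_neutral_cong_right) (use assms(2) in auto)
  ultimately show ?thesis unfolding trig_poly_def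
    by (intro exI[of _ "\<lambda>l. if l \<le> n then c l else 0"]) (use c in auto)
qed

lemma trig_poly_power:
  fixes u :: "'a::{star_algebra, real_algebra_1}"
  shows "trig_poly u n (\<lambda>z. z ^ n) (u ^ n)"
proof (induction n)
  case 0
  show ?case unfolding trig_poly_def by (intro exI[of _ "\<lambda>_. 1"]) simp
next
  case (Suc n)
  then show ?case using trig_poly_shift by fastforce
qed

text \<open>
  On the unit circle \<open>z Im z = - i / 2 (z\<^sup>2 - 1)\<close>, and \<open>u h\<close> satisfies the same identity. Each factor
  \<open>Im z\<close> or \<open>h\<close> is paired with one factor \<open>z\<close> or \<open>u\<close>, hence the power in front and the degree \<open>2 n\<close>.
\<close>

lemma trig_poly_peval:
  fixes u h :: "'a::{star_algebra, real_algebra_1}"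
  assumes uh: "u * h = h * u" "u * h = (- \<i> / 2) *\<^sub>C (u * u - 1)"
    and "degree q \<le> n"
  shows "trig_poly u (2 * n) (\<lambda>z. z ^ n * of_real (poly q (Im z))) (u ^ n * peval q h)"
  using assms(3)
proof (induction n arbitrary: q)
  case 0
  then obtain a where "q = [:a:]" using degree_eq_zeroE by blast
  then show ?case
    using trig_poly_scale[OF trig_poly_power[of u 0], of "of_real a"]
    by (simp add: scaleR_scaleC)
next
  case (Suc n)
  obtain a p where q: "q = pCons a p" by (cases q)
  have "degree p \<le> n" using Suc.prems by (auto simp: q degree_pCons_eq_if split: if_splits)
  note IH = Suc.IH[OF this]
  let ?F = "\<lambda>z. z ^ n * complex_of_real (poly p (Im z))" and ?T = "u ^ n * peval p h"
  have "trig_poly u (Suc (Suc (2 * n))) (\<lambda>z. (- \<i> / 2) * (z * (z * ?F z) + (- 1) * ?F z))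
      ((- \<i> / 2) *\<^sub>C (u * (u * ?T) + (- 1) *\<^sub>C ?T))"
    by (rule trig_poly_scale, rule trig_poly_add,
        (intro trig_poly_shift IH), rule trig_poly_mono[OF trig_poly_scale[OF IH]]) simp
  moreover have "trig_poly u (Suc (Suc (2 * n))) (\<lambda>z. of_real a * z ^ Suc n)
      (of_real a *\<^sub>C u ^ Suc n)"
    by (rule trig_poly_mono[OF trig_poly_scale[OF trig_poly_power]]) simp
  ultimately have "trig_poly u (Suc (Suc (2 * n)))
      (\<lambda>z. of_real a * z ^ Suc n + (- \<i> / 2) * (z * (z * ?F z) + (- 1) * ?F z))
      (of_real a *\<^sub>C u ^ Suc n + (- \<i> / 2) *\<^sub>C (u * (u * ?T) + (- 1) *\<^sub>C ?T))"
    by (intro trig_poly_add)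
  moreover have "of_real a *\<^sub>C u ^ Suc n + (- \<i> / 2) *\<^sub>C (u * (u * ?T) + (- 1) *\<^sub>C ?T)
      = u ^ Suc n * peval q h"
  proof -
    have "(- \<i> / 2) *\<^sub>C (u * (u * ?T) + (- 1) *\<^sub>C ?T) = ((- \<i> / 2) *\<^sub>C (u * u - 1)) * ?T"
      by (simp add: mult_scaleC_left algebra_simps complex_vector.scale_minus_left scaleC_one)
    also have "\<dots> = h * (u * u ^ n) * peval p h"
      by (simp only: uh(2)[symmetric] uh(1) mult.assoc)
    also have "h * (u * u ^ n) = u ^ Suc n * h"
      using power_commuting_commutes[OF uh(1), of "Suc n"] by simp
    finally show ?thesis by (simp add: q algebra_simps scaleR_scaleC mult_scaleC_right)
  qed
  moreover have "of_real a * z ^ Suc n + (- \<i> / 2) * (z * (z * ?F z) + (- 1) * ?F z)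
      = z ^ Suc n * of_real (poly q (Im z))" if "cmod z = 1" for z
  proof -
    have "z * cnj z = 1" using that by (simp add: complex_mult_cnj cmod_def)
    then have "z * z - 1 = z * (z - cnj z)" by (simp add: algebra_simps)
    also have "z - cnj z = of_real (2 * Im z) * \<i>" by (rule complex_diff_cnj)
    finally have *: "(- \<i> / 2) * (z * z - 1) = z * of_real (Im z)" by (simp add: mult_ac)
    have "(- \<i> / 2) * (z * (z * ?F z) + (- 1) * ?F z) = ((- \<i> / 2) * (z * z - 1)) * ?F z"
      by (simp add: field_simps)
    also have "\<dots> = z * of_real (Im z) * ?F z" by (simp only: *)
    finally show ?thesis by (simp only: q) (simp add: algebra_simps)
  qed
  ultimately show ?case unfolding trig_poly_def by simp
qed

text \<open>
  Estimating the terms one by one loses the factor \<open>n + 1\<close>. It disappears when the bound is applied to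
  powers and roots are taken.
\<close>

lemma norm_trig_poly:
  fixes u :: "'a::{cstar_algebra, real_normed_algebra_1}"
  assumes "trig_poly u n F T" and u: "norm u = 1"
    and F: "\<And>z. cmod z = 1 \<Longrightarrow> cmod (F z) \<le> m"
  shows "norm T \<le> real (Suc n) * m"
proof -
  obtain c where c: "\<forall>z. cmod z = 1 \<longrightarrow> F z = (\<Sum>l\<le>n. c l * z ^ l)" "T = (\<Sum>l\<le>n. c l *\<^sub>C u ^ l)"
    using assms unfolding trig_poly_def by blast
  have "norm T \<le> (\<Sum>l\<le>n. norm (c l *\<^sub>C u ^ l))" unfolding c(2) by (rule norm_sum)
  also have "\<dots> \<le> (\<Sum>l\<le>n. m)"
  proof (rule sum_mono)
    fix l assume l: "l \<in> {..n}"
    have "cmod (c l) \<le> m"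
      by (rule coeff_bound_unit_circle[where n = n]) (use l c(1) F in auto)
    moreover have "norm (u ^ l) \<le> 1" using norm_power_ineq[of u l] u by simp
    ultimately have "cmod (c l) * norm (u ^ l) \<le> m * 1"
      by (intro mult_mono) (auto intro: order_trans[OF norm_ge_zero])
    then show "norm (c l *\<^sub>C u ^ l) \<le> m" by (simp add: norm_scaleC)
  qed
  finally show ?thesis by simp
qed

lemma exponential_beats_linear:
  fixes a :: real
  assumes "1 < a"
  obtains k where "C * 2 ^ k + 1 < a ^ (2 ^ k)"
proof -
  define e where "e = sqrt a - 1"
  have e: "0 < e" using assms by (simp add: e_def)
  obtain k where k: "C / e\<^sup>2 < 2 ^ k" using real_arch_pow[of 2 "C / e\<^sup>2"] by auto
  have "1 + real (2 ^ k) * e \<le> (1 + e) ^ (2 ^ k)"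
    by (rule Bernoulli_inequality) (use e in simp)
  then have "(1 + real (2 ^ k) * e)\<^sup>2 \<le> ((1 + e) ^ (2 ^ k))\<^sup>2"
    using e by (intro power_mono) auto
  also have "\<dots> = ((1 + e)\<^sup>2) ^ (2 ^ k)" by (simp add: mult.commute flip: power_mult)
  also have "(1 + e)\<^sup>2 = a" using assms by (simp add: e_def)
  finally have "1 + 2 * (2 ^ k * e) + (2 ^ k * e)\<^sup>2 \<le> a ^ (2 ^ k)"
    by (simp add: power2_eq_square algebra_simps)
  moreover have "C * 2 ^ k < (2 ^ k * e)\<^sup>2"
  proof -
    have "C < 2 ^ k * e\<^sup>2" using k e by (simp add: field_simps)
    then have "C * 2 ^ k < (2 ^ k * e\<^sup>2) * 2 ^ k" by (rule mult_strict_right_mono) simp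
    then show ?thesis by (simp add: power2_eq_square algebra_simps)
  qed
  moreover have "0 < 2 ^ k * e" using e by simp
  ultimately show ?thesis using that[of k] by linarith
qed

text \<open>
  The crude bound for \<open>q\<^sup>N\<close>, with \<open>N\<close> a power of two, exceeds the \<open>N\<close>-th power of the maximum by a factor
  linear in \<open>N\<close> only, while \<open>\<parallel>q(h)\<^sup>N\<parallel> = \<parallel>q(h)\<parallel>\<^sup>N\<close> by the C*-identity.
\<close>

lemma norm_peval_le_of_norm_less_1:
  fixes h :: "'a::{cstar_algebra, real_normed_algebra_1}"
  assumes h: "star h = h" "norm h < 1"
    and m: "\<And>x. \<bar>x\<bar> \<le> 1 \<Longrightarrow> \<bar>poly q x\<bar> \<le> m"
  shows "norm (peval q h) \<le> m"
proof (rule ccontr)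
  assume "\<not> norm (peval q h) \<le> m"
  then have X: "m < norm (peval q h)" by simp
  have m0: "0 \<le> m" using m[of 0] by simp
  define m' where "m' = (norm (peval q h) + m) / 2"
  have m': "m \<le> m'" "0 < m'" "m' < norm (peval q h)" using X m0 by (auto simp: m'_def)
  obtain u where u: "star u * u = 1" "u * h = h * u" "u * h = (- \<i> / 2) *\<^sub>C (u * u - 1)"
    using exists_unitary_with_imaginary_part[OF h] .
  have nu: "norm u = 1"
    using cstar_identity[of u] u(1) norm_ge_zero[of u] by (simp add: power2_eq_1_iff)
  have iso: "norm (u ^ n * x) = norm x" for n and x :: 'a
  proof (induction n)
    case (Suc n)
    have *: "norm (u * y) = norm y" for y
    proof -
      have "(norm (u * y))\<^sup>2 = norm (star y * (star u * u) * y)"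
        unfolding cstar_identity[symmetric] star_mult by (simp add: mult.assoc)
      also have "\<dots> = (norm y)\<^sup>2" by (simp add: u cstar_identity)
      finally show ?thesis by simp
    qed
    show ?case using *[of "u ^ n * x"] Suc by (simp add: mult.assoc)
  qed simp
  obtain k where k: "2 * real (degree q) * 2 ^ k + 1 < (norm (peval q h) / m') ^ (2 ^ k)"
    using exponential_beats_linear[of "norm (peval q h) / m'"] m' by auto
  define n where "n = degree q * 2 ^ k"
  \<comment> \<open>Multiplication by the unitary is isometric and turns the left factor into a polynomial in it.\<close>
  have "norm (peval q h) ^ (2 ^ k) = norm (peval (q ^ (2 ^ k)) h)"
    by (simp add: norm_power_selfadjoint star_peval h)
  also have "\<dots> = norm (u ^ n * peval (q ^ (2 ^ k)) h)" by (simp add: iso)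
  also have "\<dots> \<le> real (Suc (2 * n)) * m' ^ (2 ^ k)"
  proof (rule norm_trig_poly[OF trig_poly_peval[OF u(2,3)] nu])
    show "degree (q ^ (2 ^ k)) \<le> n" unfolding n_def by (rule degree_power_le)
    fix z assume z: "cmod z = 1"
    have "\<bar>poly q (Im z)\<bar> \<le> m'" using m[of "Im z"] abs_Im_le_cmod[of z] z m'(1) by linarith
    then show "cmod (z ^ n * of_real (poly (q ^ 2 ^ k) (Im z))) \<le> m' ^ 2 ^ k"
      by (simp add: norm_mult norm_power z power_mono)
  qed
  finally have "(norm (peval q h) / m') ^ (2 ^ k) \<le> real (Suc (2 * n))"
    using m' by (simp add: power_divide field_simps)
  with k show False by (simp add: n_def)
qed

text \<open>
  The closed interval \<open>[- \<parallel>h\<parallel>, \<parallel>h\<parallel>]\<close> is reached from \<open>r h\<close> with \<open>r < 1\<close>, \<open>r \<rightarrow> 1\<close>.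
\<close>

lemma norm_peval_le:
  fixes h :: "'a::{cstar_algebra, real_normed_algebra_1}"
  assumes h: "star h = h" and m: "\<And>x. \<bar>x\<bar> \<le> norm h \<Longrightarrow> \<bar>poly q x\<bar> \<le> m"
  shows "norm (peval q h) \<le> m"
proof (cases "h = 0")
  case True
  have "peval q 0 = poly q 0 *\<^sub>R (1 :: 'a)" by (cases q) simp
  then show ?thesis using m[of 0] True by simp
next
  case False
  define R where "R = norm h"
  have R: "0 < R" using False by (simp add: R_def)
  have "norm (peval q (r *\<^sub>R h)) \<le> m" if r: "0 < r" "r < 1" for r
  proof -
    have "peval q (r *\<^sub>R h) = peval (pcompose q [:0, R:]) ((r / R) *\<^sub>R h)"
      using R by (simp add: peval_pcompose)
    moreover have "norm \<dots> \<le> m"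
    proof (rule norm_peval_le_of_norm_less_1)
      show "star ((r / R) *\<^sub>R h) = (r / R) *\<^sub>R h" by (simp add: star_scaleR h)
      show "norm ((r / R) *\<^sub>R h) < 1" using r R by (simp add: R_def)
      fix x :: real assume "\<bar>x\<bar> \<le> 1"
      then have "\<bar>x * R\<bar> \<le> norm h" using R by (simp add: abs_mult R_def mult_left_le_one_le)
      then show "\<bar>poly (pcompose q [:0, R:]) x\<bar> \<le> m" using m by (simp add: poly_pcompose)
    qed
    ultimately show ?thesis by simp
  qed
  then have ev: "\<forall>\<^sub>F r in at_left 1. norm (peval q (r *\<^sub>R h)) \<le> m"
    using eventually_at_left_real[of 0 1] by (auto elim: eventually_mono)
  have "((\<lambda>r. r *\<^sub>R h) \<longlongrightarrow> 1 *\<^sub>R h) (at_left 1)" by (intro tendsto_intros)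
  then have "((\<lambda>r. norm (peval q (r *\<^sub>R h))) \<longlongrightarrow> norm (peval q h)) (at_left 1)"
    using tendsto_norm[OF tendsto_peval] by fastforce
  then show ?thesis using ev tendsto_upperbound trivial_limit_at_left_real by blast
qed

section \<open>Continuous functional calculus\<close>

lemma exists_poly_near:
  assumes "continuous_on UNIV f" "0 < e"
  obtains q where "\<And>x :: real. \<bar>x\<bar> \<le> R \<Longrightarrow> \<bar>poly q x - f x\<bar> \<le> e"
proof -
  obtain g where g: "real_polynomial_function g" "\<And>x. x \<in> {-R..R} \<Longrightarrow> \<bar>f x - g x\<bar> < e"
    using Stone_Weierstrass_real_polynomial_function[of "{-R..R}" f e]
      continuous_on_subset[OF assms(1)] assms(2) by auto
  obtain a n where "g = (\<lambda>x. \<Sum>i\<le>n. a i * x ^ i)"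
    using g(1) real_polynomial_function_iff_sum by auto
  then have "poly (\<Sum>i\<le>n. monom (a i) i) x = g x" for x by (simp add: poly_sum poly_monom)
  then show ?thesis using that[of "\<Sum>i\<le>n. monom (a i) i"] g(2)
    by (metis abs_le_iff abs_minus_commute atLeastAtMost_iff less_imp_le minus_le_iff)
qed

text \<open>
  By \<open>norm_peval_le\<close>, the values at \<open>h\<close> of polynomials that converge to \<open>f\<close> uniformly on
  \<open>[- \<parallel>h\<parallel>, \<parallel>h\<parallel>]\<close> form a Cauchy sequence, whose limit does not depend on the choice of the polynomials.
\<close>

definition cfc :: "(real \<Rightarrow> real) \<Rightarrow> 'a::{cstar_algebra, real_normed_algebra_1} \<Rightarrow> 'a"
  where "cfc f h = lim (\<lambda>n. peval
    (SOME q. \<forall>x. \<bar>x\<bar> \<le> norm h \<longrightarrow> \<bar>poly q x - f x\<bar> \<le> inverse (real (Suc n))) h)"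

context
  fixes h :: "'a::{cstar_algebra, real_normed_algebra_1}"
  assumes h: "star h = h"
begin

lemma norm_peval_diff_le:
  assumes "\<And>x. \<bar>x\<bar> \<le> norm h \<Longrightarrow> \<bar>poly p x - f x\<bar> \<le> d"
    and "\<And>x. \<bar>x\<bar> \<le> norm h \<Longrightarrow> \<bar>poly q x - f x\<bar> \<le> e"
  shows "norm (peval p h - peval q h) \<le> d + e"
proof -
  have "norm (peval (p - q) h) \<le> d + e"
  proof (rule norm_peval_le[OF h])
    fix x assume "\<bar>x\<bar> \<le> norm h"
    from assms[OF this] show "\<bar>poly (p - q) x\<bar> \<le> d + e" by simp
  qed
  then show ?thesis by simp
qed

lemma norm_peval_cfc_le:
  assumes f: "continuous_on UNIV f"
    and q: "\<And>x. \<bar>x\<bar> \<le> norm h \<Longrightarrow> \<bar>poly q x - f x\<bar> \<le> e"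
  shows "norm (peval q h - cfc f h) \<le> e"
proof -
  define Q where "Q n = (SOME q. \<forall>x. \<bar>x\<bar> \<le> norm h \<longrightarrow> \<bar>poly q x - f x\<bar> \<le> inverse (real (Suc n)))"
    for n
  have Q: "\<bar>poly (Q n) x - f x\<bar> \<le> inverse (real (Suc n))" if "\<bar>x\<bar> \<le> norm h" for n x
  proof -
    have "\<exists>q. \<forall>x. \<bar>x\<bar> \<le> norm h \<longrightarrow> \<bar>poly q x - f x\<bar> \<le> inverse (real (Suc n))"
      using exists_poly_near[OF f, of "inverse (real (Suc n))" "norm h"] by auto
    from someI_ex[OF this] that show ?thesis unfolding Q_def by blast
  qed
  have "Cauchy (\<lambda>n. peval (Q n) h)"
  proof (rule metric_CauchyI)
    fix e :: real assume e: "0 < e"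
    obtain N where N: "inverse (real (Suc N)) < e / 2" using reals_Archimedean[of "e / 2"] e by auto
    have "dist (peval (Q m) h) (peval (Q n) h) < e" if "m \<ge> N" "n \<ge> N" for m n
    proof -
      have "dist (peval (Q m) h) (peval (Q n) h) \<le> inverse (real (Suc m)) + inverse (real (Suc n))"
        unfolding dist_norm by (rule norm_peval_diff_le) (fact Q)+
      also have "\<dots> \<le> inverse (real (Suc N)) + inverse (real (Suc N))"
        using that by (intro add_mono le_imp_inverse_le) auto
      finally show ?thesis using N by linarith
    qed
    then show "\<exists>N. \<forall>m\<ge>N. \<forall>n\<ge>N. dist (peval (Q m) h) (peval (Q n) h) < e" by blast
  qed
  then have lim: "(\<lambda>n. peval (Q n) h) \<longlonglongrightarrow> cfc f h"
    unfolding cfc_def Q_def[symmetric] using Cauchy_convergent convergent_LIMSEQ_iff by blast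
  have "(\<lambda>n. norm (peval q h - peval (Q n) h)) \<longlonglongrightarrow> norm (peval q h - cfc f h)"
    by (intro tendsto_intros lim)
  moreover have "(\<lambda>n. e + inverse (real (Suc n))) \<longlonglongrightarrow> e + 0"
    by (intro tendsto_intros LIMSEQ_inverse_real_of_nat)
  moreover have "norm (peval q h - peval (Q n) h) \<le> e + inverse (real (Suc n))" for n
    by (rule norm_peval_diff_le) (fact q Q)+
  ultimately show ?thesis using LIMSEQ_le by fastforce
qed

lemma cfc_approx:
  assumes "continuous_on UNIV f" "0 < e"
  obtains q where "\<And>x. \<bar>x\<bar> \<le> norm h \<Longrightarrow> \<bar>poly q x - f x\<bar> \<le> e" "norm (peval q h - cfc f h) \<le> e"
proof -
  obtain q where "\<And>x. \<bar>x\<bar> \<le> norm h \<Longrightarrow> \<bar>poly q x - f x\<bar> \<le> e"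
    using exists_poly_near[OF assms] by metis
  then show ?thesis using that norm_peval_cfc_le[OF assms(1)] by blast
qed

lemma cfc_eqI:
  assumes f: "continuous_on UNIV f"
    and ex: "\<And>e. 0 < e \<Longrightarrow> \<exists>q. (\<forall>x. \<bar>x\<bar> \<le> norm h \<longrightarrow> \<bar>poly q x - f x\<bar> \<le> e) \<and> norm (peval q h - a) \<le> e"
  shows "cfc f h = a"
proof -
  have "norm (cfc f h - a) \<le> 0 + e" if e: "0 < e" for e
  proof -
    have "0 < e / 2" using e by simp
    from ex[OF this] obtain q where q: "\<And>x. \<bar>x\<bar> \<le> norm h \<Longrightarrow> \<bar>poly q x - f x\<bar> \<le> e / 2"
      "norm (peval q h - a) \<le> e / 2" by blast
    have "norm (peval q h - cfc f h) \<le> e / 2" by (rule norm_peval_cfc_le[OF f q(1)])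
    then show ?thesis using norm_triangle_ineq4[of "peval q h - a" "peval q h - cfc f h"] q(2)
      by simp
  qed
  then have "norm (cfc f h - a) \<le> 0" by (rule field_le_epsilon)
  then show ?thesis by simp
qed

lemma norm_cfc_le:
  assumes f: "continuous_on UNIV f" and m: "\<And>x. \<bar>x\<bar> \<le> norm h \<Longrightarrow> \<bar>f x\<bar> \<le> m"
  shows "norm (cfc f h) \<le> m"
proof (rule field_le_epsilon)
  fix e :: real assume "0 < e"
  then have "0 < e / 2" by simp
  then obtain q where q: "\<And>x. \<bar>x\<bar> \<le> norm h \<Longrightarrow> \<bar>poly q x - f x\<bar> \<le> e / 2"
    "norm (peval q h - cfc f h) \<le> e / 2" using cfc_approx[OF f] by blast
  have "norm (peval q h) \<le> m + e / 2"
  proof (rule norm_peval_le[OF h])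
    fix x assume "\<bar>x\<bar> \<le> norm h"
    from q(1)[OF this] m[OF this] show "\<bar>poly q x\<bar> \<le> m + e / 2" by linarith
  qed
  then show "norm (cfc f h) \<le> m + e"
    using q(2) norm_triangle_ineq4[of "peval q h" "peval q h - cfc f h"] by simp
qed

lemma cfc_poly: "cfc (poly q) h = peval q h"
  by (rule cfc_eqI) (auto intro!: exI[of _ q] continuous_intros)

lemma cfc_cong:
  assumes f: "continuous_on UNIV f" and g: "continuous_on UNIV g"
    and eq: "\<And>x. \<bar>x\<bar> \<le> norm h \<Longrightarrow> f x = g x"
  shows "cfc f h = cfc g h"
proof (rule cfc_eqI[OF f])
  fix e :: real assume "0 < e"
  then obtain q where "\<And>x. \<bar>x\<bar> \<le> norm h \<Longrightarrow> \<bar>poly q x - g x\<bar> \<le> e"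
    "norm (peval q h - cfc g h) \<le> e" using cfc_approx[OF g] by blast
  then show "\<exists>q. (\<forall>x. \<bar>x\<bar> \<le> norm h \<longrightarrow> \<bar>poly q x - f x\<bar> \<le> e) \<and> norm (peval q h - cfc g h) \<le> e"
    by (intro exI[of _ q]) (auto simp: eq)
qed

lemma cfc_id: "cfc (\<lambda>x. x) h = h"
proof -
  have "poly [:0, 1:] = (\<lambda>x :: real. x)" by (simp add: fun_eq_iff)
  then show ?thesis using cfc_poly[of "[:0, 1:]"] by simp
qed

lemma cfc_const: "cfc (\<lambda>x. c) h = c *\<^sub>R 1"
proof -
  have "poly [:c:] = (\<lambda>x. c)" by (simp add: fun_eq_iff)
  then show ?thesis using cfc_poly[of "[:c:]"] by simp
qed

lemma cfc_add:
  assumes f: "continuous_on UNIV f" and g: "continuous_on UNIV g"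
  shows "cfc (\<lambda>x. f x + g x) h = cfc f h + cfc g h"
proof (rule cfc_eqI)
  show "continuous_on UNIV (\<lambda>x. f x + g x)" by (intro continuous_intros f g)
  fix e :: real assume "0 < e"
  then have e: "0 < e / 2" by simp
  obtain p where p: "\<And>x. \<bar>x\<bar> \<le> norm h \<Longrightarrow> \<bar>poly p x - f x\<bar> \<le> e / 2"
    "norm (peval p h - cfc f h) \<le> e / 2" using cfc_approx[OF f e] by blast
  obtain q where q: "\<And>x. \<bar>x\<bar> \<le> norm h \<Longrightarrow> \<bar>poly q x - g x\<bar> \<le> e / 2"
    "norm (peval q h - cfc g h) \<le> e / 2" using cfc_approx[OF g e] by blast
  have "\<bar>poly (p + q) x - (f x + g x)\<bar> \<le> e" if "\<bar>x\<bar> \<le> norm h" for x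
    using p(1)[OF that] q(1)[OF that] unfolding poly_add by linarith
  moreover have "norm (peval (p + q) h - (cfc f h + cfc g h)) \<le> e"
    using norm_triangle_ineq[of "peval p h - cfc f h" "peval q h - cfc g h"] p(2) q(2)
    by (simp add: algebra_simps)
  ultimately show "\<exists>r. (\<forall>x. \<bar>x\<bar> \<le> norm h \<longrightarrow> \<bar>poly r x - (f x + g x)\<bar> \<le> e) \<and>
      norm (peval r h - (cfc f h + cfc g h)) \<le> e" by blast
qed

lemma cfc_mult:
  assumes f: "continuous_on UNIV f" and g: "continuous_on UNIV g"
  shows "cfc (\<lambda>x. f x * g x) h = cfc f h * cfc g h"
proof (rule cfc_eqI)
  show "continuous_on UNIV (\<lambda>x. f x * g x)" by (intro continuous_intros f g)
  fix e :: real assume e: "0 < e"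
  have "compact ((\<lambda>x. \<bar>f x\<bar> + \<bar>g x\<bar>) ` {- norm h..norm h})"
    by (intro compact_continuous_image continuous_intros continuous_on_subset[OF f]
        continuous_on_subset[OF g]) auto
  then obtain K where K: "\<forall>y\<in>(\<lambda>x. \<bar>f x\<bar> + \<bar>g x\<bar>) ` {- norm h..norm h}. \<bar>y\<bar> \<le> K"
    using compact_imp_bounded bounded_real by metis
  have Kf: "\<bar>f x\<bar> \<le> K" and Kg: "\<bar>g x\<bar> \<le> K" if "\<bar>x\<bar> \<le> norm h" for x
  proof -
    have "\<bar>\<bar>f x\<bar> + \<bar>g x\<bar>\<bar> \<le> K" using K that by (auto simp: abs_le_iff)
    then show "\<bar>f x\<bar> \<le> K" "\<bar>g x\<bar> \<le> K" by auto
  qed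
  have K0: "0 \<le> K" using Kf[of 0] by simp
  define d where "d = min 1 (e / (2 * K + 1))"
  have d: "0 < d" "d \<le> 1" and de: "(K + 1) * d + K * d \<le> e"
  proof -
    show "0 < d" "d \<le> 1" using e K0 by (auto simp: d_def)
    have "d \<le> e / (2 * K + 1)" by (simp add: d_def)
    then have "(2 * K + 1) * d \<le> e" using K0 by (simp add: field_simps)
    then show "(K + 1) * d + K * d \<le> e" by (simp add: algebra_simps)
  qed
  obtain p where p: "\<And>x. \<bar>x\<bar> \<le> norm h \<Longrightarrow> \<bar>poly p x - f x\<bar> \<le> d"
    "norm (peval p h - cfc f h) \<le> d" using cfc_approx[OF f d(1)] by blast
  obtain q where q: "\<And>x. \<bar>x\<bar> \<le> norm h \<Longrightarrow> \<bar>poly q x - g x\<bar> \<le> d"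
    "norm (peval q h - cfc g h) \<le> d" using cfc_approx[OF g d(1)] by blast
  have pK: "\<bar>poly p x\<bar> \<le> K + 1" if "\<bar>x\<bar> \<le> norm h" for x
    using p(1)[OF that] Kf[OF that] d(2) by linarith
  have "\<bar>poly (p * q) x - f x * g x\<bar> \<le> e" if x: "\<bar>x\<bar> \<le> norm h" for x
  proof -
    have "\<bar>poly (p * q) x - f x * g x\<bar>
        = \<bar>poly p x * (poly q x - g x) + (poly p x - f x) * g x\<bar>"
      by (simp add: algebra_simps)
    also have "\<dots> \<le> \<bar>poly p x\<bar> * \<bar>poly q x - g x\<bar> + \<bar>poly p x - f x\<bar> * \<bar>g x\<bar>"
      unfolding abs_mult[symmetric] by (rule abs_triangle_ineq)
    also have "\<dots> \<le> (K + 1) * d + d * K"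
      by (intro add_mono mult_mono pK p q Kg x) (use K0 d in auto)
    finally show ?thesis using de by (simp add: mult.commute)
  qed
  moreover have "norm (peval (p * q) h - cfc f h * cfc g h) \<le> e"
  proof -
    have "norm (peval (p * q) h - cfc f h * cfc g h)
        = norm (peval p h * (peval q h - cfc g h) + (peval p h - cfc f h) * cfc g h)"
      by (simp add: algebra_simps)
    also have "\<dots> \<le> norm (peval p h) * norm (peval q h - cfc g h)
        + norm (peval p h - cfc f h) * norm (cfc g h)"
      by (intro order_trans[OF norm_triangle_ineq] add_mono norm_mult_ineq)
    also have "\<dots> \<le> (K + 1) * d + d * K"
      by (intro add_mono mult_mono p q norm_peval_le[OF h] pK norm_cfc_le g Kg)
        (use K0 d in auto)
    finally show ?thesis using de by (simp add: mult.commute)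
  qed
  ultimately show "\<exists>r. (\<forall>x. \<bar>x\<bar> \<le> norm h \<longrightarrow> \<bar>poly r x - (f x * g x)\<bar> \<le> e) \<and>
      norm (peval r h - (cfc f h * cfc g h)) \<le> e" by blast
qed

lemma cfc_scale: "continuous_on UNIV f \<Longrightarrow> cfc (\<lambda>x. c * f x) h = c *\<^sub>R cfc f h"
  by (simp add: cfc_mult cfc_const)

lemma cfc_minus: "continuous_on UNIV f \<Longrightarrow> cfc (\<lambda>x. - f x) h = - cfc f h"
  using cfc_scale[of f "-1"] by simp

lemma cfc_diff:
  "continuous_on UNIV f \<Longrightarrow> continuous_on UNIV g \<Longrightarrow> cfc (\<lambda>x. f x - g x) h = cfc f h - cfc g h"
  using cfc_add[of f "\<lambda>x. - g x"] by (simp add: cfc_minus continuous_on_minus)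

lemma star_cfc:
  assumes f: "continuous_on UNIV f" shows "star (cfc f h) = cfc f h"
proof (rule cfc_eqI[OF f, symmetric])
  fix e :: real assume "0 < e"
  then obtain q where q: "\<And>x. \<bar>x\<bar> \<le> norm h \<Longrightarrow> \<bar>poly q x - f x\<bar> \<le> e"
    "norm (peval q h - cfc f h) \<le> e" using cfc_approx[OF f] by blast
  have "norm (peval q h - star (cfc f h)) = norm (star (peval q h - cfc f h))"
    by (simp add: star_sub star_peval h)
  then show "\<exists>q. (\<forall>x. \<bar>x\<bar> \<le> norm h \<longrightarrow> \<bar>poly q x - f x\<bar> \<le> e) \<and> norm (peval q h - star (cfc f h)) \<le> e"
    using q by (intro exI[of _ q]) (auto simp: norm_star)
qed

end

section \<open>Closed *-subalgebras\<close>

definition cstar_subalgebra :: "'a::banach_star_algebra set \<Rightarrow> bool"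
  where "cstar_subalgebra S \<longleftrightarrow> closed S \<and> 0 \<in> S \<and> (\<forall>x\<in>S. \<forall>y\<in>S. x + y \<in> S) \<and>
    (\<forall>c. \<forall>x\<in>S. c *\<^sub>C x \<in> S) \<and> (\<forall>x\<in>S. \<forall>y\<in>S. x * y \<in> S) \<and> (\<forall>x\<in>S. star x \<in> S)"

context
  fixes S :: "'a::banach_star_algebra set"
  assumes S: "cstar_subalgebra S"
begin

lemma subalgebra_closed: "closed S" using S by (simp add: cstar_subalgebra_def)
lemma subalgebra_0: "0 \<in> S" using S by (simp add: cstar_subalgebra_def)
lemma subalgebra_add: "x \<in> S \<Longrightarrow> y \<in> S \<Longrightarrow> x + y \<in> S" using S by (simp add: cstar_subalgebra_def)
lemma subalgebra_scaleC: "x \<in> S \<Longrightarrow> c *\<^sub>C x \<in> S" using S by (simp add: cstar_subalgebra_def)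
lemma subalgebra_mult: "x \<in> S \<Longrightarrow> y \<in> S \<Longrightarrow> x * y \<in> S" using S by (simp add: cstar_subalgebra_def)
lemma subalgebra_star: "x \<in> S \<Longrightarrow> star x \<in> S" using S by (simp add: cstar_subalgebra_def)
lemma subalgebra_scaleR: "x \<in> S \<Longrightarrow> r *\<^sub>R x \<in> S"
  by (simp add: scaleR_scaleC subalgebra_scaleC)
lemma subalgebra_minus: "x \<in> S \<Longrightarrow> - x \<in> S" using subalgebra_scaleR[of x "-1"] by simp
lemma subalgebra_diff: "x \<in> S \<Longrightarrow> y \<in> S \<Longrightarrow> x - y \<in> S"
  using subalgebra_add[of x "- y"] subalgebra_minus by simp

lemmas subalgebra_intros = subalgebra_0 subalgebra_add subalgebra_scaleC subalgebra_mult
  subalgebra_star subalgebra_scaleR subalgebra_minus subalgebra_diff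

end

lemma closed_approach:
  fixes a :: "'a::real_normed_vector"
  assumes "closed S" "\<And>e. 0 < e \<Longrightarrow> \<exists>x\<in>S. norm (x - a) \<le> e"
  shows "a \<in> S"
proof -
  have "\<exists>x\<in>S. dist x a < e" if "0 < e" for e
    using assms(2)[of "e / 2"] that by (force simp: dist_norm)
  then have "a \<in> closure S" by (simp add: closure_approachable)
  with assms(1) show ?thesis by simp
qed

text \<open>A closed subspace stable under multiplication by \<open>h\<close> is stable under every \<open>f(h)\<close>.\<close>

lemma mult_cfc_mem:
  fixes h :: "'a::{cstar_algebra, real_normed_algebra_1}"
  assumes h: "star h = h" and f: "continuous_on UNIV f"
    and I: "closed I" "0 \<in> I" "\<And>x y. x \<in> I \<Longrightarrow> y \<in> I \<Longrightarrow> x + y \<in> I"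
      "\<And>r x. x \<in> I \<Longrightarrow> r *\<^sub>R x \<in> I" "\<And>x. x \<in> I \<Longrightarrow> x * h \<in> I"
    and y: "y \<in> I"
  shows "y * cfc f h \<in> I"
proof (rule closed_approach[OF I(1)])
  fix e :: real assume e: "0 < e"
  have *: "x * peval q h \<in> I" if "x \<in> I" for x q
    using that
  proof (induction q arbitrary: x)
    case (pCons a q)
    have "x * peval (pCons a q) h = a *\<^sub>R x + (x * h) * peval q h" by (simp add: algebra_simps)
    then show ?case using pCons I by simp
  qed (simp add: I)
  define d where "d = e / (norm y + 1)"
  have d: "0 < d" using e by (simp add: d_def add_nonneg_pos)
  obtain q where q: "norm (peval q h - cfc f h) \<le> d" using cfc_approx[OF h f d] by blast
  have "norm (y * peval q h - y * cfc f h) \<le> norm y * norm (peval q h - cfc f h)"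
    by (metis norm_mult_ineq right_diff_distrib)
  also have "\<dots> \<le> (norm y + 1) * d" using q d by (intro mult_mono) auto
  also have "\<dots> = e" by (simp add: d_def add_nonneg_pos less_imp_neq[symmetric])
  finally show "\<exists>x\<in>I. norm (x - y * cfc f h) \<le> e" using *[OF y] by blast
qed

lemma subalgebra_mult_cfc:
  fixes h :: "'a::{cstar_algebra, real_normed_algebra_1}"
  assumes S: "cstar_subalgebra S" and h: "star h = h" "h \<in> S" and f: "continuous_on UNIV f"
    and y: "y \<in> S"
  shows "y * cfc f h \<in> S"
  by (rule mult_cfc_mem[OF h(1) f])
    (auto intro: subalgebra_intros[OF S] subalgebra_closed[OF S] h y)

lemma subalgebra_cfc:
  fixes h :: "'a::{cstar_algebra, real_normed_algebra_1}"
  assumes S: "cstar_subalgebra S" and h: "star h = h" "h \<in> S"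
    and f: "continuous_on UNIV f" "f 0 = 0"
  shows "cfc f h \<in> S"
proof (rule closed_approach[OF subalgebra_closed[OF S]])
  fix e :: real assume "0 < e"
  then have "0 < e / 2" by simp
  then obtain q where q: "\<And>x. \<bar>x\<bar> \<le> norm h \<Longrightarrow> \<bar>poly q x - f x\<bar> \<le> e / 2"
    "norm (peval q h - cfc f h) \<le> e / 2" using cfc_approx[OF h(1) f(1)] by blast
  obtain a p where qp: "q = pCons a p" by (cases q)
  have pS: "h * peval p h \<in> S"
    using subalgebra_mult_cfc[OF S h _ h(2), of "poly p"] by (simp add: cfc_poly h continuous_intros)
  have "norm (h * peval p h - cfc f h) = norm (peval q h - cfc f h - a *\<^sub>R 1)"
    by (simp add: qp algebra_simps)
  also have "\<dots> \<le> norm (peval q h - cfc f h) + norm (a *\<^sub>R (1 :: 'a))" by (rule norm_triangle_ineq4)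
  also have "\<dots> \<le> e / 2 + e / 2" using q(1)[of 0] q(2) by (intro add_mono) (auto simp: qp f)
  finally show "\<exists>x\<in>S. norm (x - cfc f h) \<le> e" using pS by auto
qed


section \<open>The order on self-adjoint elements\<close>

text \<open>
  Positivity is expressed by the distance to a multiple of the unit: sums of positive elements are then
  positive by the triangle inequality, without any knowledge of spectra.
\<close>

definition pos :: "'a::{cstar_algebra, real_normed_algebra_1} \<Rightarrow> bool"
  where "pos a \<longleftrightarrow> star a = a \<and> (\<exists>t. norm (t *\<^sub>R 1 - a) \<le> t)"

lemma pos_star: "pos a \<Longrightarrow> star a = a" by (simp add: pos_def)

lemma pos_radius_mono:
  fixes a :: "'a::{cstar_algebra, real_normed_algebra_1}"
  assumes "norm (t *\<^sub>R 1 - a) \<le> t" "t \<le> s"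
  shows "norm (s *\<^sub>R 1 - a) \<le> s"
proof -
  have "s *\<^sub>R 1 - a = (s - t) *\<^sub>R 1 + (t *\<^sub>R 1 - a)" by (simp add: algebra_simps)
  then have "norm (s *\<^sub>R 1 - a) \<le> norm ((s - t) *\<^sub>R (1 :: 'a)) + norm (t *\<^sub>R 1 - a)"
    by (metis norm_triangle_ineq)
  then show ?thesis using assms by simp
qed

lemma pos_add:
  assumes "pos a" "pos b" shows "pos (a + b)"
proof -
  obtain s t where st: "norm (s *\<^sub>R 1 - a) \<le> s" "norm (t *\<^sub>R 1 - b) \<le> t"
    using assms by (auto simp: pos_def)
  have "norm ((s + t) *\<^sub>R 1 - (a + b)) = norm ((s *\<^sub>R 1 - a) + (t *\<^sub>R 1 - b))"
    by (simp add: algebra_simps)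
  also have "\<dots> \<le> s + t" by (intro order_trans[OF norm_triangle_ineq] add_mono st)
  finally show ?thesis using assms by (auto simp: pos_def star_add)
qed

lemma pos_0 [simp]: "pos 0" by (auto simp: pos_def intro: exI[of _ 0])

lemma pos_scaleR:
  assumes "pos a" "0 \<le> r" shows "pos (r *\<^sub>R a)"
proof -
  obtain t where t: "norm (t *\<^sub>R 1 - a) \<le> t" using assms by (auto simp: pos_def)
  have "norm ((r * t) *\<^sub>R 1 - r *\<^sub>R a) = r * norm (t *\<^sub>R 1 - a)"
    using assms(2) by (simp flip: scaleR_scaleR scaleR_diff_right)
  then have "norm ((r * t) *\<^sub>R 1 - r *\<^sub>R a) \<le> r * t" using t assms(2) by (simp add: mult_left_mono)
  then show ?thesis using assms by (auto simp: pos_def star_scaleR)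
qed

lemma pos_norm_minus: "star b = b \<Longrightarrow> pos (norm b *\<^sub>R 1 - b)"
  by (auto simp: pos_def star_sub star_scaleR intro!: exI[of _ "norm b"])

lemma pos_norm_plus: "star b = b \<Longrightarrow> pos (norm b *\<^sub>R 1 + b)"
  using pos_norm_minus[of "- b"] by (simp add: star_uminus)

lemma pos_square:
  assumes h: "star h = h" shows "pos (h * h)"
proof -
  let ?t = "(norm h)\<^sup>2"
  have "norm (peval [:?t, 0, -1:] h) \<le> ?t"
  proof (rule norm_peval_le[OF h])
    fix x assume "\<bar>x\<bar> \<le> norm h"
    then have "x\<^sup>2 \<le> ?t" by (metis abs_ge_zero power2_abs power_mono)
    then show "\<bar>poly [:?t, 0, -1:] x\<bar> \<le> ?t" by (simp add: power2_eq_square)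
  qed
  then have "norm (?t *\<^sub>R 1 - h * h) \<le> ?t" by simp
  then show ?thesis by (auto simp: pos_def star_mult h)
qed

text \<open>
  If \<open>\<parallel>t - a\<parallel>\<close> and \<open>\<parallel>t + a\<parallel>\<close> are at most \<open>t\<close>, then \<open>\<parallel>t\<^sup>2 + a\<^sup>2\<parallel> \<le> t\<^sup>2\<close> by the parallelogram identity. But
  \<open>a\<^sup>2 = (t\<^sup>2 + a\<^sup>2) f(a)\<close> with \<open>f(x) = x\<^sup>2 / (t\<^sup>2 + x\<^sup>2)\<close>, so that \<open>\<parallel>a\<parallel>\<^sup>2 \<le> t\<^sup>2 \<parallel>a\<parallel>\<^sup>2 / (t\<^sup>2 + \<parallel>a\<parallel>\<^sup>2)\<close>, which leaves
  only \<open>a = 0\<close>.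
\<close>

lemma pos_antisym:
  assumes "pos a" "pos (- a)"
  shows "a = 0"
proof (rule ccontr)
  assume "a \<noteq> 0"
  then have n: "0 < norm a" by simp
  have a: "star a = a" using assms by (simp add: pos_star)
  obtain r s where rs: "norm (r *\<^sub>R 1 - a) \<le> r" "norm (s *\<^sub>R 1 - - a) \<le> s"
    using assms by (auto simp: pos_def)
  define t where "t = max (max r s) 1"
  have t: "norm (t *\<^sub>R 1 - a) \<le> t" "norm (t *\<^sub>R 1 + a) \<le> t" "0 < t"
    using pos_radius_mono[OF rs(1), of t] pos_radius_mono[OF rs(2), of t] by (auto simp: t_def)
  let ?X = "t\<^sup>2 *\<^sub>R 1 + a * a"
  have "2 * norm ?X = norm (?X + ?X)" by (simp flip: scaleR_2)
  also have "?X + ?X = (t *\<^sub>R 1 - a) * (t *\<^sub>R 1 - a) + (t *\<^sub>R 1 + a) * (t *\<^sub>R 1 + a)"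
    by (simp add: algebra_simps power2_eq_square)
  also have "norm \<dots> \<le> norm (t *\<^sub>R 1 - a) * norm (t *\<^sub>R 1 - a) + norm (t *\<^sub>R 1 + a) * norm (t *\<^sub>R 1 + a)"
    by (intro order_trans[OF norm_triangle_ineq] add_mono norm_mult_ineq)
  also have "\<dots> \<le> t * t + t * t"
    using t by (intro add_mono mult_mono) auto
  finally have 1: "norm (t\<^sup>2 *\<^sub>R 1 + a * a) \<le> t\<^sup>2" by (simp add: power2_eq_square)
  define f where "f x = x\<^sup>2 / (t\<^sup>2 + x\<^sup>2)" for x
  have den: "t\<^sup>2 + x\<^sup>2 > 0" for x using t(3) by (simp add: add_pos_nonneg)
  have f: "continuous_on UNIV f"
    unfolding f_def by (intro continuous_intros) (use den in \<open>auto simp: less_imp_neq[symmetric]\<close>)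
  have "(t\<^sup>2 *\<^sub>R 1 + a * a) * cfc f a = cfc (\<lambda>x. (t\<^sup>2 + x * x) * f x) a"
    by (simp add: cfc_mult cfc_add cfc_const cfc_id a f continuous_intros)
  also have "(\<lambda>x. (t\<^sup>2 + x * x) * f x) = (\<lambda>x. x * x)"
    using den by (auto simp: f_def fun_eq_iff power2_eq_square less_imp_neq[symmetric])
  also have "cfc (\<lambda>x. x * x) a = a * a" by (simp add: cfc_mult cfc_id a)
  finally have "a * a = (t\<^sup>2 *\<^sub>R 1 + a * a) * cfc f a" by simp
  then have "(norm a)\<^sup>2 \<le> norm (t\<^sup>2 *\<^sub>R 1 + a * a) * norm (cfc f a)"
    using norm_sq_selfadjoint[OF a] norm_mult_ineq by metis
  also have "\<dots> \<le> t\<^sup>2 * ((norm a)\<^sup>2 / (t\<^sup>2 + (norm a)\<^sup>2))"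
  proof (intro mult_mono 1 norm_cfc_le a f)
    fix x assume "\<bar>x\<bar> \<le> norm a"
    then have "x\<^sup>2 \<le> (norm a)\<^sup>2" by (metis abs_ge_zero power2_abs power_mono)
    then have "x\<^sup>2 * (t\<^sup>2 + (norm a)\<^sup>2) \<le> (norm a)\<^sup>2 * (t\<^sup>2 + x\<^sup>2)"
      by (simp add: algebra_simps mult_left_mono)
    then show "\<bar>f x\<bar> \<le> (norm a)\<^sup>2 / (t\<^sup>2 + (norm a)\<^sup>2)"
      using den[of x] den[of "norm a"] by (simp add: f_def divide_simps)
  qed auto
  finally have "(norm a)\<^sup>2 * (t\<^sup>2 + (norm a)\<^sup>2) \<le> t\<^sup>2 * (norm a)\<^sup>2"
    using den[of "norm a"] by (simp add: field_simps)
  then have "(norm a)\<^sup>2 * (norm a)\<^sup>2 \<le> 0" by (simp add: algebra_simps)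
  then show False using n by (simp add: mult_le_0_iff)
qed

lemma pos_cfc:
  assumes a: "star a = a" and f: "continuous_on UNIV f" "\<And>x. 0 \<le> f x"
  shows "pos (cfc f a)"
proof -
  have c: "continuous_on UNIV (\<lambda>x. sqrt (f x))" by (intro continuous_intros f)
  have "cfc f a = cfc (\<lambda>x. sqrt (f x)) a * cfc (\<lambda>x. sqrt (f x)) a"
    by (simp add: f flip: cfc_mult[OF a c c])
  then show ?thesis using pos_square[OF star_cfc[OF a c]] by simp
qed

text \<open>
  With \<open>k = t - a\<close> and \<open>\<parallel>k\<parallel> \<le> t\<close>, the function \<open>t - x\<close> is nonnegative where the calculus for \<open>k\<close> sees it.
\<close>

lemma pos_exists_sqrt:
  assumes "pos a"
  obtains b where "star b = b" "a = b * b"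
proof -
  obtain t where t: "norm (t *\<^sub>R 1 - a) \<le> t" using assms by (auto simp: pos_def)
  define k where "k = t *\<^sub>R 1 - a"
  have k: "star k = k" using assms by (simp add: k_def star_sub star_scaleR pos_star)
  let ?f = "\<lambda>x. sqrt (max 0 (t - x))"
  have c: "continuous_on UNIV ?f" by (intro continuous_intros)
  have "cfc ?f k * cfc ?f k = cfc (\<lambda>x. max 0 (t - x)) k" by (simp flip: cfc_mult[OF k c c])
  also have "\<dots> = cfc (\<lambda>x. t - x) k"
    by (rule cfc_cong[OF k]) (use t in \<open>auto simp: k_def intro!: continuous_intros\<close>)
  also have "\<dots> = a" by (simp add: cfc_diff cfc_const cfc_id k) (simp add: k_def)
  finally show ?thesis using that[OF star_cfc[OF k c]] by simp
qed

text \<open>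
  Compressing \<open>a\<close> by its own negative part \<open>m\<close> gives \<open>- m\<^sup>3\<close>; similar compressions below also give
  minus a cube. As the cube itself is positive, it vanishes as soon as its negative is positive.
\<close>

lemma cfc_eq_0_of_pos_minus_cube:
  assumes a: "star a = a" and f: "continuous_on UNIV f" "\<And>x. 0 \<le> f x"
    and neg: "pos (- cfc (\<lambda>x. f x * f x * f x) a)"
  shows "cfc f a = 0"
proof -
  have "pos (cfc (\<lambda>x. f x * f x * f x) a)"
    by (rule pos_cfc[OF a]) (use f in \<open>auto intro!: continuous_intros\<close>)
  then have 0: "cfc (\<lambda>x. f x * f x * f x) a = 0" by (rule pos_antisym[OF _ neg])
  have "(cfc f a * cfc f a) * (cfc f a * cfc f a) = cfc (\<lambda>x. f x * f x * f x) a * cfc f a"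
    by (simp add: cfc_mult a f continuous_intros mult.assoc)
  then have "norm ((cfc f a * cfc f a) * (cfc f a * cfc f a)) = 0" by (simp add: 0)
  then show ?thesis
    by (simp add: norm_sq_selfadjoint star_mult star_cfc a f)
qed

text \<open>
  For \<open>E = t + w w*\<close> and \<open>D = t + w* w\<close> one has \<open>E w = w D\<close>. Hence \<open>E\<^sup>n = t\<^sup>n + w X w*\<close> with \<open>t \<parallel>X\<parallel> \<le> n t\<^sup>n\<close>
  as soon as \<open>\<parallel>D\<parallel> \<le> t\<close>, and taking roots of high order gives \<open>\<parallel>E\<parallel> \<le> t\<close>. This stands in for the equality
  of the nonzero spectra of \<open>w w*\<close> and \<open>w* w\<close>.
\<close>

lemma pos_minus_swap:
  assumes "pos (- (star w * w))"
  shows "pos (- (w * star w))"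
proof -
  obtain s where "norm (s *\<^sub>R 1 - - (star w * w)) \<le> s" using assms by (auto simp: pos_def)
  from pos_radius_mono[OF this, of "max s 1"]
  obtain t where t: "norm (t *\<^sub>R 1 + star w * w) \<le> t" "0 < t" by (metis diff_minus_eq_add
      less_max_iff_disj max.cobounded1 zero_less_one)
  define D where "D = t *\<^sub>R 1 + star w * w"
  define E where "E = t *\<^sub>R 1 + w * star w"
  have Ew: "E * w = w * D" by (simp add: D_def E_def algebra_simps)
  have pow: "\<exists>X. E ^ n = t ^ n *\<^sub>R 1 + w * X * star w \<and> t * norm X \<le> real n * t ^ n" for n
  proof (induction n)
    case 0
    show ?case by (intro exI[of _ 0]) simp
  next
    case (Suc n)
    then obtain X where X: "E ^ n = t ^ n *\<^sub>R 1 + w * X * star w" "t * norm X \<le> real n * t ^ n"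
      by blast
    have "E ^ Suc n = t ^ n *\<^sub>R E + E * w * X * star w" by (simp add: X algebra_simps)
    also have "\<dots> = t ^ Suc n *\<^sub>R 1 + w * (t ^ n *\<^sub>R 1 + D * X) * star w"
      unfolding Ew by (simp add: E_def algebra_simps)
    finally have 1: "E ^ Suc n = t ^ Suc n *\<^sub>R 1 + w * (t ^ n *\<^sub>R 1 + D * X) * star w" .
    have "norm (t ^ n *\<^sub>R 1 + D * X) \<le> norm (t ^ n *\<^sub>R (1 :: 'a)) + norm (D * X)"
      by (rule norm_triangle_ineq)
    also have "\<dots> \<le> t ^ n + t * norm X"
      using t norm_mult_ineq[of D X] mult_right_mono[OF t(1) norm_ge_zero[of X]]
      by (simp add: D_def)
    also have "\<dots> \<le> t ^ n + real n * t ^ n" using X by simp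
    finally have "t * norm (t ^ n *\<^sub>R 1 + D * X) \<le> t * (t ^ n + real n * t ^ n)"
      using t by (intro mult_left_mono) auto
    also have "\<dots> = real (Suc n) * t ^ Suc n" by (simp add: algebra_simps)
    finally show ?case using 1 by blast
  qed
  have sE: "star E = E" by (simp add: E_def star_add star_scaleR star_mult star_star)
  have "norm E \<le> t"
  proof (rule ccontr)
    assume "\<not> norm E \<le> t"
    then have "1 < norm E / t" using t by simp
    then obtain k where k: "norm w * norm w / t * 2 ^ k + 1 < (norm E / t) ^ (2 ^ k)"
      using exponential_beats_linear by blast
    obtain X where X: "E ^ (2 ^ k) = t ^ (2 ^ k) *\<^sub>R 1 + w * X * star w"
        "t * norm X \<le> real (2 ^ k) * t ^ (2 ^ k)" using pow by blast
    have "norm E ^ (2 ^ k) = norm (t ^ (2 ^ k) *\<^sub>R 1 + w * X * star w)"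
      using norm_power_selfadjoint[OF sE, of k] X by simp
    also have "\<dots> \<le> norm (t ^ (2 ^ k) *\<^sub>R (1 :: 'a)) + norm (w * X * star w)"
      by (rule norm_triangle_ineq)
    also have "norm (w * X * star w) \<le> norm w * norm X * norm w"
      by (intro order_trans[OF norm_mult_ineq] mult_mono norm_mult_ineq)
        (auto simp: norm_star)
    also have "norm X \<le> 2 ^ k * t ^ (2 ^ k) / t" using X t by (simp add: field_simps)
    finally have "norm E ^ (2 ^ k) \<le> t ^ (2 ^ k) + norm w * (2 ^ k * t ^ (2 ^ k) / t) * norm w"
      using t by (simp add: mult_left_mono mult_right_mono)
    also have "\<dots> = (norm w * norm w / t * 2 ^ k + 1) * t ^ (2 ^ k)"
      by (simp add: field_simps)
    finally have "(norm E / t) ^ (2 ^ k) \<le> norm w * norm w / t * 2 ^ k + 1"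
      using t by (simp add: power_divide divide_le_eq)
    with k show False by simp
  qed
  then show ?thesis
    by (auto simp: pos_def star_uminus star_mult star_star E_def intro!: exI[of _ t])
qed

abbreviation pos_part :: "real \<Rightarrow> real" where "pos_part x \<equiv> max 0 x"
abbreviation neg_part :: "real \<Rightarrow> real" where "neg_part x \<equiv> max 0 (- x)"

lemma cfc_pos_neg_part: "star a = a \<Longrightarrow> a = cfc pos_part a - cfc neg_part a"
proof -
  assume a: "star a = a"
  have "cfc pos_part a - cfc neg_part a = cfc (\<lambda>x. pos_part x - neg_part x) a"
    by (rule cfc_diff[OF a, symmetric]) (intro continuous_intros)+
  also have "(\<lambda>x. pos_part x - neg_part x) = (\<lambda>x. x)" by (auto simp: fun_eq_iff max_def)
  finally show ?thesis by (simp add: cfc_id a)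
qed

text \<open>
  Kaplansky's argument. Let \<open>m\<close> be the negative part of \<open>y* y\<close> and \<open>w = y m\<close>. Then \<open>w* w = - m\<^sup>3\<close> is
  negative, hence so is \<open>w w*\<close>; but \<open>w* w + w w*\<close> is a sum of two squares, so that \<open>w = 0\<close> and \<open>m = 0\<close>.
\<close>

lemma pos_star_mult: "pos (star y * y)"
proof -
  define a where "a = star y * y"
  have a: "star a = a" by (simp add: a_def star_mult star_star)
  define m where "m = cfc neg_part a"
  have cn: "continuous_on UNIV neg_part" by (intro continuous_intros)
  have m: "star m = m" by (simp add: m_def star_cfc[OF a cn])
  define w where "w = y * m"
  have "star w * w = m * a * m" by (simp add: w_def star_mult m a_def mult.assoc)
  also have "\<dots> = cfc (\<lambda>x. neg_part x * x * neg_part x) a"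
    using a by (simp add: m_def cfc_mult cn cfc_id continuous_intros)
  also have "(\<lambda>x. neg_part x * x * neg_part x) = (\<lambda>x. - (neg_part x * neg_part x * neg_part x))"
    by (auto simp: fun_eq_iff max_def)
  also have "cfc \<dots> a = - cfc (\<lambda>x. neg_part x * neg_part x * neg_part x) a"
    by (rule cfc_minus[OF a]) (intro continuous_intros)
  finally have ww: "star w * w = - cfc (\<lambda>x. neg_part x * neg_part x * neg_part x) a" .
  have "pos (cfc (\<lambda>x. neg_part x * neg_part x * neg_part x) a)"
    by (rule pos_cfc[OF a]) (auto intro!: continuous_intros)
  then have n1: "pos (- (star w * w))" by (simp add: ww)
  then have n2: "pos (- (w * star w))" by (rule pos_minus_swap)
  \<comment> \<open>Up to factors, the real and the imaginary part of w.\<close>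
  define h where "h = w + star w"
  define k where "k = \<i> *\<^sub>C (w - star w)"
  have hk: "star h = h" "star k = k"
    by (simp_all add: h_def k_def star_add star_sub star_scaleC star_star add.commute
        complex_vector.scale_minus_left flip: complex_vector.scale_minus_right)
  have "h * h + k * k = 2 *\<^sub>R (star w * w + w * star w)"
    by (simp add: h_def k_def mult_scaleC_left mult_scaleC_right scaleC_scaleC scaleC_one
        complex_vector.scale_minus_left algebra_simps scaleR_2)
  then have "pos (2 *\<^sub>R (star w * w + w * star w))"
    using pos_add[OF pos_square[OF hk(1)] pos_square[OF hk(2)]] by simp
  from pos_scaleR[OF this, of "1/2"] have "pos (star w * w + w * star w)" by simp
  from pos_add[OF this n1] have "pos (w * star w)" by simp
  then have "w * star w = 0" using pos_antisym n2 by blast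
  then have "norm (star (star w) * star w) = 0" by (simp add: star_star)
  then have "w = 0" by (simp add: cstar_identity norm_star)
  then have "pos (- cfc (\<lambda>x. neg_part x * neg_part x * neg_part x) a)" using ww by simp
  then have "cfc neg_part a = 0"
    by (intro cfc_eq_0_of_pos_minus_cube[OF a cn]) auto
  then have "a = cfc pos_part a" using cfc_pos_neg_part[OF a] by simp
  moreover have "pos (cfc pos_part a)" by (rule pos_cfc[OF a]) (auto intro!: continuous_intros)
  ultimately show ?thesis by (simp add: a_def)
qed

lemma pos_conj: "pos a \<Longrightarrow> pos (star x * a * x)"
proof -
  assume "pos a"
  then obtain b where "star b = b" "a = b * b" by (rule pos_exists_sqrt)
  then have "star x * a * x = star (b * x) * (b * x)" by (simp add: star_mult mult.assoc)
  then show ?thesis by (simp add: pos_star_mult)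
qed

lemma pos_eq_cfc_pos_part:
  assumes "pos a" shows "a = cfc pos_part a"
proof -
  have a: "star a = a" using assms by (rule pos_star)
  have cn: "continuous_on UNIV neg_part" by (intro continuous_intros)
  have "cfc neg_part a * a * cfc neg_part a = cfc (\<lambda>x. neg_part x * x * neg_part x) a"
    using a by (simp add: cfc_mult cn cfc_id continuous_intros)
  also have "(\<lambda>x. neg_part x * x * neg_part x) = (\<lambda>x. - (neg_part x * neg_part x * neg_part x))"
    by (auto simp: fun_eq_iff max_def)
  also have "cfc \<dots> a = - cfc (\<lambda>x. neg_part x * neg_part x * neg_part x) a"
    by (rule cfc_minus[OF a]) (intro continuous_intros)
  finally have "pos (- cfc (\<lambda>x. neg_part x * neg_part x * neg_part x) a)"
    using pos_conj[OF assms, of "cfc neg_part a"] by (simp add: star_cfc[OF a cn])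
  then have "cfc neg_part a = 0"
    by (intro cfc_eq_0_of_pos_minus_cube[OF a cn]) auto
  then show ?thesis using cfc_pos_neg_part[OF a] by simp
qed

text \<open>
  The element \<open>t - r a\<close> is negative on the part of \<open>a\<close> where \<open>r x > t\<close>. The cases \<open>r = 1\<close> and \<open>r = - 1\<close> bound
  \<open>a\<close> from above and from below.
\<close>

lemma cfc_excess_eq_0:
  assumes a: "star a = a" and p: "pos (t *\<^sub>R 1 - r *\<^sub>R a)"
  shows "cfc (\<lambda>x. max 0 (r * x - t)) a = 0"
proof -
  let ?f = "\<lambda>x. max 0 (r * x - t)"
  have c: "continuous_on UNIV ?f" by (intro continuous_intros)
  have lin: "cfc (\<lambda>x. t - r * x) a = t *\<^sub>R 1 - r *\<^sub>R a"
    by (simp add: cfc_diff cfc_scale cfc_const cfc_id a continuous_intros)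
  have "cfc ?f a * (t *\<^sub>R 1 - r *\<^sub>R a) * cfc ?f a = cfc (\<lambda>x. ?f x * (t - r * x) * ?f x) a"
    using a by (simp add: lin cfc_mult c continuous_intros)
  also have "(\<lambda>x. ?f x * (t - r * x) * ?f x) = (\<lambda>x. - (?f x * ?f x * ?f x))"
    by (auto simp: fun_eq_iff max_def algebra_simps)
  also have "cfc \<dots> a = - cfc (\<lambda>x. ?f x * ?f x * ?f x) a"
    by (rule cfc_minus[OF a]) (intro continuous_intros)
  finally have "pos (- cfc (\<lambda>x. ?f x * ?f x * ?f x) a)"
    using pos_conj[OF p, of "cfc ?f a"] by (simp add: star_cfc[OF a c])
  then show ?thesis by (intro cfc_eq_0_of_pos_minus_cube[OF a c]) auto
qed

lemma norm_le_of_pos: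
  assumes a: "star a = a" and p: "pos (t *\<^sub>R 1 - a)" "pos (t *\<^sub>R 1 + a)" and t: "0 \<le> t"
  shows "norm a \<le> t"
proof -
  have "a = cfc (\<lambda>x. (max (- t) (min t x) + max 0 (1 * x - t)) - max 0 ((-1) * x - t)) a"
  proof -
    have "(\<lambda>x. (max (- t) (min t x) + max 0 (1 * x - t)) - max 0 ((-1) * x - t)) = (\<lambda>x. x)"
      using t by (auto simp: fun_eq_iff max_def min_def)
    then show ?thesis by (simp only: cfc_id[OF a])
  qed
  also have "\<dots> = cfc (\<lambda>x. max (- t) (min t x)) a + cfc (\<lambda>x. max 0 (1 * x - t)) a
      - cfc (\<lambda>x. max 0 ((-1) * x - t)) a"
    by (subst cfc_diff[OF a] cfc_add[OF a], (intro continuous_intros)+)+ simp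
  also have "\<dots> = cfc (\<lambda>x. max (- t) (min t x)) a"
    using cfc_excess_eq_0[OF a, of t 1] cfc_excess_eq_0[OF a, of t "-1"] p by simp
  finally have "norm a = norm (cfc (\<lambda>x. max (- t) (min t x)) a)" by simp
  also have "\<dots> \<le> t" by (rule norm_cfc_le[OF a]) (use t in \<open>auto intro!: continuous_intros\<close>)
  finally show ?thesis .
qed

lemma norm_mono:
  assumes "star a = a" "star b = b" "pos (b - a)" "pos (b + a)"
  shows "norm a \<le> norm b"
proof (rule norm_le_of_pos[OF assms(1)])
  show "pos (norm b *\<^sub>R 1 - a)" using pos_add[OF pos_norm_minus[OF assms(2)] assms(3)] by simp
  show "pos (norm b *\<^sub>R 1 + a)" using pos_add[OF pos_norm_minus[OF assms(2)] assms(4)] by simp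
qed simp

lemma norm_mono_pos:
  assumes "pos a" "pos (b - a)"
  shows "norm a \<le> norm b"
proof (rule norm_mono)
  have "pos b" using pos_add[OF assms] by simp
  then show "star b = b" "pos (b + a)" using assms by (auto simp: pos_star pos_add)
qed (use assms in \<open>auto simp: pos_star\<close>)

lemma exists_pos_sqrt_in_subalgebra:
  assumes S: "cstar_subalgebra S" and s: "pos s" "s \<in> S"
  obtains b where "star b = b" "b \<in> S" "b * b = s"
proof -
  have ss: "star s = s" using s(1) by (rule pos_star)
  let ?f = "\<lambda>x. sqrt (pos_part x)"
  have c: "continuous_on UNIV ?f" by (intro continuous_intros)
  have "cfc ?f s * cfc ?f s = cfc pos_part s" by (simp flip: cfc_mult[OF ss c c])
  then show ?thesis
    using that[of "cfc ?f s"] star_cfc[OF ss c] subalgebra_cfc[OF S ss s(2) c]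
      pos_eq_cfc_pos_part[OF s(1)] by simp
qed

lemma continuous_on_inverse_sqrt:
  assumes "0 < \<eta>" shows "continuous_on UNIV (\<lambda>x :: real. 1 / sqrt (x\<^sup>2 + \<eta>))"
proof -
  have "x\<^sup>2 + \<eta> > 0" for x :: real using assms by (simp add: add_nonneg_pos)
  then show ?thesis by (intro continuous_intros) (auto simp: less_imp_neq[symmetric])
qed

text \<open>
  The element \<open>\<rho>\<close> plays the role of \<open>(b\<^sup>2 + \<eta>)\<^sup>-\<^sup>1\<^sup>/\<^sup>2\<close>, so that \<open>\<rho> b\<^sup>2 \<rho>\<close> acts as a unit up to \<open>\<surd>\<eta>\<close> on every \<open>x\<close>
  with \<open>x* x \<le> b\<^sup>2\<close>: compress this inequality by \<open>e = 1 - \<rho> b\<^sup>2 \<rho> = \<eta> / (b\<^sup>2 + \<eta>)\<close>, and note that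
  \<open>\<eta>\<^sup>2 r\<^sup>2 / (r\<^sup>2 + \<eta>)\<^sup>2 \<le> \<eta>\<close> for real \<open>r\<close>.
\<close>

lemma approximate_unit_below:
  fixes b :: "'a::{cstar_algebra, real_normed_algebra_1}"
  assumes b: "star b = b" and \<eta>: "0 < \<eta>"
  defines "\<rho> \<equiv> cfc (\<lambda>x. 1 / sqrt (x\<^sup>2 + \<eta>)) b"
  shows "star \<rho> = \<rho>" "norm (\<rho> * (b * b) * \<rho>) \<le> 1"
    "\<rho> * (b * b) * \<rho> = b * b * (\<rho> * \<rho>)"
    "\<And>x. pos (b * b - star x * x) \<Longrightarrow> (norm (x - x * (\<rho> * (b * b) * \<rho>)))\<^sup>2 \<le> \<eta>"
proof -
  have den: "x\<^sup>2 + \<eta> > 0" for x using \<eta> by (simp add: add_nonneg_pos)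
  note c = continuous_on_inverse_sqrt[OF \<eta>]
  show \<rho>: "star \<rho> = \<rho>" unfolding \<rho>_def by (rule star_cfc[OF b c])
  have bb: "b * b = cfc (\<lambda>x. x * x) b" by (simp add: cfc_mult cfc_id b)
  have cs: "continuous_on UNIV (\<lambda>x :: real. x * x)" by (intro continuous_intros)
  have "\<rho> * (b * b) * \<rho> = cfc (\<lambda>x. 1 / sqrt (x\<^sup>2 + \<eta>) * (x * x) * (1 / sqrt (x\<^sup>2 + \<eta>))) b"
    unfolding \<rho>_def bb
    by (simp only: cfc_mult[OF b c cs] cfc_mult[OF b continuous_on_mult[OF c cs] c])
  also have "(\<lambda>x. 1 / sqrt (x\<^sup>2 + \<eta>) * (x * x) * (1 / sqrt (x\<^sup>2 + \<eta>))) = (\<lambda>x. x\<^sup>2 / (x\<^sup>2 + \<eta>))"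
    using den by (auto simp: fun_eq_iff power2_eq_square less_imp_le)
  finally have e: "\<rho> * (b * b) * \<rho> = cfc (\<lambda>x. x\<^sup>2 / (x\<^sup>2 + \<eta>)) b" .
  have ce: "continuous_on UNIV (\<lambda>x. x\<^sup>2 / (x\<^sup>2 + \<eta>))"
    by (intro continuous_intros) (use den in \<open>auto simp: less_imp_neq[symmetric]\<close>)
  show "norm (\<rho> * (b * b) * \<rho>) \<le> 1" unfolding e
    by (rule norm_cfc_le[OF b ce]) (use den \<eta> in \<open>auto simp: divide_le_eq\<close>)
  have "\<rho> * (b * b) = b * b * \<rho>"
    unfolding \<rho>_def bb by (simp add: mult.commute flip: cfc_mult[OF b c cs] cfc_mult[OF b cs c])
  then show "\<rho> * (b * b) * \<rho> = b * b * (\<rho> * \<rho>)" by (simp add: mult.assoc)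
  fix x assume x: "pos (b * b - star x * x)"
  define f where "f x = 1 - x\<^sup>2 / (x\<^sup>2 + \<eta>)" for x
  have cf: "continuous_on UNIV f" unfolding f_def by (intro continuous_intros ce)
  have f: "1 - \<rho> * (b * b) * \<rho> = cfc f b"
    unfolding e f_def by (simp add: cfc_diff b ce cfc_const)
  have sf: "star (cfc f b) = cfc f b" by (rule star_cfc[OF b cf])
  have "(norm (x * cfc f b))\<^sup>2 = norm (cfc f b * (star x * x) * cfc f b)"
    unfolding cstar_identity[symmetric] by (simp add: star_mult sf mult.assoc)
  also have "\<dots> \<le> norm (cfc f b * (b * b) * cfc f b)"
  proof (rule norm_mono_pos)
    show "pos (cfc f b * (star x * x) * cfc f b)"
      using pos_conj[OF pos_star_mult, of "cfc f b" x] by (simp add: sf)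
    show "pos (cfc f b * (b * b) * cfc f b - cfc f b * (star x * x) * cfc f b)"
      using pos_conj[OF x, of "cfc f b"] by (simp add: sf algebra_simps)
  qed
  also have "cfc f b * (b * b) * cfc f b = cfc (\<lambda>x. f x * (x * x) * f x) b"
    unfolding bb by (simp only: cfc_mult[OF b cf cs] cfc_mult[OF b continuous_on_mult[OF cf cs] cf])
  also have "norm \<dots> \<le> \<eta>"
  proof (rule norm_cfc_le[OF b])
    show "continuous_on UNIV (\<lambda>x. f x * (x * x) * f x)" by (intro continuous_intros cf)
    fix x :: real
    have f: "f x = \<eta> / (x\<^sup>2 + \<eta>)" using den[of x] by (simp add: f_def field_simps)
    have "f x * (x * x) * f x = \<eta> * (\<eta> / (x\<^sup>2 + \<eta>)) * (x\<^sup>2 / (x\<^sup>2 + \<eta>))"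
      by (simp add: f power2_eq_square)
    also have "\<dots> \<le> \<eta> * 1 * 1"
      using den[of x] \<eta> by (intro mult_mono) (auto simp: divide_le_eq)
    finally show "\<bar>f x * (x * x) * f x\<bar> \<le> \<eta>" using \<eta> den[of x] by (simp add: f)
  qed
  finally show "(norm (x - x * (\<rho> * (b * b) * \<rho>)))\<^sup>2 \<le> \<eta>"
    unfolding f[symmetric] by (simp add: right_diff_distrib)
qed

section \<open>Excision\<close>

text \<open>
  On the right ideal generated by \<open>y\<close>, the element \<open>a\<close> looks like the scalar \<open>t\<close> up to \<open>\<delta>\<close>.
\<close>

definition excises :: "'a \<Rightarrow> real \<Rightarrow> real \<Rightarrow> 'a::{cstar_algebra, real_normed_algebra_1} \<Rightarrow> bool"
  where "excises a \<delta> t y \<longleftrightarrow> pos (\<delta> *\<^sub>R (star y * y) - star y * (a - t *\<^sub>R 1) * y) \<and>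
    pos (\<delta> *\<^sub>R (star y * y) + star y * (a - t *\<^sub>R 1) * y)"

lemma excises_mult:
  assumes "excises a \<delta> t y" shows "excises a \<delta> t (y * w)"
proof -
  have "\<delta> *\<^sub>R (star (y * w) * (y * w)) - star (y * w) * (a - t *\<^sub>R 1) * (y * w)
      = star w * (\<delta> *\<^sub>R (star y * y) - star y * (a - t *\<^sub>R 1) * y) * w"
    "\<delta> *\<^sub>R (star (y * w) * (y * w)) + star (y * w) * (a - t *\<^sub>R 1) * (y * w)
      = star w * (\<delta> *\<^sub>R (star y * y) + star y * (a - t *\<^sub>R 1) * y) * w"
    by (simp_all add: star_mult algebra_simps)
  with assms show ?thesis unfolding excises_def using pos_conj by metis
qed

context
  fixes S I :: "'a::{cstar_algebra, real_normed_algebra_1} set"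
  assumes S: "cstar_subalgebra S"
    and I: "closed I" "0 \<in> I" "\<And>x y. x \<in> I \<Longrightarrow> y \<in> I \<Longrightarrow> x + y \<in> I"
      "\<And>r x. x \<in> I \<Longrightarrow> r *\<^sub>R x \<in> I"
    and I_left: "\<And>w x. w \<in> S \<Longrightarrow> x \<in> I \<Longrightarrow> w * x \<in> I"
    and I_right: "\<And>w x. w \<in> S \<Longrightarrow> x \<in> I \<Longrightarrow> x * w \<in> I"
begin

lemma ideal_mult_cfc:
  assumes "star h = h" "h \<in> S" "continuous_on UNIV f" "y \<in> I"
  shows "y * cfc f h \<in> I"
  by (rule mult_cfc_mem) (use I I_right assms in auto)

text \<open>
  The function \<open>f\<^sup>3 / (f\<^sup>2 + e\<^sup>2)\<close> differs from \<open>f\<close> by at most \<open>e\<close>.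
\<close>

lemma ideal_cube_root:
  assumes c: "star c = c" "c \<in> S" and f: "continuous_on UNIV f" "\<And>x. 0 \<le> f x"
    and cube: "cfc (\<lambda>x. f x * f x * f x) c \<in> I"
  shows "cfc f c \<in> I"
proof (rule closed_approach[OF I(1)])
  fix e :: real assume e: "0 < e"
  have den: "(f x)\<^sup>2 + e\<^sup>2 > 0" for x using e by (simp add: add_nonneg_pos)
  define g where "g x = 1 / ((f x)\<^sup>2 + e\<^sup>2)" for x
  have g: "continuous_on UNIV g"
    unfolding g_def by (intro continuous_intros f) (use den in \<open>auto simp: less_imp_neq[symmetric]\<close>)
  have f3: "continuous_on UNIV (\<lambda>x. f x * f x * f x)" by (intro continuous_intros f)
  have "norm (cfc (\<lambda>x. f x * f x * f x) c * cfc g c - cfc f c)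
      = norm (cfc (\<lambda>x. f x * f x * f x * g x - f x) c)"
    by (subst cfc_diff[OF c(1)]) (simp_all add: cfc_mult c g f f3 continuous_intros)
  also have "\<dots> \<le> e"
  proof (rule norm_cfc_le[OF c(1)])
    show "continuous_on UNIV (\<lambda>x. f x * f x * f x * g x - f x)" by (intro continuous_intros f g)
    fix x
    have "f x * f x * f x * g x - f x = - (f x * e\<^sup>2 / ((f x)\<^sup>2 + e\<^sup>2))"
    proof -
      define D where "D = (f x)\<^sup>2 + e\<^sup>2"
      have "f x * f x = D - e\<^sup>2" by (simp add: D_def power2_eq_square)
      moreover have "D \<noteq> 0" using den[of x] unfolding D_def by (metis less_irrefl)
      moreover have "g x = 1 / D" by (simp add: g_def D_def)
      moreover have "f x * (D - e\<^sup>2) * (1 / D) - f x = - (f x * e\<^sup>2 / D)"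
        using \<open>D \<noteq> 0\<close> by (simp add: field_simps)
      ultimately have "f x * (f x * f x) * g x - f x = - (f x * e\<^sup>2 / D)" by simp
      then show ?thesis by (simp add: D_def mult.assoc)
    qed
    then have "\<bar>f x * f x * f x * g x - f x\<bar> = f x * e\<^sup>2 / ((f x)\<^sup>2 + e\<^sup>2)"
      using den[of x] f(2)[of x] by simp
    also have "\<dots> \<le> e"
    proof -
      have "0 \<le> (f x - e)\<^sup>2" by simp
      then have "f x * e \<le> (f x)\<^sup>2 + e\<^sup>2"
        using mult_nonneg_nonneg[OF f(2)[of x] less_imp_le[OF e]] unfolding power2_diff by linarith
      then have "f x * e * e \<le> ((f x)\<^sup>2 + e\<^sup>2) * e" using e by (intro mult_right_mono) auto
      then show ?thesis using den[of x] by (simp add: divide_le_eq power2_eq_square algebra_simps)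
    qed
    finally show "\<bar>f x * f x * f x * g x - f x\<bar> \<le> e" .
  qed
  finally show "\<exists>x\<in>I. norm (x - cfc f c) \<le> e"
    using ideal_mult_cfc[OF c g cube] by blast
qed

lemma subalgebra_compression:
  assumes "y \<in> S" "a \<in> S" shows "star y * (a - t *\<^sub>R 1) \<in> S"
proof -
  have "star y * (a - t *\<^sub>R 1) = star y * a - t *\<^sub>R star y" by (simp add: algebra_simps)
  then show ?thesis using assms by (simp add: subalgebra_intros[OF S])
qed

text \<open>
  The difference \<open>c(t) - c(t + \<delta>) = \<delta> y* y\<close> is at most the sum of the positive part of \<open>c(t)\<close> and the
  negative part of \<open>c(t + \<delta>)\<close>. If the ideal contained \<open>y\<close> times either part, it would contain the parts,
  because \<open>f c f\<close> is plus or minus the cube of such a part \<open>f\<close> and has a right factor \<open>y f\<close>. Then \<open>y* y\<close>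
  would lie below a positive element of the ideal, and the ideal would contain \<open>y\<close> by
  \<open>approximate_unit_below\<close>.
\<close>

lemma spectral_dichotomy:
  fixes \<delta> :: real
  assumes a: "star a = a" "a \<in> S" and y: "y \<in> S" "y \<notin> I" and \<delta>: "0 < \<delta>"
  defines "c \<equiv> \<lambda>t. star y * (a - t *\<^sub>R 1) * y"
  shows "y * cfc pos_part (c t) \<notin> I \<or> y * cfc neg_part (c (t + \<delta>)) \<notin> I"
proof (rule ccontr)
  assume "\<not> ?thesis"
  then have inI: "y * cfc pos_part (c t) \<in> I" "y * cfc neg_part (c (t + \<delta>)) \<in> I" by auto
  have sc: "star (c t) = c t" for t
    by (simp add: c_def star_mult star_sub star_scaleR star_star a mult.assoc)
  have cS: "c t \<in> S" for t
    unfolding c_def using subalgebra_mult[OF S subalgebra_compression] y a by blast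
  have cp: "continuous_on UNIV pos_part" and cn: "continuous_on UNIV neg_part"
    by (intro continuous_intros)+
  have part: "cfc f (c t) \<in> I"
    if f: "continuous_on UNIV f" "\<And>x. 0 \<le> f x" "f 0 = 0" and r: "\<And>x. f x * x * f x = r * (f x * f x * f x)"
      and r2: "r * r = 1" and fI: "y * cfc f (c t) \<in> I" for f t r
  proof (rule ideal_cube_root[OF sc cS f(1,2)])
    have "cfc f (c t) \<in> S" by (rule subalgebra_cfc[OF S sc cS f(1,3)])
    then have "cfc f (c t) * (star y * (a - t *\<^sub>R 1)) \<in> S"
      by (rule subalgebra_mult[OF S _ subalgebra_compression[OF y(1) a(2)]])
    then have "cfc f (c t) * (star y * (a - t *\<^sub>R 1)) * (y * cfc f (c t)) \<in> I"
      by (rule I_left[OF _ fI])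
    also have "cfc f (c t) * (star y * (a - t *\<^sub>R 1)) * (y * cfc f (c t))
        = cfc f (c t) * c t * cfc f (c t)" by (simp add: c_def mult.assoc)
    also have "\<dots> = cfc (\<lambda>x. f x * x * f x) (c t)"
      by (simp add: cfc_mult sc f cfc_id continuous_intros)
    also have "\<dots> = r *\<^sub>R cfc (\<lambda>x. f x * f x * f x) (c t)"
      unfolding r by (rule cfc_scale[OF sc]) (intro continuous_intros f)
    finally have "r *\<^sub>R r *\<^sub>R cfc (\<lambda>x. f x * f x * f x) (c t) \<in> I" by (rule I(4))
    then show "cfc (\<lambda>x. f x * f x * f x) (c t) \<in> I" by (simp add: r2)
  qed
  have p: "cfc pos_part (c t) \<in> I"
    by (rule part[where r = 1]) (use inI cp in \<open>auto simp: max_def\<close>)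
  have n: "cfc neg_part (c (t + \<delta>)) \<in> I"
    by (rule part[where r = "-1"]) (use inI cn in \<open>auto simp: max_def\<close>)
  define s where "s = (1 / \<delta>) *\<^sub>R (cfc pos_part (c t) + cfc neg_part (c (t + \<delta>)))"
  have sI: "s \<in> I" unfolding s_def by (intro I p n)
  have sS: "s \<in> S" unfolding s_def
    by (intro subalgebra_intros[OF S] subalgebra_cfc[OF S sc cS] cp cn) auto
  have s: "pos s" unfolding s_def
    by (intro pos_scaleR pos_add pos_cfc[OF sc] cp cn) (use \<delta> in auto)
  have "c t - c (t + \<delta>) = \<delta> *\<^sub>R (star y * y)" by (simp add: c_def algebra_simps)
  moreover have "c t = cfc pos_part (c t) - cfc neg_part (c t)"
    "c (t + \<delta>) = cfc pos_part (c (t + \<delta>)) - cfc neg_part (c (t + \<delta>))"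
    by (rule cfc_pos_neg_part[OF sc])+
  ultimately have "\<delta> *\<^sub>R (star y * y) = (cfc pos_part (c t) - cfc neg_part (c t)) -
      (cfc pos_part (c (t + \<delta>)) - cfc neg_part (c (t + \<delta>)))" by metis
  then have "star y * y = (1 / \<delta>) *\<^sub>R ((cfc pos_part (c t) - cfc neg_part (c t)) -
      (cfc pos_part (c (t + \<delta>)) - cfc neg_part (c (t + \<delta>))))"
    using \<delta> by (simp flip: \<open>\<delta> *\<^sub>R (star y * y) = _\<close>)
  then have "s - star y * y = (1 / \<delta>) *\<^sub>R (cfc neg_part (c t) + cfc pos_part (c (t + \<delta>)))"
    by (simp add: s_def algebra_simps)
  then have below: "pos (s - star y * y)"
    using \<delta> by (auto intro!: pos_scaleR pos_add pos_cfc[OF sc] cp cn)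
  obtain b where b: "star b = b" and bS: "b \<in> S" and bb: "b * b = s"
    using exists_pos_sqrt_in_subalgebra[OF S s sS] .
  have "y \<in> I"
  proof (rule closed_approach[OF I(1)])
    fix e :: real assume e: "0 < e"
    then have e2: "0 < e\<^sup>2" by simp
    define \<rho> where "\<rho> = cfc (\<lambda>x. 1 / sqrt (x\<^sup>2 + e\<^sup>2)) b"
    note cr = continuous_on_inverse_sqrt[OF e2]
    have "s * \<rho> * \<rho> \<in> I"
      unfolding \<rho>_def by (intro ideal_mult_cfc b bS cr sI)
    also have "s * \<rho> * \<rho> = \<rho> * (b * b) * \<rho>"
      using approximate_unit_below(3)[OF b e2, folded \<rho>_def] by (simp add: bb mult.assoc)
    finally have "y * (\<rho> * (b * b) * \<rho>) \<in> I" by (rule I_left[OF y(1)])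
    moreover have "(norm (y - y * (\<rho> * (b * b) * \<rho>)))\<^sup>2 \<le> e\<^sup>2"
      unfolding \<rho>_def by (rule approximate_unit_below(4)[OF b e2]) (simp add: bb below)
    then have "norm (y * (\<rho> * (b * b) * \<rho>) - y) \<le> e"
      using e by (simp add: norm_minus_commute power2_le_iff_abs_le)
    ultimately show "\<exists>x\<in>I. norm (x - y) \<le> e" by blast
  qed
  with y show False by simp
qed

text \<open>
  A lower bound \<open>y* a y \<ge> t y* y\<close> is available for \<open>t = - \<parallel>a\<parallel>\<close>. By \<open>spectral_dichotomy\<close>, some right multiple
  of \<open>y\<close> outside the ideal satisfies either the lower bound with \<open>t + \<delta>\<close> or the upper bound with
  \<open>t + 2 \<delta>\<close>. In the second case it excises \<open>a\<close> at \<open>t + \<delta>\<close>; in the first case the step is repeated, until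
  the lower bound reaches \<open>\<parallel>a\<parallel>\<close>, which always is an upper bound.
\<close>

lemma exists_excising_multiple:
  assumes a: "star a = a" "a \<in> S" and y: "y \<in> S" "y \<notin> I" and \<delta>: "0 < \<delta>"
  obtains w t where "y * w \<in> S" "y * w \<notin> I" "excises a \<delta> t (y * w)"
proof -
  have claim: "\<exists>w t. y * w \<in> S \<and> y * w \<notin> I \<and> excises a \<delta> t (y * w)"
    if "y \<in> S" "y \<notin> I" "pos (star y * (a - (norm a - real n * \<delta>) *\<^sub>R 1) * y)" for y n
    using that
  proof (induction n arbitrary: y)
    case 0
    have "pos (star y * (norm a *\<^sub>R 1 - a) * y)" by (intro pos_conj pos_norm_minus a)
    then have "pos (- (star y * (a - norm a *\<^sub>R 1) * y))" by (simp add: algebra_simps)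
    with 0 have "star y * (a - norm a *\<^sub>R 1) * y = 0" using pos_antisym by fastforce
    then have "excises a \<delta> (norm a) y"
      using \<delta> by (simp add: excises_def pos_scaleR pos_star_mult)
    then show ?case using 0 by (intro exI[of _ 1] exI[of _ "norm a"]) simp
  next
    case (Suc n)
    define t where "t = norm a - real n * \<delta>"
    define c where "c t = star y * (a - t *\<^sub>R 1) * y" for t
    have sc: "star (c t) = c t" for t
      by (simp add: c_def star_mult star_sub star_scaleR star_star a mult.assoc)
    have cS: "c t \<in> S" for t
      unfolding c_def using subalgebra_mult[OF S subalgebra_compression] Suc.prems a by blast
    have cp: "continuous_on UNIV pos_part" and cn: "continuous_on UNIV neg_part"
      by (intro continuous_intros)+
    have comp: "star (y * cfc f (c t)) * (a - t' *\<^sub>R 1) * (y * cfc f (c t)) = cfc f (c t) * c t' * cfc f (c t)"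
      if "continuous_on UNIV f" for f t t'
      unfolding star_mult star_cfc[OF sc that] by (simp add: c_def mult.assoc)
    have comp2: "cfc f (c t) * c t * cfc f (c t) = cfc (\<lambda>x. f x * x * f x) (c t)"
      if f: "continuous_on UNIV f" for f t
      by (simp add: cfc_mult sc f cfc_id continuous_intros)
    consider "y * cfc pos_part (c t) \<notin> I" | "y * cfc neg_part (c (t + \<delta>)) \<notin> I"
      using spectral_dichotomy[OF a Suc.prems(1,2) \<delta>, of t] unfolding c_def by blast
    then show ?case
    proof cases
      case 1
      let ?y = "y * cfc pos_part (c t)"
      have yS: "?y \<in> S" by (rule subalgebra_mult_cfc[OF S sc cS cp Suc.prems(1)])
      have "pos (cfc (\<lambda>x. pos_part x * x * pos_part x) (c t))"
      proof (rule pos_cfc[OF sc])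
        show "continuous_on UNIV (\<lambda>x. pos_part x * x * pos_part x)" by (intro continuous_intros)
      qed (simp add: max_def)
      then have "pos (star ?y * (a - t *\<^sub>R 1) * ?y)" by (simp add: comp[OF cp] comp2[OF cp])
      then obtain w t' where "?y * w \<in> S" "?y * w \<notin> I" "excises a \<delta> t' (?y * w)"
        using Suc.IH[OF yS 1] unfolding t_def by blast
      then show ?thesis by (metis mult.assoc)
    next
      case 2
      let ?m = "cfc neg_part (c (t + \<delta>))"
      let ?y = "y * ?m"
      have yS: "?y \<in> S" by (rule subalgebra_mult_cfc[OF S sc cS cn Suc.prems(1)])
      have "pos (cfc (\<lambda>x. - (neg_part x * x * neg_part x)) (c (t + \<delta>)))"
      proof (rule pos_cfc[OF sc])
        show "continuous_on UNIV (\<lambda>x. - (neg_part x * x * neg_part x))" by (intro continuous_intros)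
      qed (simp add: max_def mult_le_0_iff)
      then have up: "pos (- (star ?y * (a - (t + \<delta>) *\<^sub>R 1) * ?y))"
        unfolding comp[OF cn] comp2[OF cn]
        by (subst cfc_minus[OF sc, symmetric]) (auto intro!: continuous_intros)
      have "pos (star ?m * (star y * (a - (t - \<delta>) *\<^sub>R 1) * y) * ?m)"
        by (rule pos_conj) (use Suc.prems(3) in \<open>simp add: t_def algebra_simps\<close>)
      then have lo: "pos (star ?y * (a - (t - \<delta>) *\<^sub>R 1) * ?y)"
        by (simp add: star_mult mult.assoc)
      have "excises a \<delta> t ?y"
        unfolding excises_def using up lo by (simp add: algebra_simps)
      then show ?thesis using yS 2 by blast
    qed
  qed
  obtain n where n: "2 * norm a / \<delta> \<le> real n" using real_arch_simple by blast
  then have n: "2 * norm a \<le> real n * \<delta>" using \<delta> by (simp add: field_simps)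
  have "pos ((norm a *\<^sub>R 1 + a) + (real n * \<delta> - 2 * norm a) *\<^sub>R (1 :: 'a))"
    using n pos_square[of "1 :: 'a"] by (intro pos_add pos_norm_plus a pos_scaleR) auto
  also have "(norm a *\<^sub>R 1 + a) + (real n * \<delta> - 2 * norm a) *\<^sub>R (1 :: 'a)
      = a - (norm a - real n * \<delta>) *\<^sub>R 1"
    by (simp add: algebra_simps flip: scaleR_2)
  finally have "pos (star y * (a - (norm a - real n * \<delta>) *\<^sub>R 1) * y)" by (rule pos_conj)
  then show ?thesis using claim[OF y] that by blast
qed

lemma exists_excising_outside_ideal:
  assumes "finite F" "\<And>a. a \<in> F \<Longrightarrow> star a = a \<and> a \<in> S" "x \<in> S" "x \<notin> I" "0 < \<delta>"
  obtains y where "y \<in> S" "y \<notin> I" "\<And>a. a \<in> F \<Longrightarrow> \<exists>t. excises a \<delta> t y"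
proof -
  have "\<exists>y. y \<in> S \<and> y \<notin> I \<and> (\<forall>a\<in>F. \<exists>t. excises a \<delta> t y)"
    using assms(1,2)
  proof (induction F rule: finite_induct)
    case empty
    then show ?case using assms(3,4) by auto
  next
    case (insert a F)
    then obtain y where y: "y \<in> S" "y \<notin> I" "\<forall>a\<in>F. \<exists>t. excises a \<delta> t y" by auto
    obtain w t where w: "y * w \<in> S" "y * w \<notin> I" "excises a \<delta> t (y * w)"
      using exists_excising_multiple[OF _ _ y(1,2) assms(5), of a] insert.prems by auto
    have "\<forall>b\<in>insert a F. \<exists>t. excises b \<delta> t (y * w)"
      using y(3) w(3) excises_mult by blast
    with w show ?case by blast
  qed
  then show ?thesis using that by blast
qed

end



lemma pos_sum_list: "(\<And>y. y \<in> set ys \<Longrightarrow> pos (f y)) \<Longrightarrow> pos (\<Sum>y\<leftarrow>ys. f y)"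
  by (induction ys) (auto intro: pos_add)

abbreviation gram :: "'a::star_algebra list \<Rightarrow> 'a"
  where "gram ys \<equiv> \<Sum>y\<leftarrow>ys. star y * y"

lemma conj_sum_list:
  fixes w :: "'a::{star_algebra}"
  shows "(\<Sum>y\<leftarrow>ys. w * f y * w') = w * (\<Sum>y\<leftarrow>ys. f y) * w'"
  by (induction ys) (simp_all add: algebra_simps)

context
  fixes S F :: "'a::{cstar_algebra, real_normed_algebra_1} set" and \<delta> :: real
  assumes S: "cstar_subalgebra S" and F: "finite F" "\<And>a. a \<in> F \<Longrightarrow> star a = a \<and> a \<in> S"
    and \<delta>: "0 < \<delta>"
begin

definition "excising = {y \<in> S. \<forall>a\<in>F. \<exists>t. excises a \<delta> t y}"

text \<open>
  Being below a sum of squares, rather than being a combination of excising elements, passes at once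
  to sums and to left and right multiples, and is the hypothesis of \<open>approximate_unit_below\<close>.
\<close>

definition "dominated = {x \<in> S. \<exists>ys. set ys \<subseteq> excising \<and> pos (gram ys - star x * x)}"

lemma excising_mult: "y \<in> excising \<Longrightarrow> y * w \<in> S \<Longrightarrow> y * w \<in> excising"
  unfolding excising_def using excises_mult by blast

lemma excising_scaleR: "y \<in> excising \<Longrightarrow> r *\<^sub>R y \<in> excising"
  using excising_mult[of y "r *\<^sub>R 1"] by (simp add: excising_def subalgebra_intros[OF S])

lemma dominated_mono:
  assumes "x \<in> S" "set ys \<subseteq> excising" "pos (r *\<^sub>R (gram ys) - star x * x)" "0 \<le> r"
  shows "x \<in> dominated"
proof -
  have "(\<Sum>y\<leftarrow>map ((*\<^sub>R) (sqrt r)) ys. star y * y) = r *\<^sub>R (gram ys)"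
    using assms(4) by (induction ys) (simp_all add: star_scaleR algebra_simps)
  moreover have "set (map ((*\<^sub>R) (sqrt r)) ys) \<subseteq> excising"
    using assms(2) excising_scaleR by auto
  ultimately show ?thesis unfolding dominated_def using assms(1,3)
    by (intro CollectI conjI exI[of _ "map ((*\<^sub>R) (sqrt r)) ys"]) auto
qed

lemma dominated_add:
  assumes "x \<in> dominated" "x' \<in> dominated"
  shows "x + x' \<in> dominated"
proof -
  obtain ys ys' where ys: "set ys \<subseteq> excising" "pos (gram ys - star x * x)"
      "set ys' \<subseteq> excising" "pos (gram ys' - star x' * x')"
    using assms by (auto simp: dominated_def)
  \<comment> \<open>The parallelogram identity bounds the square of a sum by twice the squares.\<close>
  have "pos (2 *\<^sub>R ((gram ys - star x * x) + (gram ys' - star x' * x'))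
      + star (x - x') * (x - x'))"
    by (intro pos_add pos_scaleR pos_star_mult ys) simp
  also have "2 *\<^sub>R ((gram ys - star x * x) + (gram ys' - star x' * x'))
      + star (x - x') * (x - x') = 2 *\<^sub>R (gram (ys @ ys')) - star (x + x') * (x + x')"
    by (simp add: star_add star_sub algebra_simps scaleR_2)
  finally show ?thesis
    using assms ys by (intro dominated_mono[of _ "ys @ ys'" 2])
      (auto simp: dominated_def intro: subalgebra_add[OF S])
qed

lemma dominated_left:
  assumes "x \<in> dominated" "w \<in> S" shows "w * x \<in> dominated"
proof -
  obtain ys where ys: "set ys \<subseteq> excising" "pos (gram ys - star x * x)"
    using assms by (auto simp: dominated_def)
  let ?r = "norm (star w * w)"
  have "pos (?r *\<^sub>R (gram ys - star x * x) + star x * (?r *\<^sub>R 1 - star w * w) * x)"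
    by (intro pos_add pos_scaleR pos_conj pos_norm_minus ys) (auto simp: star_mult star_star)
  also have "?r *\<^sub>R (gram ys - star x * x) + star x * (?r *\<^sub>R 1 - star w * w) * x
      = ?r *\<^sub>R (gram ys) - star (w * x) * (w * x)"
    by (simp add: star_mult algebra_simps)
  finally show ?thesis
    using assms ys by (intro dominated_mono[of _ ys ?r])
      (auto simp: dominated_def intro: subalgebra_mult[OF S])
qed

lemma dominated_right:
  assumes "x \<in> dominated" "w \<in> S" shows "x * w \<in> dominated"
proof -
  obtain ys where ys: "set ys \<subseteq> excising" "pos (gram ys - star x * x)"
    using assms by (auto simp: dominated_def)
  have "(\<Sum>y\<leftarrow>map (\<lambda>y. y * w) ys. star y * y) = star w * (gram ys) * w"
    using conj_sum_list[of "star w" "\<lambda>y. star y * y" w ys] by (simp add: comp_def star_mult mult.assoc)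
  then have "pos ((\<Sum>y\<leftarrow>map (\<lambda>y. y * w) ys. star y * y) - star (x * w) * (x * w))"
    using pos_conj[OF ys(2), of w] by (simp add: star_mult algebra_simps)
  moreover have "set (map (\<lambda>y. y * w) ys) \<subseteq> excising"
    using ys(1) assms(2) excising_mult subalgebra_mult[OF S] by (auto simp: excising_def)
  ultimately show ?thesis
    using assms unfolding dominated_def by (blast intro: subalgebra_mult[OF S])
qed

lemma dominated_scaleR: "x \<in> dominated \<Longrightarrow> r *\<^sub>R x \<in> dominated"
proof -
  assume "x \<in> dominated"
  then obtain ys where x: "x \<in> S" and ys: "set ys \<subseteq> excising" "pos (gram ys - star x * x)"
    by (auto simp: dominated_def)
  have "pos (r\<^sup>2 *\<^sub>R (gram ys - star x * x))" by (intro pos_scaleR ys) simp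
  then have "pos (r\<^sup>2 *\<^sub>R (gram ys) - star (r *\<^sub>R x) * (r *\<^sub>R x))"
    by (simp add: star_scaleR algebra_simps power2_eq_square)
  then show ?thesis using x ys by (intro dominated_mono) (auto intro: subalgebra_intros[OF S])
qed

text \<open>
  A proper closed ideal of \<open>S\<close> misses some excising element, whereas each excising element \<open>y\<close> is below
  its own square \<open>y* y\<close>.
\<close>

lemma closure_dominated: "closure dominated = S"
proof (rule ccontr)
  assume ne: "closure dominated \<noteq> S"
  have sub: "closure dominated \<subseteq> S"
    by (rule closure_minimal) (auto simp: dominated_def subalgebra_closed[OF S])
  with ne obtain x where x: "x \<in> S" "x \<notin> closure dominated" by blast
  have img: "f z \<in> closure dominated"
    if "z \<in> closure dominated" "bounded_linear f" "\<And>z. z \<in> dominated \<Longrightarrow> f z \<in> dominated" for f z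
  proof -
    have "f ` closure dominated \<subseteq> closure dominated"
      by (rule image_closure_subset)
        (use that closure_subset in \<open>auto intro: linear_continuous_on\<close>)
    with that show ?thesis by blast
  qed

  have "0 \<in> dominated"
    unfolding dominated_def by (auto intro!: exI[of _ "[]"] subalgebra_0[OF S])
  then have 0: "0 \<in> closure dominated" using closure_subset by blast
  have add: "u + v \<in> closure dominated" if uv: "u \<in> closure dominated" "v \<in> closure dominated" for u v
  proof -
    obtain f g where "\<forall>n. f n \<in> dominated" "f \<longlonglongrightarrow> u" "\<forall>n. g n \<in> dominated" "g \<longlonglongrightarrow> v"
      using uv unfolding closure_sequential by blast
    then have "\<forall>n. f n + g n \<in> dominated" "(\<lambda>n. f n + g n) \<longlonglongrightarrow> u + v"
      by (auto intro: dominated_add tendsto_add)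
    then show ?thesis unfolding closure_sequential by (intro exI[of _ "\<lambda>n. f n + g n"]) blast
  qed
  obtain y where y: "y \<in> S" "y \<notin> closure dominated" "\<And>a. a \<in> F \<Longrightarrow> \<exists>t. excises a \<delta> t y"
    by (rule exists_excising_outside_ideal[OF S closed_closure 0 add _ _ _ F x \<delta>])
      (auto intro: img dominated_scaleR dominated_left dominated_right
        bounded_linear_scaleR_right bounded_linear_mult_right bounded_linear_mult_left)
  have "y \<in> excising" using y by (auto simp: excising_def)
  then have "y \<in> dominated" unfolding dominated_def using y(1)
    by (auto intro!: exI[of _ "[y]"])
  then show False using y(2) closure_subset by blast
qed

text \<open>
  If \<open>s = \<Sum> y* y\<close> dominates elements close to those of \<open>G\<close>, then the excising elements \<open>y \<rho>\<close> with
  \<open>\<rho> = (s + \<eta>)\<^sup>-\<^sup>1\<^sup>/\<^sup>2\<close> have the sum of squares \<open>\<rho> s \<rho>\<close>, which is almost a unit for \<open>G\<close>. The proof takes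
  \<open>\<eta> = (e / 3)\<^sup>2\<close>.
\<close>

lemma exists_excising_partition:
  assumes G: "finite G" "G \<subseteq> S" and e: "0 < e"
  obtains ys where "set ys \<subseteq> excising" "norm (gram ys) \<le> 1"
    "\<And>x. x \<in> G \<Longrightarrow> norm (x - x * (gram ys)) \<le> e"
proof -
  have e3: "0 < e / 3" using e by simp
  have "\<exists>ys. set ys \<subseteq> excising \<and>
      (\<forall>x\<in>G. \<exists>x'. norm (x - x') \<le> e / 3 \<and> pos (gram ys - star x' * x'))"
    using G
  proof (induction G rule: finite_induct)
    case empty
    then show ?case by (intro exI[of _ "[]"]) simp
  next
    case (insert x G)
    then obtain ys where ys: "set ys \<subseteq> excising"
        "\<forall>x\<in>G. \<exists>x'. norm (x - x') \<le> e / 3 \<and> pos (gram ys - star x' * x')" by auto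
    have "x \<in> closure dominated" using insert.prems closure_dominated by auto
    then obtain x' where x': "x' \<in> dominated" "dist x' x < e / 3"
      unfolding closure_approachable using e3 by blast
    then obtain zs where zs: "set zs \<subseteq> excising" "pos (gram zs - star x' * x')"
      by (auto simp: dominated_def)
    have more: "pos ((gram (ys @ zs)) - w)" if
      "pos (gram ys - w) \<or> pos (gram zs - w)" for w
    proof -
      have "pos (gram ys)" "pos (gram zs)"
        by (auto intro: pos_sum_list pos_star_mult)
      with that show ?thesis
        using pos_add[of "(gram ys) - w" "gram zs"]
          pos_add[of "(gram zs) - w" "gram ys"]
        by (auto simp: algebra_simps)
    qed
    have x'e: "norm (x - x') \<le> e / 3" using x'(2) by (simp add: dist_norm norm_minus_commute)
    have "\<exists>v'. norm (v - v') \<le> e / 3 \<and> pos ((gram (ys @ zs)) - star v' * v')"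
      if "v \<in> insert x G" for v
    proof (cases "v = x")
      case True
      then show ?thesis using x'e zs(2) more by blast
    next
      case False
      then show ?thesis using that ys(2) more by blast
    qed
    then show ?case using ys zs by (intro exI[of _ "ys @ zs"]) auto
  qed
  then obtain ys where ys: "set ys \<subseteq> excising"
      "\<And>x. x \<in> G \<Longrightarrow> \<exists>x'. norm (x - x') \<le> e / 3 \<and> pos (gram ys - star x' * x')" by blast
  define s where "s = (gram ys)"
  have s: "pos s" unfolding s_def by (auto intro: pos_sum_list pos_star_mult)
  have sS: "s \<in> S" unfolding s_def using ys(1)
    by (induction ys) (auto simp: excising_def intro: subalgebra_intros[OF S])
  obtain b where b: "star b = b" and bS: "b \<in> S" and bb: "b * b = s"
    using exists_pos_sqrt_in_subalgebra[OF S s sS] .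
  have e2: "0 < (e / 3)\<^sup>2" using e by simp
  define \<rho> where "\<rho> = cfc (\<lambda>x. 1 / sqrt (x\<^sup>2 + (e / 3)\<^sup>2)) b"
  note cr = continuous_on_inverse_sqrt[OF e2]
  note \<rho> = approximate_unit_below[OF b e2, folded \<rho>_def, unfolded bb]
  define zs where "zs = map (\<lambda>y. y * \<rho>) ys"
  have zs: "gram zs = \<rho> * s * \<rho>"
    using conj_sum_list[of \<rho> "\<lambda>y. star y * y" \<rho> ys]
    by (simp add: zs_def s_def comp_def star_mult \<rho>(1) mult.assoc)
  have "y * \<rho> \<in> S" if "y \<in> S" for y
    unfolding \<rho>_def by (rule subalgebra_mult_cfc[OF S b bS cr that])
  then have "set zs \<subseteq> excising"
    using ys(1) excising_mult by (auto simp: zs_def excising_def)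
  moreover have "norm (x - x * (\<rho> * s * \<rho>)) \<le> e" if "x \<in> G" for x
  proof -
    from ys(2)[OF that] obtain x' where x': "norm (x - x') \<le> e / 3" "pos (s - star x' * x')"
      unfolding s_def by blast
    have "norm (x' - x' * (\<rho> * s * \<rho>)) \<le> e / 3"
      using \<rho>(4)[OF x'(2)] e by (simp add: power2_le_iff_abs_le)
    moreover have "norm ((x - x') * (\<rho> * s * \<rho>)) \<le> e / 3 * 1"
      by (rule order_trans[OF norm_mult_ineq]) (intro mult_mono x' \<rho>(2), use e in auto)
    moreover have "norm (x - x * (\<rho> * s * \<rho>))
        = norm ((x - x') + (x' - x' * (\<rho> * s * \<rho>)) - (x - x') * (\<rho> * s * \<rho>))"
      by (simp add: algebra_simps)
    moreover have "\<dots> \<le> norm (x - x') + norm (x' - x' * (\<rho> * s * \<rho>))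
        + norm ((x - x') * (\<rho> * s * \<rho>))"
      by (intro order_trans[OF norm_triangle_ineq4] add_right_mono norm_triangle_ineq)
    ultimately show ?thesis using x'(1) by linarith
  qed
  ultimately show ?thesis using that[of zs] \<rho>(2) by (simp add: zs)
qed

end

section \<open>Adjoining a unit\<close>

datatype 'a unitization = Unitize (scalar_part: complex) (algebra_part: 'a)

lemma unitization_eqI:
  "scalar_part x = scalar_part y \<Longrightarrow> algebra_part x = algebra_part y \<Longrightarrow> x = y"
  by (rule unitization.expand) simp

instantiation unitization :: (cstar_algebra) star_algebra
begin

definition "0 = Unitize 0 (0 :: 'a)"
definition "x + y = Unitize (scalar_part x + scalar_part y) (algebra_part x + algebra_part y :: 'a)"
definition "- x = Unitize (- scalar_part x) (- algebra_part x :: 'a)"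
definition "x - y = Unitize (scalar_part x - scalar_part y) (algebra_part x - algebra_part y :: 'a)"
definition "c *\<^sub>C x = Unitize (c * scalar_part x) (c *\<^sub>C algebra_part x :: 'a)"
definition "r *\<^sub>R x = Unitize (complex_of_real r * scalar_part x) (r *\<^sub>R algebra_part x :: 'a)"
definition "x * y = Unitize (scalar_part x * scalar_part y)
  (scalar_part x *\<^sub>C algebra_part y + scalar_part y *\<^sub>C algebra_part x + algebra_part x * algebra_part y :: 'a)"
definition "star x = Unitize (cnj (scalar_part x)) (star (algebra_part x :: 'a))"

lemma unitization_sel [simp]:
  fixes x y :: "'a unitization"
  shows "scalar_part (0 :: 'a unitization) = 0" "algebra_part (0 :: 'a unitization) = 0"
    "scalar_part (x + y) = scalar_part x + scalar_part y"
    "algebra_part (x + y) = algebra_part x + algebra_part y"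
    "scalar_part (- x) = - scalar_part x" "algebra_part (- x) = - algebra_part x"
    "scalar_part (x - y) = scalar_part x - scalar_part y"
    "algebra_part (x - y) = algebra_part x - algebra_part y"
    "scalar_part (c *\<^sub>C x) = c * scalar_part x" "algebra_part (c *\<^sub>C x) = c *\<^sub>C algebra_part x"
    "scalar_part (r *\<^sub>R x) = r * scalar_part x" "algebra_part (r *\<^sub>R x) = r *\<^sub>R algebra_part x"
    "scalar_part (x * y) = scalar_part x * scalar_part y"
    "algebra_part (x * y) = scalar_part x *\<^sub>C algebra_part y + scalar_part y *\<^sub>C algebra_part x
      + algebra_part x * algebra_part y"
    "scalar_part (star x) = cnj (scalar_part x)" "algebra_part (star x) = star (algebra_part x)"
  by (simp_all add: zero_unitization_def plus_unitization_def uminus_unitization_def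
      minus_unitization_def scaleC_unitization_def scaleR_unitization_def times_unitization_def
      star_unitization_def)

instance
  by standard
    (auto intro!: unitization_eqI simp: algebra_simps scaleC_add_left scaleC_add_right
      scaleC_scaleC scaleC_one mult_scaleC_left mult_scaleC_right star_add star_scaleC star_mult
      star_star scaleR_scaleC)

end

text \<open>
  The unitization acts on the algebra from the left, and this action provides its norm.
\<close>

definition unit_act :: "'a::cstar_algebra unitization \<Rightarrow> 'a \<Rightarrow> 'a"
  where "unit_act x y = scalar_part x *\<^sub>C y + algebra_part x * y"

lemma unit_act_simps:
  "unit_act (x + x') y = unit_act x y + unit_act x' y"
  "unit_act (c *\<^sub>C x) y = c *\<^sub>C unit_act x y"
  "unit_act (x * x') y = unit_act x (unit_act x' y)"
  by (simp_all add: unit_act_def algebra_simps scaleC_add_left scaleC_add_right scaleC_scaleC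
      mult_scaleC_left mult_scaleC_right)

lemma star_unit_act: "star (unit_act x y) * z = star y * unit_act (star x) z"
  by (simp add: unit_act_def star_add star_scaleC star_mult algebra_simps mult_scaleC_left
      mult_scaleC_right mult.assoc)

lemma norm_unit_act_le_parts:
  "norm (unit_act x y) \<le> (cmod (scalar_part x) + norm (algebra_part x)) * norm y"
proof -
  have "norm (unit_act x y) \<le> norm (scalar_part x *\<^sub>C y) + norm (algebra_part x * y)"
    unfolding unit_act_def by (rule norm_triangle_ineq)
  also have "\<dots> \<le> cmod (scalar_part x) * norm y + norm (algebra_part x) * norm y"
    by (intro add_mono norm_mult_ineq) (simp add: norm_scaleC)
  finally show ?thesis by (simp add: algebra_simps)
qed

lemma bounded_linear_unit_act: "bounded_linear (unit_act x)"
  by (rule bounded_linear_intro[of _ "cmod (scalar_part x) + norm (algebra_part x)"])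
    (use norm_unit_act_le_parts[of x] in \<open>auto simp: unit_act_def algebra_simps scaleC_add_right
      scaleR_scaleC scaleC_scaleC mult_scaleC_right\<close>)

lemma norm_unit_act_le: "norm (unit_act x y) \<le> onorm (unit_act x) * norm y"
  by (rule onorm[OF bounded_linear_unit_act])

lemma onorm_unit_act_le_parts: "onorm (unit_act x) \<le> cmod (scalar_part x) + norm (algebra_part x)"
  by (rule onorm_bound) (auto intro: norm_unit_act_le_parts)

lemma norm_algebra_part_le: "norm (algebra_part x) \<le> cmod (scalar_part x) + onorm (unit_act x)"
proof (cases "algebra_part x = 0")
  case True
  then show ?thesis using onorm_pos_le[OF bounded_linear_unit_act[of x]] by simp
next
  case False
  let ?a = "algebra_part x"
  have "(norm ?a)\<^sup>2 = norm (?a * star ?a)"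
    using cstar_identity[of "star ?a"] by (simp add: star_star norm_star)
  also have "?a * star ?a = unit_act x (star ?a) - scalar_part x *\<^sub>C star ?a"
    by (simp add: unit_act_def)
  also have "norm \<dots> \<le> onorm (unit_act x) * norm (star ?a) + cmod (scalar_part x) * norm (star ?a)"
    by (intro order_trans[OF norm_triangle_ineq4] add_mono norm_unit_act_le) (simp add: norm_scaleC)
  finally have "norm ?a * norm ?a \<le> (cmod (scalar_part x) + onorm (unit_act x)) * norm ?a"
    by (simp add: norm_star power2_eq_square algebra_simps)
  then show ?thesis using False by simp
qed

lemma onorm_unit_act_mult: "onorm (unit_act (x * y)) \<le> onorm (unit_act x) * onorm (unit_act y)"
proof -
  have "unit_act (x * y) = unit_act x \<circ> unit_act y" by (auto simp: unit_act_simps)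
  then show ?thesis using onorm_compose[OF bounded_linear_unit_act bounded_linear_unit_act] by metis
qed

text \<open>
  This is the C*-identity \<open>\<parallel>x y\<parallel>\<^sup>2 = \<parallel>y* x* x y\<parallel>\<close> of the algebra itself, applied to its elements \<open>x y\<close>.
\<close>

lemma onorm_unit_act_cstar: "(onorm (unit_act x))\<^sup>2 \<le> onorm (unit_act (star x * x))"
proof -
  let ?N = "onorm (unit_act (star x * x))"
  have "norm (unit_act x y) \<le> sqrt ?N * norm y" for y
  proof -
    have "(norm (unit_act x y))\<^sup>2 = norm (star y * unit_act (star x * x) y)"
      by (simp add: unit_act_simps star_unit_act flip: cstar_identity)
    also have "\<dots> \<le> norm (star y) * norm (unit_act (star x * x) y)" by (rule norm_mult_ineq)
    also have "\<dots> \<le> norm y * (?N * norm y)"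
      by (intro mult_mono norm_unit_act_le) (auto simp: norm_star)
    finally have "sqrt ((norm (unit_act x y))\<^sup>2) \<le> sqrt (norm y * (?N * norm y))"
      by (rule real_sqrt_le_mono)
    also have "\<dots> = sqrt ?N * norm y" by (simp add: real_sqrt_mult)
    finally show ?thesis by simp
  qed
  then have "onorm (unit_act x) \<le> sqrt ?N" by (rule onorm_bound[rotated])
    (simp add: onorm_pos_le bounded_linear_unit_act)
  then have "(onorm (unit_act x))\<^sup>2 \<le> (sqrt ?N)\<^sup>2"
    by (intro power_mono) (auto simp: onorm_pos_le bounded_linear_unit_act)
  then show ?thesis by (simp add: onorm_pos_le bounded_linear_unit_act)
qed

lemma onorm_unit_act_star: "onorm (unit_act (star x)) = onorm (unit_act x)"
proof -
  have le: "onorm (unit_act x) \<le> onorm (unit_act (star x))" for x :: "'a unitization"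
  proof (cases "onorm (unit_act x) = 0")
    case True
    then show ?thesis by (simp add: onorm_pos_le bounded_linear_unit_act)
  next
    case False
    then have "0 < onorm (unit_act x)"
      using onorm_pos_le[OF bounded_linear_unit_act[of x]] by simp
    moreover have "onorm (unit_act x) * onorm (unit_act x) \<le> onorm (unit_act (star x)) * onorm (unit_act x)"
      using order_trans[OF onorm_unit_act_cstar onorm_unit_act_mult] by (simp add: power2_eq_square)
    ultimately show ?thesis by simp
  qed
  show ?thesis using le[of x] le[of "star x"] by (simp add: star_star)
qed

text \<open>
  If the algebra already has a unit, its left action does not separate the new unit from the old one.
  The maximum with the modulus of the scalar part restores definiteness and the C*-identity survives,
  because the scalar part is a *-homomorphism.
\<close>

instantiation unitization :: (cstar_algebra) real_normed_algebra_1
begin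

definition "1 = Unitize 1 (0 :: 'a)"
definition "norm x = max (cmod (scalar_part x)) (onorm (unit_act (x :: 'a unitization)))"
definition "dist x y = norm (x - y :: 'a unitization)"
definition "sgn x = inverse (norm x) *\<^sub>R (x :: 'a unitization)"
definition "uniformity = (INF e\<in>{0 <..}. principal {(x :: 'a unitization, y). dist x y < e})"
definition "open S = (\<forall>x\<in>S. \<forall>\<^sub>F (x', y :: 'a unitization) in uniformity. x' = x \<longrightarrow> y \<in> S)"

lemma unitization_sel_1 [simp]: "scalar_part (1 :: 'a unitization) = 1" "algebra_part (1 :: 'a unitization) = 0"
  by (simp_all add: one_unitization_def)

lemma norm_unitization_scaleC: "norm (c *\<^sub>C x) = cmod c * norm (x :: 'a unitization)"
proof -
  have "onorm (unit_act (c *\<^sub>C x)) = cmod c * onorm (unit_act x)"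
  proof (cases "c = 0")
    case True
    then have "unit_act (c *\<^sub>C x) = (\<lambda>y. 0)" by (simp add: unit_act_def fun_eq_iff)
    then show ?thesis using True by (simp add: onorm_zero)
  next
    case False
    have le: "onorm (unit_act (c *\<^sub>C x)) \<le> cmod c * onorm (unit_act x)" for c and x :: "'a unitization"
    proof (rule onorm_bound)
      show "norm (unit_act (c *\<^sub>C x) y) \<le> cmod c * onorm (unit_act x) * norm y" for y
        using norm_unit_act_le[of x y] by (simp add: unit_act_simps norm_scaleC mult_left_mono mult.assoc)
    qed (simp add: onorm_pos_le bounded_linear_unit_act)
    have "onorm (unit_act x) \<le> cmod (inverse c) * onorm (unit_act (c *\<^sub>C x))"
      using le[of "inverse c" "c *\<^sub>C x"] False by (simp add: scaleC_scaleC scaleC_one)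
    then have "cmod c * onorm (unit_act x) \<le> onorm (unit_act (c *\<^sub>C x))"
      using False unfolding norm_inverse by (simp add: field_simps)
    with le[of c x] show ?thesis by simp
  qed
  then show ?thesis by (simp add: norm_unitization_def norm_mult max_mult_distrib_left)
qed

instance
proof
  fix x y :: "'a unitization" and r :: real and S :: "'a unitization set"
  show "dist x y = norm (x - y)" "sgn x = inverse (norm x) *\<^sub>R x"
    "uniformity = (INF e\<in>{0 <..}. principal {(x :: 'a unitization, y). dist x y < e})"
    "open S = (\<forall>x\<in>S. \<forall>\<^sub>F (x', y) in uniformity. x' = x \<longrightarrow> y \<in> S)"
    by (rule dist_unitization_def sgn_unitization_def uniformity_unitization_def
        open_unitization_def)+
  show "1 * x = x" "x * 1 = x" by (auto intro!: unitization_eqI simp: scaleC_one)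
  show "(0 :: 'a unitization) \<noteq> 1" by (metis unitization_sel_1(1) unitization_sel(1) zero_neq_one)
  show "(norm x = 0) = (x = 0)"
  proof
    assume "norm x = 0"
    then have "cmod (scalar_part x) \<le> 0" and N: "onorm (unit_act x) \<le> 0"
      by (auto simp: norm_unitization_def max_def split: if_splits)
    moreover have "norm (algebra_part x) \<le> 0"
      using norm_algebra_part_le[of x] calculation by linarith
    ultimately show "x = 0" by (auto intro!: unitization_eqI)
  next
    assume "x = 0"
    then have "unit_act x = (\<lambda>y. 0)" by (auto simp: unit_act_def)
    then show "norm x = 0" using \<open>x = 0\<close> by (simp add: norm_unitization_def onorm_zero)
  qed
  have "unit_act (x + y) = (\<lambda>z. unit_act x z + unit_act y z)" by (auto simp: unit_act_simps)
  then have "onorm (unit_act (x + y)) \<le> onorm (unit_act x) + onorm (unit_act y)"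
    using onorm_triangle[OF bounded_linear_unit_act bounded_linear_unit_act] by metis
  moreover have "cmod (scalar_part (x + y)) \<le> cmod (scalar_part x) + cmod (scalar_part y)"
    by (simp add: norm_triangle_ineq)
  ultimately show "norm (x + y) \<le> norm x + norm y"
    unfolding norm_unitization_def by linarith
  show "norm (r *\<^sub>R x) = \<bar>r\<bar> * norm x"
    by (simp add: scaleR_scaleC norm_unitization_scaleC)
  have "cmod (scalar_part x) * cmod (scalar_part y) \<le> norm x * norm y"
    "onorm (unit_act x) * onorm (unit_act y) \<le> norm x * norm y"
    by (auto intro!: mult_mono simp: norm_unitization_def onorm_pos_le bounded_linear_unit_act le_max_iff_disj)
  with onorm_unit_act_mult[of x y] show "norm (x * y) \<le> norm x * norm y"
    by (simp add: norm_unitization_def[of "x * y"] norm_mult)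
  have "unit_act (1 :: 'a unitization) = (\<lambda>y. y)" by (auto simp: unit_act_def scaleC_one)
  then have "onorm (unit_act (1 :: 'a unitization)) \<le> 1" by (simp add: onorm_id_le)
  then show "norm (1 :: 'a unitization) = 1" by (simp add: norm_unitization_def)
qed

end

lemma norm_unitization_le_parts: "norm x \<le> cmod (scalar_part x) + norm (algebra_part x)"
  using onorm_unit_act_le_parts[of x] by (simp add: norm_unitization_def)

lemma norm_scalar_part_le_norm: "cmod (scalar_part x) \<le> norm x"
  by (simp add: norm_unitization_def)

lemma norm_algebra_part_le_norm: "norm (algebra_part x) \<le> 2 * norm x"
  using norm_algebra_part_le[of x] by (simp add: norm_unitization_def)

lemma bounded_linear_scalar_part: "bounded_linear (scalar_part :: 'a::cstar_algebra unitization \<Rightarrow> complex)"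
  by (rule bounded_linear_intro[of _ 1]) (auto simp: norm_scalar_part_le_norm scaleR_conv_of_real[where 'a = complex])

lemma bounded_linear_algebra_part: "bounded_linear (algebra_part :: 'a::cstar_algebra unitization \<Rightarrow> 'a)"
  by (rule bounded_linear_intro[of _ 2]) (use norm_algebra_part_le_norm in \<open>auto simp: mult.commute\<close>)

instance unitization :: (cstar_algebra) cstar_algebra
proof
  fix X :: "nat \<Rightarrow> 'a unitization" assume X: "Cauchy X"
  then have "convergent (\<lambda>n. scalar_part (X n))" "convergent (\<lambda>n. algebra_part (X n))"
    by (auto intro!: Cauchy_convergent bounded_linear.Cauchy[OF bounded_linear_scalar_part]
        bounded_linear.Cauchy[OF bounded_linear_algebra_part])
  then obtain l a where la: "(\<lambda>n. scalar_part (X n)) \<longlonglongrightarrow> l" "(\<lambda>n. algebra_part (X n)) \<longlonglongrightarrow> a"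
    unfolding convergent_def by blast
  have "(\<lambda>n. cmod (scalar_part (X n) - l) + norm (algebra_part (X n) - a)) \<longlonglongrightarrow> 0"
    using tendsto_add[OF tendsto_norm[OF LIM_zero[OF la(1)]] tendsto_norm[OF LIM_zero[OF la(2)]]]
    by simp
  moreover have "norm (X n - Unitize l a) \<le> cmod (scalar_part (X n) - l) + norm (algebra_part (X n) - a)" for n
    using norm_unitization_le_parts[of "X n - Unitize l a"] by simp
  ultimately have "(\<lambda>n. X n - Unitize l a) \<longlonglongrightarrow> 0"
    by (auto intro: Lim_null_comparison[rotated])
  then show "convergent X" unfolding convergent_def using LIM_zero_cancel by blast
next
  fix c :: complex and x :: "'a unitization"
  show "norm (c *\<^sub>C x) = cmod c * norm x" by (rule norm_unitization_scaleC)
  show "norm (star x) = norm x" by (simp add: norm_unitization_def onorm_unit_act_star)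
  have "onorm (unit_act (star x * x)) = (onorm (unit_act x))\<^sup>2"
    using onorm_unit_act_cstar[of x] onorm_unit_act_mult[of "star x" x]
    by (simp add: onorm_unit_act_star power2_eq_square)
  moreover have "cmod (scalar_part (star x * x)) = (cmod (scalar_part x))\<^sup>2"
    by (simp add: norm_mult power2_eq_square)
  moreover have "max (s\<^sup>2) (t\<^sup>2) = (max s t)\<^sup>2" if "0 \<le> s" "0 \<le> t" for s t :: real
    using that by (auto simp: max_def power2_le_iff_abs_le)
  ultimately show "norm (star x * x) = (norm x)\<^sup>2"
    by (simp add: norm_unitization_def onorm_pos_le bounded_linear_unit_act)
qed

abbreviation incl :: "'a \<Rightarrow> 'a unitization" where "incl a \<equiv> Unitize 0 a"

lemma incl_simps:
  fixes a b :: "'a::cstar_algebra"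
  shows "incl 0 = 0" "incl (a + b) = incl a + incl b" "incl (a - b) = incl a - incl b"
    "incl (c *\<^sub>C a) = c *\<^sub>C incl a" "incl (r *\<^sub>R a) = r *\<^sub>R incl a"
    "incl (a * b) = incl a * incl b" "incl (star a) = star (incl a)"
  by (auto intro!: unitization_eqI)

lemma norm_incl: "norm (incl a) = norm (a :: 'a::cstar_algebra)"
proof (rule antisym)
  show "norm (incl a) \<le> norm a" using norm_unitization_le_parts[of "incl a"] by simp
  show "norm a \<le> norm (incl a)" using norm_algebra_part_le[of "incl a"]
    by (simp add: norm_unitization_def onorm_pos_le bounded_linear_unit_act)
qed

section \<open>Norming functionals\<close>

definition sublinear :: "('a::real_vector \<Rightarrow> real) \<Rightarrow> bool"
  where "sublinear p \<longleftrightarrow> (\<forall>x y. p (x + y) \<le> p x + p y) \<and> (\<forall>r x. 0 \<le> r \<longrightarrow> p (r *\<^sub>R x) = r * p x)"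

lemma sublinear_0: "sublinear p \<Longrightarrow> p 0 = 0"
  unfolding sublinear_def by (metis mult_zero_left order_refl scaleR_zero_left)

lemma sublinear_lower: "sublinear p \<Longrightarrow> - p (- x) \<le> p x"
proof -
  assume p: "sublinear p"
  then have "p (x + - x) \<le> p x + p (- x)" unfolding sublinear_def by blast
  then show ?thesis using sublinear_0[OF p] by simp
qed

lemma sublinearI:
  assumes add: "\<And>x y. p (x + y) \<le> p x + p y" and p0: "p 0 = 0"
    and scale: "\<And>r x. 0 < r \<Longrightarrow> p (r *\<^sub>R x) \<le> r * p x"
  shows "sublinear p"
proof -
  have "p (r *\<^sub>R x) = r * p x" if "0 \<le> r" for r x
  proof (cases "r = 0")
    case False
    then have r: "0 < r" using that by simp
    have "p ((1 / r) *\<^sub>R (r *\<^sub>R x)) \<le> (1 / r) * p (r *\<^sub>R x)" by (rule scale) (use r in simp)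
    then have "r * p x \<le> p (r *\<^sub>R x)" using r by (simp add: field_simps)
    with scale[OF r, of x] show ?thesis by simp
  qed (simp add: p0)
  with add show ?thesis by (simp add: sublinear_def)
qed

text \<open>
  Pushing a sublinear functional down in the direction \<open>y\<close>. A minimal functional is not moved, which turns
  out to mean that it is additive; pushing the norm down in the direction \<open>x\<^sub>0\<close> forces every linear
  functional below it to attain \<open>\<parallel>x\<^sub>0\<parallel>\<close> at \<open>x\<^sub>0\<close>.
\<close>

definition push_down :: "('a::real_vector \<Rightarrow> real) \<Rightarrow> 'a \<Rightarrow> 'a \<Rightarrow> real"
  where "push_down p y x = (INF t\<in>{0..}. p (x + t *\<^sub>R y) - t * p y)"

lemma push_down:
  assumes p: "sublinear p"
  shows "0 \<le> t \<Longrightarrow> push_down p y x \<le> p (x + t *\<^sub>R y) - t * p y"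
    and "sublinear (push_down p y)"
proof -
  have padd: "p (x + y) \<le> p x + p y" and pscale: "0 \<le> r \<Longrightarrow> p (r *\<^sub>R x) = r * p x" for x y r
    using p by (auto simp: sublinear_def)
  have low: "- p (- x) \<le> p (x + t *\<^sub>R y) - t * p y" if "0 \<le> t" for x t
    using padd[of "x + t *\<^sub>R y" "- x"] pscale[OF that, of y] by simp
  have bdd: "bdd_below ((\<lambda>t. p (x + t *\<^sub>R y) - t * p y) ` {0..})" for x
    by (rule bdd_belowI2[of _ "- p (- x)"]) (use low in auto)
  have le: "push_down p y x \<le> p (x + t *\<^sub>R y) - t * p y" if "0 \<le> t" for x t
    unfolding push_down_def by (rule cINF_lower[OF bdd]) (use that in simp)
  show "0 \<le> t \<Longrightarrow> push_down p y x \<le> p (x + t *\<^sub>R y) - t * p y" by (rule le)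
  have approx: "\<exists>t\<ge>0. p (x + t *\<^sub>R y) - t * p y < push_down p y x + e" if "0 < e" for x e
  proof -
    have "push_down p y x < push_down p y x + e" using that by simp
    then obtain v where "v \<in> (\<lambda>t. p (x + t *\<^sub>R y) - t * p y) ` {0..}" "v < push_down p y x + e"
      using cInf_lessD[of "(\<lambda>t. p (x + t *\<^sub>R y) - t * p y) ` {0..}"] unfolding push_down_def by blast
    then show ?thesis by auto
  qed
  show "sublinear (push_down p y)"
  proof (rule sublinearI)
    fix x x'
    show "push_down p y (x + x') \<le> push_down p y x + push_down p y x'"
    proof (rule field_le_epsilon)
      fix e :: real assume "0 < e"
      then have e: "0 < e / 2" by simp
      obtain t t' where t: "0 \<le> t" "p (x + t *\<^sub>R y) - t * p y < push_down p y x + e / 2"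
        "0 \<le> t'" "p (x' + t' *\<^sub>R y) - t' * p y < push_down p y x' + e / 2"
        using approx[OF e] by meson
      have "push_down p y (x + x') \<le> p (x + x' + (t + t') *\<^sub>R y) - (t + t') * p y"
        by (rule le) (use t in simp)
      also have "p (x + x' + (t + t') *\<^sub>R y) \<le> p (x + t *\<^sub>R y) + p (x' + t' *\<^sub>R y)"
        using padd[of "x + t *\<^sub>R y" "x' + t' *\<^sub>R y"] by (simp add: algebra_simps)
      finally show "push_down p y (x + x') \<le> push_down p y x + push_down p y x' + e"
        using t by (simp add: algebra_simps)
    qed
  next
    have "(\<lambda>t. p (0 + t *\<^sub>R y) - t * p y) ` {0..} = {0}" using pscale[of _ y] by force
    then show "push_down p y 0 = 0" by (simp add: push_down_def)
  next
    fix r :: real and x assume r: "0 < r"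
    have "push_down p y (r *\<^sub>R x) / r \<le> push_down p y x"
      unfolding push_down_def[of p y x]
    proof (rule cINF_greatest)
      fix t :: real assume "t \<in> {0..}"
      then have "push_down p y (r *\<^sub>R x) \<le> p (r *\<^sub>R x + (r * t) *\<^sub>R y) - (r * t) * p y"
        using r by (intro le) simp
      also have "r *\<^sub>R x + (r * t) *\<^sub>R y = r *\<^sub>R (x + t *\<^sub>R y)" by (simp add: algebra_simps)
      also have "p (r *\<^sub>R (x + t *\<^sub>R y)) = r * p (x + t *\<^sub>R y)" by (rule pscale) (use r in simp)
      finally show "push_down p y (r *\<^sub>R x) / r \<le> p (x + t *\<^sub>R y) - t * p y"
        using r by (simp add: field_simps)
    qed simp
    then show "push_down p y (r *\<^sub>R x) \<le> r * push_down p y x" using r by (simp add: field_simps)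
  qed
qed

lemma sublinear_chain_Inf:
  assumes ne: "C \<noteq> {}" and C: "\<And>q. q \<in> C \<Longrightarrow> sublinear q"
    and p: "\<And>q x. q \<in> C \<Longrightarrow> q x \<le> p x"
    and chain: "\<And>q r. q \<in> C \<Longrightarrow> r \<in> C \<Longrightarrow> (\<forall>x. q x \<le> r x) \<or> (\<forall>x. r x \<le> q x)"
  shows "q \<in> C \<Longrightarrow> (INF q\<in>C. q x) \<le> q x" "sublinear (\<lambda>x. INF q\<in>C. q x)"
proof -
  have bdd: "bdd_below ((\<lambda>q. q x) ` C)" for x
  proof (rule bdd_belowI2)
    fix q assume q: "q \<in> C"
    show "- p (- x) \<le> q x" using sublinear_lower[OF C[OF q], of x] p[OF q, of "- x"] by linarith
  qed
  have le: "(INF q\<in>C. q x) \<le> q x" if "q \<in> C" for q x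
    by (rule cINF_lower[OF bdd that])
  show "q \<in> C \<Longrightarrow> (INF q\<in>C. q x) \<le> q x" by (rule le)
  have approx: "\<exists>q\<in>C. q x < (INF q\<in>C. q x) + e" if "0 < e" for x e
    using cInf_lessD[of "(\<lambda>q. q x) ` C" "(INF q\<in>C. q x) + e"] ne that by auto
  show "sublinear (\<lambda>x. INF q\<in>C. q x)"
  proof (rule sublinearI)
    fix x y
    show "(INF q\<in>C. q (x + y)) \<le> (INF q\<in>C. q x) + (INF q\<in>C. q y)"
    proof (rule field_le_epsilon)
      fix e :: real assume "0 < e"
      then have e: "0 < e / 2" by simp
      obtain q r where q: "q \<in> C" "q x < (INF q\<in>C. q x) + e / 2" "r \<in> C" "r y < (INF q\<in>C. q y) + e / 2"
        using approx[OF e] by meson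
      obtain s where s: "s \<in> C" "s x \<le> q x" "s y \<le> r y" using chain[OF q(1,3)] q(1,3) by auto
      have "(INF q\<in>C. q (x + y)) \<le> s (x + y)" by (rule le[OF s(1)])
      also have "\<dots> \<le> s x + s y" using C[OF s(1)] by (simp add: sublinear_def)
      finally show "(INF q\<in>C. q (x + y)) \<le> (INF q\<in>C. q x) + (INF q\<in>C. q y) + e"
        using s q by linarith
    qed
  next
    have "(\<lambda>q. q 0) ` C = {0}" using ne C sublinear_0 by force
    then show "(INF q\<in>C. q 0) = 0" by simp
  next
    fix r :: real and x assume r: "0 < r"
    have "(INF q\<in>C. q (r *\<^sub>R x)) / r \<le> (INF q\<in>C. q x)"
    proof (rule cINF_greatest[OF ne])
      fix q assume q: "q \<in> C"
      have "q (r *\<^sub>R x) = r * q x" using C[OF q] r by (simp add: sublinear_def)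
      with le[OF q, of "r *\<^sub>R x"] show "(INF q\<in>C. q (r *\<^sub>R x)) / r \<le> q x"
        using r by (simp add: field_simps)
    qed
    then show "(INF q\<in>C. q (r *\<^sub>R x)) \<le> r * (INF q\<in>C. q x)" using r by (simp add: field_simps)
  qed
qed

text \<open>
  The Hahn-Banach theorem. Zorn's lemma gives a minimal sublinear functional below \<open>p\<close>, and minimality
  against \<open>push_down\<close> makes it linear.
\<close>

theorem linear_below_sublinear:
  fixes p :: "'a::real_vector \<Rightarrow> real"
  assumes p: "sublinear p"
  obtains f where "linear f" "\<And>x. f x \<le> p x"
proof -
  define A where "A = {q. sublinear q \<and> (\<forall>x. q x \<le> p x)}"
  define P where "P q r \<longleftrightarrow> (\<forall>x :: 'a. r x \<le> q x)" for q r :: "'a \<Rightarrow> real"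
  have "\<exists>m\<in>A. \<forall>q\<in>A. P m q \<longrightarrow> q = m"
  proof (rule predicate_Zorn)
    show "partial_order_on A (relation_of P A)"
      by (rule partial_order_on_relation_ofI)
        (auto simp: P_def intro!: ext intro: order_trans antisym)
    fix C assume "C \<in> Chains (relation_of P A)"
    then have C: "C \<subseteq> A" and chain: "\<And>q r. q \<in> C \<Longrightarrow> r \<in> C \<Longrightarrow> P q r \<or> P r q"
      by (auto simp: Chains_def relation_of_def)
    show "\<exists>u\<in>A. \<forall>q\<in>C. P q u"
    proof (cases "C = {}")
      case True
      then show ?thesis using p by (auto simp: A_def)
    next
      case False
      let ?u = "\<lambda>x. INF q\<in>C. q x"
      have C': "\<And>q. q \<in> C \<Longrightarrow> sublinear q" "\<And>q x. q \<in> C \<Longrightarrow> q x \<le> p x"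
        using C by (auto simp: A_def)
      have chain': "(\<forall>x. q x \<le> r x) \<or> (\<forall>x. r x \<le> q x)" if "q \<in> C" "r \<in> C" for q r
        using chain[OF that] by (auto simp: P_def)
      have u1: "?u x \<le> q x" if "q \<in> C" for q x
        using sublinear_chain_Inf(1)[of C p q x] False C' chain' that by blast
      have u2: "sublinear ?u"
        using sublinear_chain_Inf(2)[of C p] False C' chain' by blast
      obtain q0 where q0: "q0 \<in> C" using False by blast
      have "?u x \<le> p x" for x using u1[OF q0, of x] C'(2)[OF q0, of x] by linarith
      then have "?u \<in> A" using u2 by (auto simp: A_def)
      then show ?thesis using u1 by (intro bexI[of _ ?u]) (auto simp: P_def)
    qed
  qed
  then obtain m where mA: "m \<in> A" and maximal: "\<And>q. q \<in> A \<Longrightarrow> P m q \<Longrightarrow> q = m" by blast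
  have m: "sublinear m" "\<And>x. m x \<le> p x" using mA by (auto simp: A_def)
  have min: "q = m" if q: "sublinear q" "\<And>x. q x \<le> m x" for q
  proof (rule maximal)
    have "q x \<le> p x" for x using q(2)[of x] m(2)[of x] by linarith
    then show "q \<in> A" using q(1) by (auto simp: A_def)
    show "P m q" using q(2) by (simp add: P_def)
  qed
  have add: "m (x + y) = m x + m y" for x y
  proof (rule antisym)
    show "m (x + y) \<le> m x + m y" using m(1) by (simp add: sublinear_def)
    have "push_down m y = m"
      by (rule min[OF push_down(2)[OF m(1)]]) (use push_down(1)[OF m(1), of 0] in simp)
    then have "m x \<le> m (x + y) - m y" using push_down(1)[OF m(1), of 1 y x] by simp
    then show "m x + m y \<le> m (x + y)" by simp
  qed
  have neg: "m (- x) = - m x" for x using add[of x "- x"] sublinear_0[OF m(1)] by simp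
  have "m (r *\<^sub>R x) = r * m x" for r x
  proof (cases "0 \<le> r")
    case False
    then have "0 \<le> - r" by simp
    then have "m ((- r) *\<^sub>R x) = - r * m x" using m(1) unfolding sublinear_def by blast
    then show ?thesis by (simp add: neg)
  qed (use m(1) in \<open>simp add: sublinear_def\<close>)
  then have "linear m" by (intro linearI) (auto simp: add)
  then show ?thesis using that m(2) by blast
qed

lemma scaleC_Re_Im: "c *\<^sub>C y = Re c *\<^sub>R y + Im c *\<^sub>R (\<i> *\<^sub>C y)"
proof -
  have "c = of_real (Re c) + of_real (Im c) * \<i>" by (simp add: complex_eq_iff)
  then have "c *\<^sub>C y = (of_real (Re c) + of_real (Im c) * \<i>) *\<^sub>C y" by (rule arg_cong)
  then show ?thesis by (simp only: scaleC_add_left scaleR_scaleC scaleC_scaleC)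
qed

lemma scaleC_i_i: "\<i> *\<^sub>C \<i> *\<^sub>C x = - (x :: 'a::complex_vector)"
  by (simp add: scaleC_scaleC complex_vector.scale_minus_left scaleC_one)

definition contractive_functional :: "('a::banach_star_algebra \<Rightarrow> complex) \<Rightarrow> bool"
  where "contractive_functional \<phi> \<longleftrightarrow> (\<forall>a b. \<phi> (a + b) = \<phi> a + \<phi> b) \<and>
    (\<forall>c a. \<phi> (c *\<^sub>C a) = c * \<phi> a) \<and> (\<forall>a. cmod (\<phi> a) \<le> norm a)"

theorem exists_norming_functional:
  fixes x0 :: "'a::banach_star_algebra"
  obtains \<phi> where "contractive_functional \<phi>" "\<phi> x0 = complex_of_real (norm x0)"
proof -
  have "sublinear (norm :: 'a \<Rightarrow> real)" by (auto simp: sublinear_def norm_triangle_ineq)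
  note pd = push_down[OF this]
  obtain f where f: "linear f" "\<And>x. f x \<le> push_down norm x0 x"
    using linear_below_sublinear[OF pd(2)] by blast
  have fle: "f x \<le> norm x" for x using f(2)[of x] pd(1)[of 0 x0 x] by simp
  have "f (- x0) \<le> - norm x0" using f(2)[of "- x0"] pd(1)[of 1 x0 "- x0"] by simp
  then have fx0: "norm x0 \<le> f x0" using linear_neg[OF f(1), of x0] by simp
  define \<phi> where "\<phi> x = Complex (f x) (- f (\<i> *\<^sub>C x))" for x
  have fadd: "f (x + y) = f x + f y" and fscale: "f (r *\<^sub>R x) = r * f x" and fneg: "f (- x) = - f x" for x y r
    using f(1) by (simp_all add: linear_add linear_scale linear_neg)
  have add: "\<phi> (x + y) = \<phi> x + \<phi> y" for x y
    by (simp add: \<phi>_def fadd scaleC_add_right complex_eq_iff)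
  have scale: "\<phi> (c *\<^sub>C x) = c * \<phi> x" for c x
  proof -
    note c = scaleC_Re_Im[of c]
    have "\<i> *\<^sub>C c *\<^sub>C x = c *\<^sub>C \<i> *\<^sub>C x" by (simp only: scaleC_scaleC mult.commute)
    then have "\<i> *\<^sub>C c *\<^sub>C x = Re c *\<^sub>R (\<i> *\<^sub>C x) + Im c *\<^sub>R (- x)"
      unfolding c[of "\<i> *\<^sub>C x"] scaleC_i_i .
    then have "f (\<i> *\<^sub>C c *\<^sub>C x) = Re c * f (\<i> *\<^sub>C x) + Im c * (- f x)"
      by (simp only: fadd fscale fneg)
    moreover have "f (c *\<^sub>C x) = Re c * f x + Im c * f (\<i> *\<^sub>C x)" by (simp only: c fadd fscale)
    ultimately show ?thesis by (simp add: \<phi>_def complex_eq_iff)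
  qed
  have le: "cmod (\<phi> x) \<le> norm x" for x
  proof (cases "\<phi> x = 0")
    case False
    define w where "w = cnj (\<phi> x) / cmod (\<phi> x)"
    have w: "cmod w = 1" using False by (simp add: w_def norm_divide)
    have "\<phi> (w *\<^sub>C x) = (\<phi> x * cnj (\<phi> x)) / cmod (\<phi> x)"
      by (simp add: scale w_def mult.commute)
    also have "\<dots> = complex_of_real (cmod (\<phi> x))"
      using False by (simp add: power2_eq_square flip: complex_norm_square)
    finally have "cmod (\<phi> x) = Re (\<phi> (w *\<^sub>C x))" by simp
    also have "\<dots> = f (w *\<^sub>C x)" by (simp add: \<phi>_def)
    also have "\<dots> \<le> norm x" using fle[of "w *\<^sub>C x"] by (simp add: norm_scaleC w)
    finally show ?thesis .
  qed simp
  have re: "Re (\<phi> x0) = norm x0" using fx0 fle[of x0] by (simp add: \<phi>_def)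
  have "(cmod (\<phi> x0))\<^sup>2 \<le> (norm x0)\<^sup>2" by (intro power_mono le) simp
  then have "Im (\<phi> x0) = 0" by (simp add: cmod_power2 re)
  then have "\<phi> x0 = complex_of_real (norm x0)" using re by (simp add: complex_eq_iff)
  then show ?thesis using that add scale le by (auto simp: contractive_functional_def)
qed

section \<open>Elementary operators that are nearly of finite rank\<close>

text \<open>
  The sums below are positive maps on their coefficients, so that bounds for the coefficients carry over.
  Complex coefficients and elements that are not self-adjoint cost a factor two, for the real and
  imaginary parts.
\<close>

lemma norm_sum_real_multiples:
  fixes ys :: "'a::{cstar_algebra, real_normed_algebra_1} list"
  assumes "\<And>y. y \<in> set ys \<Longrightarrow> \<bar>r y\<bar> \<le> m" "0 \<le> m"
  shows "norm (\<Sum>y\<leftarrow>ys. r y *\<^sub>R (star y * y)) \<le> m * norm (gram ys)"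
proof -
  let ?b = "\<Sum>y\<leftarrow>ys. m *\<^sub>R (star y * y)"
  have "norm (\<Sum>y\<leftarrow>ys. r y *\<^sub>R (star y * y)) \<le> norm ?b"
  proof (rule norm_mono)
    show "star (\<Sum>y\<leftarrow>ys. r y *\<^sub>R (star y * y)) = (\<Sum>y\<leftarrow>ys. r y *\<^sub>R (star y * y))"
      "star ?b = ?b" by (induction ys) (simp_all add: star_add star_scaleR star_mult star_star)
    have "0 \<le> m - r y" "0 \<le> m + r y" if "y \<in> set ys" for y
      using assms(1)[OF that] by linarith+
    then have "pos (\<Sum>y\<leftarrow>ys. (m - r y) *\<^sub>R (star y * y))" "pos (\<Sum>y\<leftarrow>ys. (m + r y) *\<^sub>R (star y * y))"
      by (auto intro!: pos_sum_list pos_scaleR pos_star_mult)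
    moreover have "(\<Sum>y\<leftarrow>ys. (m - r y) *\<^sub>R (star y * y)) = ?b - (\<Sum>y\<leftarrow>ys. r y *\<^sub>R (star y * y))"
      "(\<Sum>y\<leftarrow>ys. (m + r y) *\<^sub>R (star y * y)) = ?b + (\<Sum>y\<leftarrow>ys. r y *\<^sub>R (star y * y))"
      by (induction ys) (simp_all add: algebra_simps)
    ultimately show "pos (?b - (\<Sum>y\<leftarrow>ys. r y *\<^sub>R (star y * y)))"
      "pos (?b + (\<Sum>y\<leftarrow>ys. r y *\<^sub>R (star y * y)))" by simp_all
  qed
  also have "?b = m *\<^sub>R (gram ys)" by (induction ys) (simp_all add: algebra_simps)
  finally show ?thesis using assms(2) by simp
qed

lemma norm_sum_complex_multiples:
  fixes ys :: "'a::{cstar_algebra, real_normed_algebra_1} list"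
  assumes "\<And>y. y \<in> set ys \<Longrightarrow> cmod (d y) \<le> m" "0 \<le> m"
  shows "norm (\<Sum>y\<leftarrow>ys. d y *\<^sub>C (star y * y)) \<le> 2 * m * norm (gram ys)"
proof -
  have "d y *\<^sub>C x = Re (d y) *\<^sub>R x + \<i> *\<^sub>C Im (d y) *\<^sub>R x" for x y :: 'a
    unfolding scaleC_Re_Im[of "d y"] by (simp add: scaleR_scaleC scaleC_scaleC mult.commute)
  then have "(\<Sum>y\<leftarrow>ys. d y *\<^sub>C (star y * y)) =
      (\<Sum>y\<leftarrow>ys. Re (d y) *\<^sub>R (star y * y)) + \<i> *\<^sub>C (\<Sum>y\<leftarrow>ys. Im (d y) *\<^sub>R (star y * y))"
    by (induction ys) (simp_all add: scaleC_add_right)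
  also have "norm \<dots> \<le> m * norm (gram ys) + m * norm (gram ys)"
    by (rule order_trans[OF norm_triangle_ineq], unfold norm_scaleC norm_ii mult_1_left)
      (intro add_mono norm_sum_real_multiples, use assms in \<open>auto intro: order_trans[OF abs_Re_le_cmod]
        order_trans[OF abs_Im_le_cmod]\<close>)
  finally show ?thesis by simp
qed

lemma real_imaginary_parts:
  fixes a :: "'a::cstar_algebra"
  defines "r \<equiv> (1/2) *\<^sub>R (a + star a)" and "s \<equiv> (- \<i> / 2) *\<^sub>C (a - star a)"
  shows "star r = r" "star s = s" "a = r + \<i> *\<^sub>C s" "norm r \<le> norm a" "norm s \<le> norm a"
proof -
  show "star r = r" by (simp add: r_def star_scaleR star_add star_star add.commute)
  show "star s = s"
    by (simp add: s_def star_scaleC star_sub star_star complex_vector.scale_minus_left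
        flip: complex_vector.scale_minus_right)
  have "\<i> *\<^sub>C s = (1/2) *\<^sub>R (a - star a)" by (simp add: s_def scaleC_scaleC scaleR_scaleC)
  then have "r + \<i> *\<^sub>C s = (1/2) *\<^sub>R (a + a)" by (simp add: r_def algebra_simps)
  then show "a = r + \<i> *\<^sub>C s" by (simp flip: scaleR_2)
  have "norm (a + star a) \<le> 2 * norm a" using norm_triangle_ineq[of a "star a"] by (simp add: norm_star)
  then show "norm r \<le> norm a" by (simp add: r_def)
  have "norm (a - star a) \<le> 2 * norm a" using norm_triangle_ineq4[of a "star a"] by (simp add: norm_star)
  then show "norm s \<le> norm a" by (simp add: s_def norm_scaleC norm_divide)
qed

lemma norm_sum_compressions:
  fixes ys :: "'a::{cstar_algebra, real_normed_algebra_1} list"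
  shows "norm (\<Sum>y\<leftarrow>ys. star y * a * y) \<le> 2 * norm a * norm (gram ys)"
proof -
  let ?E = "\<lambda>a. \<Sum>y\<leftarrow>ys. star y * a * y"
  have sa: "norm (?E a) \<le> norm a * norm (gram ys)" if a: "star a = a" for a
  proof -
    let ?b = "\<Sum>y\<leftarrow>ys. norm a *\<^sub>R (star y * y)"
    have "norm (?E a) \<le> norm ?b"
    proof (rule norm_mono)
      show "star (?E a) = ?E a" "star ?b = ?b"
        by (induction ys) (simp_all add: star_add star_scaleR star_mult star_star a mult.assoc)
      have "pos (\<Sum>y\<leftarrow>ys. star y * (norm a *\<^sub>R 1 - a) * y)"
        "pos (\<Sum>y\<leftarrow>ys. star y * (norm a *\<^sub>R 1 + a) * y)"
        using a by (auto intro!: pos_sum_list pos_conj pos_norm_minus pos_norm_plus)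
      moreover have "(\<Sum>y\<leftarrow>ys. star y * (norm a *\<^sub>R 1 - a) * y) = ?b - ?E a"
        "(\<Sum>y\<leftarrow>ys. star y * (norm a *\<^sub>R 1 + a) * y) = ?b + ?E a"
        by (induction ys) (simp_all add: algebra_simps)
      ultimately show "pos (?b - ?E a)" "pos (?b + ?E a)" by simp_all
    qed
    also have "?b = norm a *\<^sub>R (gram ys)" by (induction ys) (simp_all add: algebra_simps)
    finally show ?thesis by simp
  qed
  define r where "r = (1/2) *\<^sub>R (a + star a)"
  define s where "s = (- \<i> / 2) *\<^sub>C (a - star a)"
  note rs = real_imaginary_parts[of a, folded r_def s_def]
  have "?E a = ?E r + \<i> *\<^sub>C ?E s"
    by (subst rs(3), induction ys) (simp_all add: algebra_simps scaleC_add_right mult_scaleC_left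
        mult_scaleC_right)
  also have "norm \<dots> \<le> norm r * norm (gram ys) + norm s * norm (gram ys)"
    by (rule order_trans[OF norm_triangle_ineq], unfold norm_scaleC norm_ii mult_1_left)
      (intro add_mono sa rs)
  also have "\<dots> \<le> norm a * norm (gram ys) + norm a * norm (gram ys)"
    by (intro add_mono mult_right_mono rs) auto
  finally show ?thesis by simp
qed

text \<open>
  The functional is \<open>\<psi>(y* a y) / \<parallel>y\<parallel>\<^sup>2\<close>, where \<open>\<psi>\<close> attains its norm at \<open>y* y\<close>. It sends \<open>a\<close> close to \<open>t\<close>
  because \<open>\<parallel>y* (a - t) y\<parallel> \<le> \<delta> \<parallel>y\<parallel>\<^sup>2\<close>.
\<close>

lemma excises_functional:
  fixes y :: "'a::{cstar_algebra, real_normed_algebra_1}"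
  assumes y: "y \<noteq> 0"
  obtains \<phi> where "contractive_functional \<phi>"
    "\<And>a \<delta> t. star a = a \<Longrightarrow> 0 \<le> \<delta> \<Longrightarrow> excises a \<delta> t y \<Longrightarrow> cmod (\<phi> a - of_real t) \<le> \<delta>"
proof -
  obtain \<psi> where \<psi>: "contractive_functional \<psi>" "\<psi> (star y * y) = of_real (norm (star y * y))"
    by (rule exists_norming_functional)
  define n where "n = (norm y)\<^sup>2"
  have n: "0 < n" using y by (simp add: n_def)
  define \<phi> where "\<phi> a = \<psi> (star y * a * y) / of_real n" for a
  have \<psi>': "\<psi> (a + b) = \<psi> a + \<psi> b" "\<psi> (c *\<^sub>C a) = c * \<psi> a" "cmod (\<psi> a) \<le> norm a" for a b c
    using \<psi>(1) by (auto simp: contractive_functional_def)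
  have "cmod (\<psi> (star y * a * y)) \<le> n * norm a" for a
  proof -
    have "norm (star y * a * y) \<le> norm y * norm a * norm y"
      by (intro order_trans[OF norm_mult_ineq] mult_right_mono)
        (use norm_mult_ineq[of "star y" a] in \<open>auto simp: norm_star\<close>)
    then show ?thesis using \<psi>'(3)[of "star y * a * y"] by (simp add: n_def power2_eq_square mult_ac)
  qed
  then have "contractive_functional \<phi>"
    using n unfolding contractive_functional_def \<phi>_def
    by (auto simp: distrib_left distrib_right \<psi>' mult_scaleC_left mult_scaleC_right add_divide_distrib
        norm_divide divide_le_eq mult.commute)
  moreover have "cmod (\<phi> a - of_real t) \<le> \<delta>" if a: "star a = a" "0 \<le> \<delta>" "excises a \<delta> t y" for a \<delta> t
  proof -
    let ?c = "star y * (a - t *\<^sub>R 1) * y"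
    have "norm ?c \<le> norm (\<delta> *\<^sub>R (star y * y))"
      by (rule norm_mono) (use a in \<open>auto simp: excises_def star_mult star_sub star_scaleR star_star mult.assoc\<close>)
    then have "norm ?c \<le> \<delta> * n" using a(2) by (simp add: cstar_identity n_def)
    have "star y * a * y = ?c + of_real t *\<^sub>C (star y * y)" by (simp add: algebra_simps flip: scaleR_scaleC)
    then have "\<psi> (star y * a * y) = \<psi> ?c + of_real t * of_real n"
      using \<psi>(2) by (simp only: \<psi>' cstar_identity n_def)
    then have "\<phi> a - of_real t = \<psi> ?c / of_real n" using n by (simp add: \<phi>_def field_simps)
    also have "cmod \<dots> \<le> (\<delta> * n) / n"
      unfolding norm_divide using n \<open>norm ?c \<le> \<delta> * n\<close> \<psi>'(3)[of ?c]
      by (simp add: divide_le_eq mult.commute)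
    finally show ?thesis using n by simp
  qed
  ultimately show ?thesis using that by blast
qed

text \<open>
  If every \<open>y\<close> excises the real and imaginary parts of \<open>G\<close>, then in \<open>\<Sum> y* a y\<close> the element \<open>a\<close> can be replaced,
  term by term, first by the scalar at which \<open>y\<close> excises it and then by \<open>\<phi>\<^sub>y(a)\<close>.
\<close>

lemma nearly_finite_rank_unital:
  fixes S G :: "'a::{cstar_algebra, real_normed_algebra_1} set"
  assumes S: "cstar_subalgebra S" and G: "finite G" "G \<subseteq> S" and e: "0 < e"
  obtains ys \<phi> where "set ys \<subseteq> S" "\<And>y. contractive_functional (\<phi> y)"
    "norm (gram ys) \<le> 1"
    "\<And>a. a \<in> G \<Longrightarrow> norm (a - a * (gram ys)) \<le> e"
    "\<And>a. a \<in> G \<Longrightarrow> norm ((\<Sum>y\<leftarrow>ys. star y * a * y) - (\<Sum>y\<leftarrow>ys. \<phi> y a *\<^sub>C (star y * y))) \<le> e"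
proof -
  define re where "re a = (1/2) *\<^sub>R (a + star a)" for a :: 'a
  define im where "im a = (- \<i> / 2) *\<^sub>C (a - star a)" for a :: 'a
  note ri = real_imaginary_parts[where 'a = 'a, folded re_def im_def]
  define F where "F = re ` G \<union> im ` G"
  have F: "finite F" "\<And>a. a \<in> F \<Longrightarrow> star a = a \<and> a \<in> S"
  proof -
    show "finite F" using G by (simp add: F_def)
    fix a assume "a \<in> F"
    then show "star a = a \<and> a \<in> S" using G(2) ri(1,2)
      by (auto simp: F_def) (auto simp: re_def im_def intro!: subalgebra_intros[OF S])
  qed
  \<comment> \<open>The two replacements cost 3 \<delta> for a self-adjoint element, and a general one has two parts.\<close>
  define \<delta> where "\<delta> = e / 6"
  have \<delta>: "0 < \<delta>" using e by (simp add: \<delta>_def)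
  obtain xs where xs: "set xs \<subseteq> excising S F \<delta>" "norm (gram xs) \<le> 1"
    "\<And>x. x \<in> G \<Longrightarrow> norm (x - x * (gram xs)) \<le> e"
    using exists_excising_partition[OF S F \<delta> G e] by blast
  \<comment> \<open>At 0 the functionals would not be determined by excision.\<close>
  define ys where "ys = filter (\<lambda>y. y \<noteq> 0) xs"
  have ys: "gram ys = (gram xs)"
    unfolding ys_def by (rule sum_list_map_filter) auto
  have ysS: "set ys \<subseteq> S" and exc: "\<And>y a. y \<in> set ys \<Longrightarrow> a \<in> F \<Longrightarrow> \<exists>t. excises a \<delta> t y"
    using xs(1) by (auto simp: ys_def excising_def[OF S F \<delta>])
  have "\<exists>\<phi>. contractive_functional \<phi> \<and> (\<forall>a\<in>F. \<forall>t. y \<noteq> 0 \<longrightarrow> excises a \<delta> t y \<longrightarrow> cmod (\<phi> a - of_real t) \<le> \<delta>)" for y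
  proof (cases "y = 0")
    case True
    then show ?thesis by (intro exI[of _ "\<lambda>_. 0"]) (auto simp: contractive_functional_def)
  next
    case False
    obtain \<phi> where "contractive_functional \<phi>"
      "\<And>a \<delta> t. star a = a \<Longrightarrow> 0 \<le> \<delta> \<Longrightarrow> excises a \<delta> t y \<Longrightarrow> cmod (\<phi> a - of_real t) \<le> \<delta>"
      by (rule excises_functional[OF False]) (rule that; blast)
    then show ?thesis using F(2) \<delta> by (intro exI[of _ \<phi>]) auto
  qed
  then have "\<forall>y. \<exists>\<phi>. contractive_functional \<phi> \<and>
      (\<forall>a\<in>F. \<forall>t. y \<noteq> 0 \<longrightarrow> excises a \<delta> t y \<longrightarrow> cmod (\<phi> a - of_real t) \<le> \<delta>)" by blast
  from choice[OF this] obtain \<phi> where \<phi>: "\<And>y. contractive_functional (\<phi> y)"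
    "\<And>y a t. a \<in> F \<Longrightarrow> y \<noteq> 0 \<Longrightarrow> excises a \<delta> t y \<Longrightarrow> cmod (\<phi> y a - of_real t) \<le> \<delta>" by blast
  define t where "t y a = (SOME t. excises a \<delta> t y)" for y a :: 'a
  have t: "excises a \<delta> (t y a) y" if "y \<in> set ys" "a \<in> F" for y a
    unfolding t_def by (rule someI_ex[OF exc[OF that]])
  let ?D = "\<lambda>a. (\<Sum>y\<leftarrow>ys. star y * a * y) - (\<Sum>y\<leftarrow>ys. \<phi> y a *\<^sub>C (star y * y))"
  have D: "norm (?D a) \<le> 3 * \<delta>" if a: "a \<in> F" for a
  proof -
    let ?c = "\<Sum>y\<leftarrow>ys. star y * (a - t y a *\<^sub>R 1) * y" and ?b = "\<Sum>y\<leftarrow>ys. \<delta> *\<^sub>R (star y * y)"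
    have sa: "star a = a" using F(2) a by blast
    have "norm ?c \<le> norm ?b"
    proof (rule norm_mono)
      show "star ?c = ?c" "star ?b = ?b"
        by (induction ys) (simp_all add: star_add star_scaleR star_mult star_star star_sub sa mult.assoc)
      have "pos (\<Sum>y\<leftarrow>ys. \<delta> *\<^sub>R (star y * y) - star y * (a - t y a *\<^sub>R 1) * y)"
        "pos (\<Sum>y\<leftarrow>ys. \<delta> *\<^sub>R (star y * y) + star y * (a - t y a *\<^sub>R 1) * y)"
        using t[OF _ a] by (auto intro!: pos_sum_list simp: excises_def)
      then show "pos (?b - ?c)" "pos (?b + ?c)"
        by (simp_all add: sum_list_addf sum_list_subtractf)
    qed
    also have "?b = \<delta> *\<^sub>R (gram ys)" by (induction ys) (simp_all add: algebra_simps)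
    also have "norm \<dots> \<le> \<delta> * 1" using xs(2) \<delta> by (simp add: ys)
    finally have 1: "norm ?c \<le> \<delta>" by simp
    have "norm (\<Sum>y\<leftarrow>ys. (of_real (t y a) - \<phi> y a) *\<^sub>C (star y * y)) \<le> 2 * \<delta> * norm (gram ys)"
    proof (rule norm_sum_complex_multiples)
      fix y assume y: "y \<in> set ys"
      then have "y \<noteq> 0" by (simp add: ys_def)
      from \<phi>(2)[OF a this t[OF y a]] show "cmod (of_real (t y a) - \<phi> y a) \<le> \<delta>"
        by (simp add: norm_minus_commute)
    qed (use \<delta> in simp)
    also have "\<dots> \<le> 2 * \<delta> * 1" using xs(2) \<delta> by (intro mult_left_mono) (auto simp: ys)
    finally have 2: "norm (\<Sum>y\<leftarrow>ys. (of_real (t y a) - \<phi> y a) *\<^sub>C (star y * y)) \<le> 2 * \<delta>" by simp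
    have "?D a = ?c + (\<Sum>y\<leftarrow>ys. (of_real (t y a) - \<phi> y a) *\<^sub>C (star y * y))"
      by (induction ys) (simp_all add: algebra_simps complex_vector.scale_left_diff_distrib
          flip: scaleR_scaleC)
    then show ?thesis using 1 2 norm_triangle_ineq[of ?c "\<Sum>y\<leftarrow>ys. (of_real (t y a) - \<phi> y a) *\<^sub>C (star y * y)"]
      by simp
  qed
  have "norm (?D a) \<le> e" if a: "a \<in> G" for a
  proof -
    have "\<phi> y (b + \<i> *\<^sub>C c) = \<phi> y b + \<i> * \<phi> y c" for y b c
      using \<phi>(1)[of y] by (simp add: contractive_functional_def)
    then have "?D (b + \<i> *\<^sub>C c) = ?D b + \<i> *\<^sub>C ?D c" for b c
      by (induction ys) (simp_all add: algebra_simps scaleC_add_right mult_scaleC_left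
        mult_scaleC_right scaleC_add_left complex_vector.scale_right_diff_distrib scaleC_scaleC)
    then have "?D (re a + \<i> *\<^sub>C im a) = ?D (re a) + \<i> *\<^sub>C ?D (im a)" .
    then have "?D a = ?D (re a) + \<i> *\<^sub>C ?D (im a)" by (simp only: ri(3)[of a, symmetric])
    also have "norm \<dots> \<le> 3 * \<delta> + 3 * \<delta>"
      by (rule order_trans[OF norm_triangle_ineq], unfold norm_scaleC norm_ii mult_1_left)
        (intro add_mono D, use a in \<open>auto simp: F_def\<close>)
    finally show ?thesis by (simp add: \<delta>_def)
  qed
  then show ?thesis using that[of ys \<phi>] ysS \<phi>(1) xs(2,3) by (simp add: ys)
qed

lemma cstar_subalgebra_incl:
  fixes S :: "'a::cstar_algebra set"
  assumes S: "cstar_subalgebra S" shows "cstar_subalgebra (incl ` S)"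
proof -
  have eq: "incl ` S = (scalar_part -` {0}) \<inter> (algebra_part -` S)"
    by (auto intro!: image_eqI unitization_eqI)
  have "closed (incl ` S)"
    unfolding eq by (intro closed_Int continuous_closed_vimage subalgebra_closed[OF S])
      (auto intro: linear_continuous_at bounded_linear_scalar_part bounded_linear_algebra_part)
  then show ?thesis
    unfolding cstar_subalgebra_def
    by (auto simp: subalgebra_intros[OF S] image_iff simp flip: incl_simps)
qed

text \<open>
  For commutative \<open>S\<close> the elementary operator is right multiplication by \<open>\<Sum> y* y\<close> on \<open>S\<close>, and the statement becomes
  the approximation property of \<open>S\<close>. In general the finite-rank operator is not close to the identity but
  only to an elementary operator. The bounds by \<open>2 \<parallel>a\<parallel>\<close> are independent of \<open>G\<close> and \<open>e\<close>, which allows the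
  two operators to be applied to limits of finite sums of elementary tensors.
\<close>

proposition nearly_finite_rank:
  fixes S G :: "'a::cstar_algebra set"
  assumes S: "cstar_subalgebra S" and G: "finite G" "G \<subseteq> S" and e: "0 < e"
  obtains ys \<phi> where "set ys \<subseteq> S" "\<And>y. contractive_functional (\<phi> y)"
    "norm (gram ys) \<le> 1"
    "\<And>a. a \<in> G \<Longrightarrow> norm (a - a * (gram ys)) \<le> e"
    "\<And>a. a \<in> G \<Longrightarrow> norm ((\<Sum>y\<leftarrow>ys. star y * a * y) - (\<Sum>y\<leftarrow>ys. \<phi> y a *\<^sub>C (star y * y))) \<le> e"
    "\<And>a. norm (\<Sum>y\<leftarrow>ys. star y * a * y) \<le> 2 * norm a"
    "\<And>a. norm (\<Sum>y\<leftarrow>ys. \<phi> y a *\<^sub>C (star y * y)) \<le> 2 * norm a"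
proof -
  obtain us \<psi> where us: "set us \<subseteq> incl ` S" and \<psi>: "\<And>y. contractive_functional (\<psi> y)"
    and n: "norm (gram us) \<le> 1"
    and a: "\<And>a. a \<in> incl ` G \<Longrightarrow> norm (a - a * (gram us)) \<le> e"
    "\<And>a. a \<in> incl ` G \<Longrightarrow> norm ((\<Sum>y\<leftarrow>us. star y * a * y) - (\<Sum>y\<leftarrow>us. \<psi> y a *\<^sub>C (star y * y))) \<le> e"
    using nearly_finite_rank_unital[OF cstar_subalgebra_incl[OF S], of "incl ` G" e] G e by blast
  define ys where "ys = map algebra_part us"
  define \<phi> where "\<phi> y a = \<psi> (incl y) (incl a)" for y a
  have us_eq: "us = map incl ys"
    unfolding ys_def using us by (induction us) auto
  have ysS: "set ys \<subseteq> S" using us by (auto simp: ys_def)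
  have s: "incl (gram ys) = (gram us)"
    unfolding us_eq by (induction ys) (simp_all add: incl_simps)
  have E: "incl (\<Sum>y\<leftarrow>ys. star y * a * y) = (\<Sum>y\<leftarrow>us. star y * incl a * y)" for a
    unfolding us_eq by (induction ys) (simp_all add: incl_simps)
  have T: "incl (\<Sum>y\<leftarrow>ys. \<phi> y a *\<^sub>C (star y * y)) = (\<Sum>y\<leftarrow>us. \<psi> y (incl a) *\<^sub>C (star y * y))" for a
    unfolding us_eq by (induction ys) (simp_all add: incl_simps \<phi>_def)
  have "contractive_functional (\<phi> y)" for y
  proof -
    have "cmod (\<psi> (incl y) (incl a)) \<le> norm a" for a
      using \<psi>[of "incl y"] norm_incl[of a] unfolding contractive_functional_def by metis
    then show ?thesis
      using \<psi>[of "incl y"] unfolding contractive_functional_def \<phi>_def by (simp add: incl_simps)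
  qed
  moreover have "norm (gram ys) \<le> 1" using n norm_incl[of "gram ys"] by (simp add: s)
  moreover have "norm (b - b * (gram ys)) \<le> e" if "b \<in> G" for b
    using a(1)[of "incl b"] that norm_incl[of "b - b * (gram ys)"]
    by (simp add: incl_simps(3,6) s)
  moreover have "norm ((\<Sum>y\<leftarrow>ys. star y * b * y) - (\<Sum>y\<leftarrow>ys. \<phi> y b *\<^sub>C (star y * y))) \<le> e" if "b \<in> G" for b
    using a(2)[of "incl b"] that
      norm_incl[of "(\<Sum>y\<leftarrow>ys. star y * b * y) - (\<Sum>y\<leftarrow>ys. \<phi> y b *\<^sub>C (star y * y))"]
    by (simp add: incl_simps(3) E T)
  moreover have "norm (\<Sum>y\<leftarrow>ys. star y * b * y) \<le> 2 * norm b" for b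
  proof -
    have "norm (\<Sum>y\<leftarrow>us. star y * incl b * y) \<le> 2 * norm (incl b) * norm (gram us)"
      by (rule norm_sum_compressions)
    also have "\<dots> \<le> 2 * norm (incl b) * 1" using n by (intro mult_left_mono) auto
    finally show ?thesis by (simp add: norm_incl flip: E)
  qed
  moreover have "norm (\<Sum>y\<leftarrow>ys. \<phi> y b *\<^sub>C (star y * y)) \<le> 2 * norm b" for b
  proof -
    have "norm (\<Sum>y\<leftarrow>us. \<psi> y (incl b) *\<^sub>C (star y * y)) \<le> 2 * norm (incl b) * norm (gram us)"
      by (rule norm_sum_complex_multiples) (use \<psi> in \<open>auto simp: contractive_functional_def\<close>)
    also have "\<dots> \<le> 2 * norm (incl b) * 1" using n by (intro mult_left_mono) auto
    finally show ?thesis by (simp add: norm_incl flip: T)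
  qed
  ultimately show ?thesis using that[of ys \<phi>] ysS by blast
qed

section \<open>Bounded maps on the projective tensor product\<close>

lemma ptensor_add_left: "(a + a') \<otimes>\<^sub>\<gamma> b = a \<otimes>\<^sub>\<gamma> b + a' \<otimes>\<^sub>\<gamma> b"
  by (simp add: ptensor_def atensor_add_left embed_add)

lemma ptensor_add_right: "a \<otimes>\<^sub>\<gamma> (b + b') = a \<otimes>\<^sub>\<gamma> b + a \<otimes>\<^sub>\<gamma> b'"
  by (simp add: ptensor_def atensor_add_right embed_add)

lemma ptensor_scaleC_left: "(c *\<^sub>C a) \<otimes>\<^sub>\<gamma> b = c *\<^sub>C (a \<otimes>\<^sub>\<gamma> b)"
  by (simp add: ptensor_def scaleC_atensor flip: embed_scaleC)

lemma ptensor_scaleC_right: "a \<otimes>\<^sub>\<gamma> (c *\<^sub>C b) = c *\<^sub>C (a \<otimes>\<^sub>\<gamma> b)"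
  by (simp add: ptensor_def scaleC_atensor atensor_balanced flip: embed_scaleC)

lemma norm_ptensor_le: "norm (a \<otimes>\<^sub>\<gamma> b) \<le> norm a * norm b"
  using pnorm_atensor_le[of "{#(a, b)#}"] by (simp add: ptensor_def norm_embed)

lemma ptensor_zero_left [simp]: "0 \<otimes>\<^sub>\<gamma> b = 0"
  using ptensor_add_left[of 0 0 b] by simp

lemma ptensor_zero_right [simp]: "a \<otimes>\<^sub>\<gamma> 0 = 0"
  using ptensor_add_right[of a 0 0] by simp

lemma embed_0 [simp]: "embed 0 = 0"
  using embed_add[of 0 0] by simp

abbreviation tensor_sum ::
    "('a::banach_star_algebra \<times> 'b::banach_star_algebra) multiset \<Rightarrow> ('a, 'b) ptensor"
  where "tensor_sum M \<equiv> \<Sum>(a, b)\<in>#M. a \<otimes>\<^sub>\<gamma> b"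

lemma ptensor_dense:
  fixes z :: "('a::banach_star_algebra, 'b::banach_star_algebra) ptensor"
  assumes "0 < e"
  obtains M where "norm (z - (\<Sum>(a, b)\<in>#M. a \<otimes>\<^sub>\<gamma> b)) < e"
proof -
  have "z \<in> closure (range embed)" by (simp add: closure_range_embed)
  then obtain u where u: "dist (embed u) z < e" unfolding closure_approachable using assms by blast
  obtain M where M: "u = (\<Sum>(a, b)\<in>#M. a \<otimes> b)" by (rule atensor_is_sum)
  have "embed u = (\<Sum>(a, b)\<in>#M. a \<otimes>\<^sub>\<gamma> b)"
    unfolding M by (induction M) (auto simp: embed_add ptensor_def)
  with u show ?thesis using that[of M] by (simp add: dist_norm norm_minus_commute)
qed

lemma ptensor_eqI:
  fixes F G :: "('a::banach_star_algebra, 'b::banach_star_algebra) ptensor \<Rightarrow> 'c::real_normed_vector"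
  assumes F: "bounded_linear F" and G: "bounded_linear G"
    and eq: "\<And>a b. F (a \<otimes>\<^sub>\<gamma> b) = G (a \<otimes>\<^sub>\<gamma> b)"
  shows "F z = G z"
proof -
  have "closed {z. F z = G z}"
    using F G by (intro closed_Collect_eq linear_continuous_on)
  moreover have "embed u \<in> {z. F z = G z}" for u
  proof (induction u)
    case (tensor a b)
    show ?case using eq[of a b] by (simp add: ptensor_def)
  qed (auto simp: embed_add linear_simps[OF F] linear_simps[OF G])
  ultimately have "closure (range embed) \<subseteq> {z. F z = G z}"
    by (intro closure_minimal) auto
  then show ?thesis by (auto simp: closure_range_embed)
qed

definition bounded_bilinear_map ::
    "real \<Rightarrow> ('a::banach_star_algebra \<Rightarrow> 'b::banach_star_algebra \<Rightarrow> 'c::banach_star_algebra) \<Rightarrow> bool"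
  where "bounded_bilinear_map K V \<longleftrightarrow> 0 \<le> K \<and>
    (\<forall>a a' b. V (a + a') b = V a b + V a' b) \<and> (\<forall>a b b'. V a (b + b') = V a b + V a b') \<and>
    (\<forall>c a b. V (c *\<^sub>C a) b = c *\<^sub>C V a b) \<and> (\<forall>c a b. V a (c *\<^sub>C b) = c *\<^sub>C V a b) \<and>
    (\<forall>a b. norm (V a b) \<le> K * (norm a * norm b))"

text \<open>
  The universal property of the algebraic tensor product gives a linear map \<open>g\<close>, which is Lipschitz for the
  projective seminorm by the definition of the latter as an infimum. It is extended by limits.
\<close>

lemma exists_ptensor_lift:
  fixes V :: "'a::banach_star_algebra \<Rightarrow> 'b::banach_star_algebra \<Rightarrow> 'c::banach_star_algebra"
  assumes V: "bounded_bilinear_map K V"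
  shows "\<exists>F. bounded_linear F \<and> (\<forall>a b. F (a \<otimes>\<^sub>\<gamma> b) = V a b) \<and> (\<forall>z. norm (F z) \<le> K * norm z)"
proof -
  have K: "0 \<le> K" using V by (simp add: bounded_bilinear_map_def)
  obtain g where g: "\<And>x y. g (x + y) = g x + g y" "\<And>c x. g (c *\<^sub>C x) = c *\<^sub>C g x"
      "\<And>a b. g (a \<otimes> b) = V a b"
  proof -
    have "\<exists>!g. (\<forall>x y. g (x + y) = g x + g y) \<and> (\<forall>c x. g (c *\<^sub>C x) = c *\<^sub>C g x) \<and>
        (\<forall>a b. g (a \<otimes> b) = V a b)"
      by (rule atensor_universal) (use V in \<open>simp_all add: bounded_bilinear_map_def\<close>)
    then show ?thesis using that by (elim ex1E conjE) auto
  qed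
  have g0: "g 0 = 0" using g(1)[of 0 0] by simp
  have gdiff: "g (x - y) = g x - g y" for x y using g(1)[of "x - y" y] by simp
  have g_le: "norm (g u) \<le> K * pnorm u" for u
  proof (rule field_le_epsilon)
    fix e :: real assume e: "0 < e"
    then have "0 < e / (K + 1)" using K by simp
    then obtain M where M: "u = (\<Sum>(a, b)\<in>#M. a \<otimes> b)"
        "(\<Sum>(a, b)\<in>#M. norm a * norm b) < pnorm u + e / (K + 1)"
      by (rule pnorm_atensor_approx)
    have "norm (g u) \<le> K * (\<Sum>(a, b)\<in>#M. norm a * norm b)"
      unfolding M(1)
    proof (induction M)
      case (add p M)
      obtain a b where p: "p = (a, b)" by force
      have "norm (g (a \<otimes> b)) \<le> K * (norm a * norm b)"
        using V by (simp add: g bounded_bilinear_map_def)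
      with add show ?case
        using norm_triangle_ineq[of "g (a \<otimes> b)" "g (\<Sum>(a, b)\<in>#M. a \<otimes> b)"]
        by (simp add: p g(1) algebra_simps)
    qed (simp add: g0)
    also have "\<dots> \<le> K * (pnorm u + e / (K + 1))" using M(2) K by (intro mult_left_mono) auto
    also have "\<dots> \<le> K * pnorm u + e" using K e by (simp add: field_simps)
    finally show "norm (g u) \<le> K * pnorm u + e" .
  qed
  have g_dist: "norm (g u - g v) \<le> K * norm (embed u - embed v)" for u v
    using g_le[of "u - v"] by (simp add: gdiff norm_embed flip: embed_diff)
  have "\<exists>X. (\<lambda>n. embed (X n)) \<longlonglongrightarrow> z" for z :: "('a, 'b) ptensor"
  proof -
    have "z \<in> closure (range embed)" by (simp add: closure_range_embed)
    then obtain y where y: "\<forall>n. y n \<in> range embed" "y \<longlonglongrightarrow> z" unfolding closure_sequential by blast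
    then have "\<forall>n. \<exists>x. y n = embed x" by auto
    from choice[OF this] obtain X where "\<forall>n. y n = embed (X n)" by blast
    then have "y = (\<lambda>n. embed (X n))" by auto
    with y show ?thesis by blast
  qed
  then have "\<forall>z :: ('a, 'b) ptensor. \<exists>X. (\<lambda>n. embed (X n)) \<longlonglongrightarrow> z" by blast
  from choice[OF this] obtain X
    where X: "\<And>z :: ('a, 'b) ptensor. (\<lambda>n. embed (X z n)) \<longlonglongrightarrow> z" by blast
  define F where "F z = lim (\<lambda>n. g (X z n))" for z
  have F: "(\<lambda>n. g (Y n)) \<longlonglongrightarrow> F z" if Y: "(\<lambda>n. embed (Y n)) \<longlonglongrightarrow> z" for Y z
  proof -
    have "Cauchy (\<lambda>n. g (X z n))"
    proof (rule metric_CauchyI)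
      fix e :: real assume e: "0 < e"
      then have "0 < e / (K + 1)" using K by simp
      then obtain N where N: "\<forall>m\<ge>N. \<forall>n\<ge>N. dist (embed (X z m)) (embed (X z n)) < e / (K + 1)"
        using metric_CauchyD[OF LIMSEQ_imp_Cauchy[OF X[of z]]] by blast
      have "dist (g (X z m)) (g (X z n)) < e" if "m \<ge> N" "n \<ge> N" for m n
      proof -
        have "dist (g (X z m)) (g (X z n)) \<le> K * dist (embed (X z m)) (embed (X z n))"
          using g_dist by (simp add: dist_norm)
        also have "\<dots> \<le> K * (e / (K + 1))" using N that K by (intro mult_left_mono) (auto intro: less_imp_le)
        also have "\<dots> < e" using K e by (simp add: field_simps)
        finally show ?thesis .
      qed
      then show "\<exists>N. \<forall>m\<ge>N. \<forall>n\<ge>N. dist (g (X z m)) (g (X z n)) < e" by blast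
    qed
    then have 1: "(\<lambda>n. g (X z n)) \<longlonglongrightarrow> F z"
      unfolding F_def using Cauchy_convergent convergent_LIMSEQ_iff by blast
    have "(\<lambda>n. K * norm (embed (Y n) - embed (X z n))) \<longlonglongrightarrow> K * norm (z - z)"
      by (intro tendsto_intros Y X)
    then have "(\<lambda>n. K * norm (embed (Y n) - embed (X z n))) \<longlonglongrightarrow> 0" by simp
    then have 2: "(\<lambda>n. g (Y n) - g (X z n)) \<longlonglongrightarrow> 0"
      by (rule Lim_null_comparison[rotated]) (use g_dist in auto)
    show ?thesis using tendsto_add[OF 2 1] by simp
  qed
  have add: "F (x + y) = F x + F y" for x y
  proof -
    have "(\<lambda>n. embed (X x n + X y n)) \<longlonglongrightarrow> x + y"
      unfolding embed_add by (intro tendsto_add X)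
    from F[OF this] have "(\<lambda>n. g (X x n) + g (X y n)) \<longlonglongrightarrow> F (x + y)" by (simp add: g)
    moreover have "(\<lambda>n. g (X x n) + g (X y n)) \<longlonglongrightarrow> F x + F y" by (intro tendsto_add F X)
    ultimately show ?thesis by (rule LIMSEQ_unique)
  qed
  have scale: "F (r *\<^sub>R x) = r *\<^sub>R F x" for r x
  proof -
    have "(\<lambda>n. embed (complex_of_real r *\<^sub>C X x n)) \<longlonglongrightarrow> r *\<^sub>R x"
      unfolding embed_scaleC scaleR_scaleC
      by (intro bounded_linear.tendsto[OF bounded_linear_scaleC] X)
    from F[OF this] have "(\<lambda>n. r *\<^sub>R g (X x n)) \<longlonglongrightarrow> F (r *\<^sub>R x)" by (simp add: g scaleR_scaleC)
    moreover have "(\<lambda>n. r *\<^sub>R g (X x n)) \<longlonglongrightarrow> r *\<^sub>R F x" by (intro tendsto_intros F X)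
    ultimately show ?thesis by (rule LIMSEQ_unique)
  qed
  have le: "norm (F z) \<le> K * norm z" for z
  proof (rule LIMSEQ_le)
    show "(\<lambda>n. norm (g (X z n))) \<longlonglongrightarrow> norm (F z)" by (intro tendsto_norm F X)
    show "(\<lambda>n. K * norm (embed (X z n))) \<longlonglongrightarrow> K * norm z" by (intro tendsto_intros X)
  qed (use g_le in \<open>auto simp: norm_embed\<close>)
  have "F (a \<otimes>\<^sub>\<gamma> b) = V a b" for a b
  proof -
    have "(\<lambda>n :: nat. embed (a \<otimes> b)) \<longlonglongrightarrow> a \<otimes>\<^sub>\<gamma> b" by (simp add: ptensor_def)
    from F[OF this] show ?thesis by (simp add: g LIMSEQ_const_iff)
  qed
  moreover have "bounded_linear F"
    by (rule bounded_linear_intro[of _ K]) (auto simp: add scale le mult.commute)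
  ultimately show ?thesis using le by blast
qed

definition ptensor_lift ::
    "('a::banach_star_algebra \<Rightarrow> 'b::banach_star_algebra \<Rightarrow> 'c::banach_star_algebra) \<Rightarrow>
      ('a, 'b) ptensor \<Rightarrow> 'c"
  where "ptensor_lift V = (SOME F. bounded_linear F \<and> (\<forall>a b. F (a \<otimes>\<^sub>\<gamma> b) = V a b))"

lemma
  assumes "bounded_bilinear_map K V"
  shows bounded_linear_ptensor_lift: "bounded_linear (ptensor_lift V)"
    and ptensor_lift: "ptensor_lift V (a \<otimes>\<^sub>\<gamma> b) = V a b"
    and norm_ptensor_lift: "norm (ptensor_lift V z) \<le> K * norm z"
proof -
  obtain F where F: "bounded_linear F" "\<forall>a b. F (a \<otimes>\<^sub>\<gamma> b) = V a b" "\<And>z. norm (F z) \<le> K * norm z"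
    using exists_ptensor_lift[OF assms] by blast
  then have "bounded_linear (ptensor_lift V) \<and> (\<forall>a b. ptensor_lift V (a \<otimes>\<^sub>\<gamma> b) = V a b)"
    unfolding ptensor_lift_def
    by (intro someI[where P = "\<lambda>F. bounded_linear F \<and> (\<forall>a b. F (a \<otimes>\<^sub>\<gamma> b) = V a b)"]) simp
  then show *: "bounded_linear (ptensor_lift V)" "ptensor_lift V (a \<otimes>\<^sub>\<gamma> b) = V a b" for a b
    by blast+
  have "ptensor_lift V z = F z" by (rule ptensor_eqI[OF *(1) F(1)]) (simp add: * F)
  then show "norm (ptensor_lift V z) \<le> K * norm z" using F(3) by simp
qed

text \<open>
  The map \<open>f \<otimes> id\<close>.
\<close>

definition left_map :: "('a::banach_star_algebra \<Rightarrow> 'c::banach_star_algebra) \<Rightarrow>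
    ('a, 'b::banach_star_algebra) ptensor \<Rightarrow> ('c, 'b) ptensor"
  where "left_map f = ptensor_lift (\<lambda>a b. f a \<otimes>\<^sub>\<gamma> b)"

definition bounded_complex_linear ::
    "real \<Rightarrow> ('a::banach_star_algebra \<Rightarrow> 'c::banach_star_algebra) \<Rightarrow> bool"
  where "bounded_complex_linear K f \<longleftrightarrow> 0 \<le> K \<and> (\<forall>x y. f (x + y) = f x + f y) \<and>
    (\<forall>c x. f (c *\<^sub>C x) = c *\<^sub>C f x) \<and> (\<forall>x. norm (f x) \<le> K * norm x)"

lemma bounded_bilinear_left_map:
  fixes f :: "'a::banach_star_algebra \<Rightarrow> 'c::banach_star_algebra"
  assumes "bounded_complex_linear K f"
  shows "bounded_bilinear_map K (\<lambda>a (b :: 'b::banach_star_algebra). f a \<otimes>\<^sub>\<gamma> b)"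
proof -
  have "norm (f a \<otimes>\<^sub>\<gamma> b) \<le> K * (norm a * norm b)" for a and b :: 'b
  proof -
    have "norm (f a \<otimes>\<^sub>\<gamma> b) \<le> norm (f a) * norm b" by (rule norm_ptensor_le)
    also have "\<dots> \<le> (K * norm a) * norm b"
      using assms by (intro mult_right_mono) (auto simp: bounded_complex_linear_def)
    finally show ?thesis by (simp add: mult.assoc)
  qed
  then show ?thesis using assms
    by (simp add: bounded_bilinear_map_def bounded_complex_linear_def ptensor_add_left
        ptensor_add_right ptensor_scaleC_left ptensor_scaleC_right)
qed

lemmas bounded_linear_left_map =
  bounded_linear_ptensor_lift[OF bounded_bilinear_left_map, folded left_map_def]
lemmas left_map = ptensor_lift[OF bounded_bilinear_left_map, folded left_map_def]
lemmas norm_left_map = norm_ptensor_lift[OF bounded_bilinear_left_map, folded left_map_def]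

lemma bounded_complex_linear_mult_left: "bounded_complex_linear (norm a) (\<lambda>x. a * x)"
  by (simp add: bounded_complex_linear_def distrib_left mult_scaleC_right norm_mult_ineq)

lemma bounded_complex_linear_mult_right: "bounded_complex_linear (norm a) (\<lambda>x. x * a)"
  using norm_mult_ineq[of _ a]
  by (simp add: bounded_complex_linear_def distrib_right mult_scaleC_left mult.commute[of "norm a"])

lemma bounded_complex_linear_compression:
  "bounded_complex_linear (norm y * norm y) (\<lambda>x. star y * x * y)"
proof -
  have "norm (star y * x * y) \<le> norm y * norm y * norm x" for x
    using order_trans[OF norm_mult_ineq mult_right_mono[OF norm_mult_ineq[of "star y" x] norm_ge_zero[of y]]]
    by (simp add: norm_star mult_ac)
  then show ?thesis
    by (simp add: bounded_complex_linear_def algebra_simps mult_scaleC_left mult_scaleC_right)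
qed

definition slice :: "('a::banach_star_algebra \<Rightarrow> complex) \<Rightarrow> ('a, 'b::banach_star_algebra) ptensor \<Rightarrow> 'b"
  where "slice \<phi> = ptensor_lift (\<lambda>a b. \<phi> a *\<^sub>C b)"

lemma bounded_bilinear_slice:
  assumes "contractive_functional \<phi>"
  shows "bounded_bilinear_map 1 (\<lambda>a (b :: 'b::banach_star_algebra). \<phi> a *\<^sub>C b)"
proof -
  have "norm (\<phi> a *\<^sub>C b) \<le> 1 * (norm a * norm b)" for a and b :: 'b
    using assms by (simp add: contractive_functional_def norm_scaleC mult_right_mono)
  with assms show ?thesis
    by (simp add: bounded_bilinear_map_def contractive_functional_def scaleC_add_left
        scaleC_add_right mult.commute)
qed

lemmas bounded_linear_slice = bounded_linear_ptensor_lift[OF bounded_bilinear_slice, folded slice_def]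
lemmas slice = ptensor_lift[OF bounded_bilinear_slice, folded slice_def]

text \<open>
  The flip, which makes statements about left factors available for right factors.
\<close>

definition swap :: "('a::banach_star_algebra, 'b::banach_star_algebra) ptensor \<Rightarrow> ('b, 'a) ptensor"
  where "swap = ptensor_lift (\<lambda>a b. b \<otimes>\<^sub>\<gamma> a)"

lemma bounded_bilinear_swap: "bounded_bilinear_map 1 (\<lambda>a b. b \<otimes>\<^sub>\<gamma> a)"
  unfolding bounded_bilinear_map_def
  by (auto simp: ptensor_add_left ptensor_add_right ptensor_scaleC_left ptensor_scaleC_right
      intro!: order_trans[OF norm_ptensor_le])

lemmas bounded_linear_swap = bounded_linear_ptensor_lift[OF bounded_bilinear_swap, folded swap_def]
lemmas swap_ptensor = ptensor_lift[OF bounded_bilinear_swap, folded swap_def]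

lemma swap_swap [simp]: "swap (swap z) = z"
  by (rule ptensor_eqI[OF bounded_linear_compose[OF bounded_linear_swap bounded_linear_swap]
        bounded_linear_ident]) (simp add: swap_ptensor)

lemma swap_mult: "swap (x * y) = swap x * swap y"
proof (rule ptensor_eqI[of "\<lambda>x. swap (x * y)" "\<lambda>x. swap x * swap y"])
  show "bounded_linear (\<lambda>x. swap (x * y))"
    by (rule bounded_linear_compose[OF bounded_linear_swap bounded_linear_mult_left])
  show "bounded_linear (\<lambda>x. swap x * swap y)"
    by (rule bounded_linear_compose[OF bounded_linear_mult_left bounded_linear_swap])
  fix a b
  show "swap ((a \<otimes>\<^sub>\<gamma> b) * y) = swap (a \<otimes>\<^sub>\<gamma> b) * swap y"
    by (rule ptensor_eqI[of "\<lambda>y. swap ((a \<otimes>\<^sub>\<gamma> b) * y)" "\<lambda>y. swap (a \<otimes>\<^sub>\<gamma> b) * swap y",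
        OF bounded_linear_compose[OF bounded_linear_swap bounded_linear_mult_right]
          bounded_linear_compose[OF bounded_linear_mult_right bounded_linear_swap]])
      (simp add: ptensor_mult swap_ptensor)
qed

lemma swap_center:
  assumes "z \<in> center" shows "swap z \<in> center"
proof -
  have "swap z * x = x * swap z" for x
  proof -
    have "swap (z * swap x) = swap (swap x * z)" using assms by (simp add: center_def)
    then show ?thesis by (simp add: swap_mult)
  qed
  then show ?thesis by (simp add: center_def)
qed

lemma swap_scaleC: "swap (c *\<^sub>C z) = c *\<^sub>C swap z"
  by (rule ptensor_eqI[of "\<lambda>z. swap (c *\<^sub>C z)" "\<lambda>z. c *\<^sub>C swap z",
        OF bounded_linear_compose[OF bounded_linear_swap bounded_linear_scaleC]
          bounded_linear_compose[OF bounded_linear_scaleC bounded_linear_swap]])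
    (simp add: swap_ptensor ptensor_scaleC_right flip: ptensor_scaleC_left)

lemma swap_sub_ptensor:
  assumes "z \<in> sub_ptensor S T" shows "swap z \<in> sub_ptensor T S"
proof -
  let ?G = "{a \<otimes>\<^sub>\<gamma> b | a b. a \<in> S \<and> b \<in> T}" and ?H = "{a \<otimes>\<^sub>\<gamma> b | a b. a \<in> T \<and> b \<in> S}"
  have "swap x \<in> complex_vector.span ?H" if "x \<in> complex_vector.span ?G" for x
    using that
  proof (induction rule: complex_vector.span_induct_alt)
    case base
    show ?case by (simp add: linear_simps[OF bounded_linear_swap] complex_vector.span_zero)
  next
    case (step c x y)
    then obtain a b where x: "x = a \<otimes>\<^sub>\<gamma> b" "a \<in> S" "b \<in> T" by blast
    have "swap x \<in> complex_vector.span ?H"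
      unfolding x(1) swap_ptensor by (rule complex_vector.span_base) (use x in blast)
    then show ?case using step
      by (simp add: linear_simps[OF bounded_linear_swap] swap_scaleC complex_vector.span_add
          complex_vector.span_scale)
  qed
  then have "swap ` closure (complex_vector.span ?G) \<subseteq> closure (complex_vector.span ?H)"
    by (intro image_closure_subset linear_continuous_on bounded_linear_swap)
      (use closure_subset in auto)
  with assms show ?thesis unfolding sub_ptensor_def by blast
qed

section \<open>Central tensors\<close>

text \<open>
  The approximate unit \<open>\<Sum> y* y\<close> is self-adjoint, so that approximation for the adjoints of \<open>G\<close> yields
  the other side.
\<close>

lemma exists_approximate_unit:
  fixes G :: "'a::cstar_algebra set"
  assumes "finite G" "0 < e"
  obtains s where "norm s \<le> 1" "\<And>b. b \<in> G \<Longrightarrow> norm (b - b * s) \<le> e" "\<And>b. b \<in> G \<Longrightarrow> norm (b - s * b) \<le> e"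
proof -
  have "cstar_subalgebra (UNIV :: 'a set)" by (simp add: cstar_subalgebra_def)
  moreover have "finite (G \<union> star ` G)" using assms by simp
  ultimately obtain ys where ys: "norm (gram ys) \<le> 1"
    "\<And>a. a \<in> G \<union> star ` G \<Longrightarrow> norm (a - a * (gram ys)) \<le> e"
    using nearly_finite_rank[of UNIV "G \<union> star ` G" e] assms(2) subset_UNIV by metis
  define s where "s = (gram ys)"
  have s: "star s = s" unfolding s_def by (induction ys) (simp_all add: star_add star_mult star_star)
  have "norm (b - s * b) \<le> e" if "b \<in> G" for b
  proof -
    have "norm (b - s * b) = norm (star (b - s * b))" by (simp add: norm_star)
    also have "star (b - s * b) = star b - star b * s" by (simp add: star_sub star_mult s)
    finally show ?thesis using ys(2)[of "star b"] that by (simp add: s_def)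
  qed
  then show ?thesis using that[of s] ys by (auto simp: s_def)
qed

text \<open>
  For unital \<open>B\<close> this is commutation with \<open>a \<otimes> 1\<close>. In general the unit is replaced by an element \<open>s\<close> that
  is almost a unit for the finitely many right entries of an approximation of \<open>z\<close>; its norm is at most one,
  so that the error of the approximation is not magnified.
\<close>

lemma central_left_map_commutes:
  fixes z :: "('a::cstar_algebra, 'b::cstar_algebra) ptensor"
  assumes z: "z \<in> center"
  shows "left_map (\<lambda>x. a * x) z = left_map (\<lambda>x. x * a) z"
proof -
  note L = bounded_complex_linear_mult_left[of a] and R = bounded_complex_linear_mult_right[of a]
  have "norm (left_map (\<lambda>x. a * x) z - left_map (\<lambda>x. x * a) z) \<le> 0 + e" if e: "0 < e" for e
  proof -
    define d where "d = e / (4 * norm a + 2)"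
    have d: "0 < d" using e by (simp add: d_def add_nonneg_pos)
    obtain M where M: "norm (z - (\<Sum>(x, b)\<in>#M. x \<otimes>\<^sub>\<gamma> b)) < d" using ptensor_dense[OF d] .
    let ?w = "\<Sum>(x, b)\<in>#M. x \<otimes>\<^sub>\<gamma> b"
    define C where "C = (\<Sum>(x, b)\<in>#M. norm a * norm x)"
    have C: "0 \<le> C" unfolding C_def by (induction M) auto
    define t where "t = d / (C + 1)"
    have t: "0 < t" using d C by (simp add: t_def)
    then obtain s where s: "norm s \<le> 1"
      "\<And>b. b \<in> snd ` set_mset M \<Longrightarrow> norm (b - b * s) \<le> t"
      "\<And>b. b \<in> snd ` set_mset M \<Longrightarrow> norm (b - s * b) \<le> t"
      by (rule exists_approximate_unit[OF finite_imageI[OF finite_set_mset]]) (rule that; blast)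
    have dC: "C * t \<le> d" using C d by (simp add: t_def field_simps)
    have nas: "norm (a \<otimes>\<^sub>\<gamma> s) \<le> norm a"
      using norm_ptensor_le[of a s] mult_left_mono[OF s(1) norm_ge_zero[of a]] by simp
    have 1: "norm (left_map (\<lambda>x. a * x) ?w - (a \<otimes>\<^sub>\<gamma> s) * ?w) \<le> C * t"
      using s(3) unfolding C_def
    proof (induction M)
      case (add p M)
      obtain x b where p: "p = (x, b)" by force
      have "(a * x) \<otimes>\<^sub>\<gamma> b - (a * x) \<otimes>\<^sub>\<gamma> (s * b) = (a * x) \<otimes>\<^sub>\<gamma> (b - s * b)"
        using ptensor_add_right[of "a * x" "b - s * b" "s * b"] by simp
      also have "norm \<dots> \<le> norm (a * x) * norm (b - s * b)" by (rule norm_ptensor_le)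
      also have "\<dots> \<le> (norm a * norm x) * t"
        by (intro mult_mono norm_mult_ineq add.prems) (use p in auto)
      finally have *: "norm ((a * x) \<otimes>\<^sub>\<gamma> b - (a * x) \<otimes>\<^sub>\<gamma> (s * b)) \<le> (norm a * norm x) * t" .
      have IH: "norm (left_map (\<lambda>x. a * x) (\<Sum>(x, b)\<in>#M. x \<otimes>\<^sub>\<gamma> b) - (a \<otimes>\<^sub>\<gamma> s) * (\<Sum>(x, b)\<in>#M. x \<otimes>\<^sub>\<gamma> b))
          \<le> (\<Sum>(x, b)\<in>#M. norm a * norm x) * t"
        by (rule add.IH) (use add.prems in auto)
      show ?case using norm_triangle_mono[OF * IH]
        by (simp add: p linear_simps[OF bounded_linear_left_map[OF L]] left_map[OF L] distrib_left
            ptensor_mult algebra_simps)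
    qed (simp add: linear_simps[OF bounded_linear_left_map[OF L]])
    have 2: "norm (left_map (\<lambda>x. x * a) ?w - ?w * (a \<otimes>\<^sub>\<gamma> s)) \<le> C * t"
      using s(2) unfolding C_def
    proof (induction M)
      case (add p M)
      obtain x b where p: "p = (x, b)" by force
      have "(x * a) \<otimes>\<^sub>\<gamma> b - (x * a) \<otimes>\<^sub>\<gamma> (b * s) = (x * a) \<otimes>\<^sub>\<gamma> (b - b * s)"
        using ptensor_add_right[of "x * a" "b - b * s" "b * s"] by simp
      also have "norm \<dots> \<le> norm (x * a) * norm (b - b * s)" by (rule norm_ptensor_le)
      also have "\<dots> \<le> (norm a * norm x) * t"
        by (intro mult_mono add.prems) (use p norm_mult_ineq[of x a] in \<open>auto simp: mult.commute\<close>)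
      finally have *: "norm ((x * a) \<otimes>\<^sub>\<gamma> b - (x * a) \<otimes>\<^sub>\<gamma> (b * s)) \<le> (norm a * norm x) * t" .
      have IH: "norm (left_map (\<lambda>x. x * a) (\<Sum>(x, b)\<in>#M. x \<otimes>\<^sub>\<gamma> b) - (\<Sum>(x, b)\<in>#M. x \<otimes>\<^sub>\<gamma> b) * (a \<otimes>\<^sub>\<gamma> s))
          \<le> (\<Sum>(x, b)\<in>#M. norm a * norm x) * t"
        by (rule add.IH) (use add.prems in auto)
      show ?case using norm_triangle_mono[OF * IH]
        by (simp add: p linear_simps[OF bounded_linear_left_map[OF R]] left_map[OF R] distrib_right
            ptensor_mult algebra_simps)
    qed (simp add: linear_simps[OF bounded_linear_left_map[OF R]])
    have zc: "(a \<otimes>\<^sub>\<gamma> s) * z = z * (a \<otimes>\<^sub>\<gamma> s)" using z by (simp add: center_def)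
    have zw: "norm (z - ?w) \<le> d" using M by simp
    have n1: "norm (left_map (\<lambda>x. a * x) (z - ?w)) \<le> norm a * d"
      by (rule order_trans[OF norm_left_map[OF L]]) (intro mult_left_mono zw norm_ge_zero)
    have n6: "norm (left_map (\<lambda>x. x * a) (z - ?w)) \<le> norm a * d"
      by (rule order_trans[OF norm_left_map[OF R]]) (intro mult_left_mono zw norm_ge_zero)
    have n3: "norm ((a \<otimes>\<^sub>\<gamma> s) * (z - ?w)) \<le> norm a * d"
      by (rule order_trans[OF norm_mult_ineq]) (intro mult_mono nas zw, auto)
    have n4: "norm ((z - ?w) * (a \<otimes>\<^sub>\<gamma> s)) \<le> d * norm a"
      by (rule order_trans[OF norm_mult_ineq]) (intro mult_mono nas zw, use d in auto)
    have eq: "left_map (\<lambda>x. a * x) z - left_map (\<lambda>x. x * a) z =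
        left_map (\<lambda>x. a * x) (z - ?w) + (left_map (\<lambda>x. a * x) ?w - (a \<otimes>\<^sub>\<gamma> s) * ?w)
        - (a \<otimes>\<^sub>\<gamma> s) * (z - ?w) + (z - ?w) * (a \<otimes>\<^sub>\<gamma> s)
        - (left_map (\<lambda>x. x * a) ?w - ?w * (a \<otimes>\<^sub>\<gamma> s)) - left_map (\<lambda>x. x * a) (z - ?w)"
      by (simp add: linear_simps[OF bounded_linear_left_map[OF L]]
          linear_simps[OF bounded_linear_left_map[OF R]] zc algebra_simps)
    have tri: "norm (p + q - r + t - u - v) \<le> norm p + norm q + norm r + norm t + norm u + norm v"
      for p q r t u v :: "('a, 'b) ptensor"
      by (intro order_trans[OF norm_triangle_ineq4] add_right_mono order_trans[OF norm_triangle_ineq]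
          order_refl)
    have "norm (left_map (\<lambda>x. a * x) z - left_map (\<lambda>x. x * a) z)
        \<le> norm a * d + C * t + norm a * d + d * norm a + C * t + norm a * d"
      by (subst eq, rule order_trans[OF tri]) (intro add_mono n1 1 n3 n4 2 n6)
    also have "\<dots> \<le> norm a * d + d + norm a * d + d * norm a + d + norm a * d"
      using dC by simp
    also have "\<dots> = (4 * norm a + 2) * d" by (simp add: algebra_simps)
    also have "\<dots> = e"
      using add_nonneg_pos[of "4 * norm a" 2] unfolding d_def by (simp del: distrib_right_numeral)
    finally show ?thesis by simp
  qed
  then have "norm (left_map (\<lambda>x. a * x) z - left_map (\<lambda>x. x * a) z) \<le> 0" by (rule field_le_epsilon)
  then show ?thesis by simp
qed

text \<open>
  Slicing intertwines multiplication by \<open>1 \<otimes> y\<close> with multiplication by \<open>y\<close>, and \<open>z\<close> commutes with \<open>1 \<otimes> y\<close>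
  in the sense of the preceding lemma.
\<close>

lemma slice_center:
  fixes z :: "('a::cstar_algebra, 'b::cstar_algebra) ptensor"
  assumes z: "z \<in> center" and \<phi>: "contractive_functional \<phi>"
  shows "slice \<phi> z \<in> center"
proof -
  have "slice \<phi> z * y = y * slice \<phi> z" for y
  proof -
    note L = bounded_complex_linear_mult_left[of y] and R = bounded_complex_linear_mult_right[of y]
    note bl = bounded_linear_compose[OF bounded_linear_slice[OF \<phi>]
        bounded_linear_compose[OF bounded_linear_swap]]
    have "y * slice \<phi> z = slice \<phi> (swap (left_map (\<lambda>x. y * x) (swap z)))"
      by (rule ptensor_eqI[of "\<lambda>z. y * slice \<phi> z" "\<lambda>z. slice \<phi> (swap (left_map (\<lambda>x. y * x) (swap z)))",
            OF bounded_linear_compose[OF bounded_linear_mult_right bounded_linear_slice[OF \<phi>]]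
              bl[OF bounded_linear_compose[OF bounded_linear_left_map[OF L] bounded_linear_swap]]])
        (simp add: slice[OF \<phi>] swap_ptensor left_map[OF L] mult_scaleC_right)
    also have "left_map (\<lambda>x. y * x) (swap z) = left_map (\<lambda>x. x * y) (swap z)"
      by (rule central_left_map_commutes[OF swap_center[OF z]])
    also have "slice \<phi> (swap (left_map (\<lambda>x. x * y) (swap z))) = slice \<phi> z * y"
      by (rule ptensor_eqI[of "\<lambda>z. slice \<phi> (swap (left_map (\<lambda>x. x * y) (swap z)))" "\<lambda>z. slice \<phi> z * y",
            OF bl[OF bounded_linear_compose[OF bounded_linear_left_map[OF R] bounded_linear_swap]]
              bounded_linear_compose[OF bounded_linear_mult_left bounded_linear_slice[OF \<phi>]]])
        (simp add: slice[OF \<phi>] swap_ptensor left_map[OF R] mult_scaleC_left)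
    finally show ?thesis by simp
  qed
  then show ?thesis by (simp add: center_def)
qed

lemma span_tensors_is_sum:
  assumes "w \<in> complex_vector.span {a \<otimes>\<^sub>\<gamma> b | a b. a \<in> S \<and> b \<in> T}" and S: "cstar_subalgebra S"
  obtains M where "w = (\<Sum>(a, b)\<in>#M. a \<otimes>\<^sub>\<gamma> b)" "fst ` set_mset M \<subseteq> S"
proof -
  have "\<exists>M. w = (\<Sum>(a, b)\<in>#M. a \<otimes>\<^sub>\<gamma> b) \<and> fst ` set_mset M \<subseteq> S"
    using assms(1)
  proof (induction rule: complex_vector.span_induct_alt)
    case base
    show ?case by (intro exI[of _ "{#}"]) simp
  next
    case (step c x y)
    then obtain a b M where "x = a \<otimes>\<^sub>\<gamma> b" "a \<in> S" "y = (\<Sum>(a, b)\<in>#M. a \<otimes>\<^sub>\<gamma> b)" "fst ` set_mset M \<subseteq> S"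
      by blast
    then show ?case
      by (intro exI[of _ "add_mset (c *\<^sub>C a, b) M"])
        (simp add: ptensor_scaleC_left subalgebra_scaleC[OF S])
  qed
  then show ?thesis using that by blast
qed

text \<open>
  An operator that is small on the left entries of an approximation of \<open>z\<close>, and bounded, is small on \<open>z\<close>.
\<close>

lemma norm_left_map_near_sum:
  assumes f: "bounded_complex_linear K f" and z: "norm (z - (\<Sum>(a, b)\<in>#M. a \<otimes>\<^sub>\<gamma> b)) \<le> e"
    and small: "\<And>a. a \<in> fst ` set_mset M \<Longrightarrow> norm (f a) \<le> d"
  shows "norm (left_map f z) \<le> K * e + d * (\<Sum>(a, b)\<in>#M. norm b)"
proof -
  let ?w = "\<Sum>(a, b)\<in>#M. a \<otimes>\<^sub>\<gamma> b"
  have K: "0 \<le> K" using f by (simp add: bounded_complex_linear_def)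
  have "norm (left_map f ?w) \<le> d * (\<Sum>(a, b)\<in>#M. norm b)"
    using small
  proof (induction M)
    case (add p M)
    obtain a b where p: "p = (a, b)" by force
    have "norm (f a \<otimes>\<^sub>\<gamma> b) \<le> norm (f a) * norm b" by (rule norm_ptensor_le)
    also have "\<dots> \<le> d * norm b" by (intro mult_right_mono add.prems) (auto simp: p)
    finally have 1: "norm (f a \<otimes>\<^sub>\<gamma> b) \<le> d * norm b" .
    have 2: "norm (left_map f (\<Sum>(a, b)\<in>#M. a \<otimes>\<^sub>\<gamma> b)) \<le> d * (\<Sum>(a, b)\<in>#M. norm b)"
      by (rule add.IH) (use add.prems in auto)
    show ?case using norm_triangle_mono[OF 1 2]
      by (simp add: p linear_simps[OF bounded_linear_left_map[OF f]] left_map[OF f] distrib_left)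
  qed (simp add: linear_simps[OF bounded_linear_left_map[OF f]])
  moreover have "norm (left_map f (z - ?w)) \<le> K * e"
    by (rule order_trans[OF norm_left_map[OF f]]) (intro mult_left_mono z K)
  ultimately have "norm (left_map f (z - ?w) + left_map f ?w) \<le> K * e + d * (\<Sum>(a, b)\<in>#M. norm b)"
    by (rule norm_triangle_mono[rotated])
  then show ?thesis by (simp add: linear_simps[OF bounded_linear_left_map[OF f]])
qed

lemma bounded_linear_sum_list:
  assumes "\<And>y. y \<in> set ys \<Longrightarrow> bounded_linear (f y)"
  shows "bounded_linear (\<lambda>z. \<Sum>y\<leftarrow>ys. f y z)"
  using assms by (induction ys) (auto intro: bounded_linear_add bounded_linear_zero)

lemma ptensor_sum_list_left: "(\<Sum>y\<leftarrow>ys. f y) \<otimes>\<^sub>\<gamma> b = (\<Sum>y\<leftarrow>ys. f y \<otimes>\<^sub>\<gamma> b)"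
  by (induction ys) (simp_all add: ptensor_add_left)

text \<open>
  With \<open>E\<close> and \<open>T\<close> from \<open>nearly_finite_rank\<close> for the left entries of an approximation of \<open>z\<close>, and with
  \<open>s = \<Sum> y* y\<close>, each of the following is close to the next one: \<open>z\<close>, the image of \<open>z\<close> under right
  multiplication of the left factor by \<open>s\<close>, and \<open>(T \<otimes> id) z\<close>. The second of them equals \<open>(E \<otimes> id) z\<close>, since
  centrality lets \<open>y*\<close> pass from the left of \<open>z\<close> to the right. The last one is a sum of tensors \<open>y* y \<otimes> b\<close>
  with slices \<open>b\<close> of \<open>z\<close>, which are central.
\<close>

proposition central_mem_sub_ptensor:
  fixes z :: "('a::cstar_algebra, 'b::cstar_algebra) ptensor"
  assumes z: "z \<in> center" and S: "cstar_subalgebra S" and zS: "z \<in> sub_ptensor S UNIV"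
  shows "z \<in> sub_ptensor S center"
  unfolding sub_ptensor_def
proof (rule closed_approach[OF closed_closure])
  fix e :: real assume e: "0 < e"
  let ?H = "{a \<otimes>\<^sub>\<gamma> b | a b. a \<in> S \<and> b \<in> (center :: 'b set)}"
  \<comment> \<open>The errors are 3 d for the unit and 5 d for the finite rank.\<close>
  define d where "d = e / 8"
  have d: "0 < d" using e by (simp add: d_def)
  obtain w where w: "w \<in> complex_vector.span {a \<otimes>\<^sub>\<gamma> b | a b. a \<in> S \<and> b \<in> (UNIV :: 'b set)}" "dist w z < d"
    using zS d unfolding sub_ptensor_def closure_approachable by blast
  obtain M where M: "w = (\<Sum>(a, b)\<in>#M. a \<otimes>\<^sub>\<gamma> b)" "fst ` set_mset M \<subseteq> S"
    using span_tensors_is_sum[OF w(1) S] .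
  have zM: "norm (z - (\<Sum>(a, b)\<in>#M. a \<otimes>\<^sub>\<gamma> b)) \<le> d"
    using w(2) by (simp add: M(1) dist_norm norm_minus_commute)
  define C where "C = (\<Sum>(a, b)\<in>#M. norm b)"
  have C: "0 \<le> C" unfolding C_def by (induction M) auto
  define t where "t = d / (C + 1)"
  have t: "0 < t" "t * C \<le> d" using d C by (simp_all add: t_def field_simps)
  obtain ys \<phi> where ys: "set ys \<subseteq> S" and \<phi>: "\<And>y. contractive_functional (\<phi> y)"
    and n1: "norm (gram ys) \<le> 1"
    and unit: "\<And>a. a \<in> fst ` set_mset M \<Longrightarrow> norm (a - a * (gram ys)) \<le> t"
    and near: "\<And>a. a \<in> fst ` set_mset M \<Longrightarrow>
      norm ((\<Sum>y\<leftarrow>ys. star y * a * y) - (\<Sum>y\<leftarrow>ys. \<phi> y a *\<^sub>C (star y * y))) \<le> t"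
    and nE: "\<And>a. norm (\<Sum>y\<leftarrow>ys. star y * a * y) \<le> 2 * norm a"
    and nT: "\<And>a. norm (\<Sum>y\<leftarrow>ys. \<phi> y a *\<^sub>C (star y * y)) \<le> 2 * norm a"
    using that by (rule nearly_finite_rank[OF S finite_imageI[OF finite_set_mset] M(2) t(1)])
  define s where "s = (gram ys)"
  define E where "E a = (\<Sum>y\<leftarrow>ys. star y * a * y)" for a
  define T where "T a = (\<Sum>y\<leftarrow>ys. \<phi> y a *\<^sub>C (star y * y))" for a
  have \<phi>': "\<phi> y (a + b) = \<phi> y a + \<phi> y b" "\<phi> y (c *\<^sub>C a) = c * \<phi> y a" for y a b c
    using \<phi>[of y] by (simp_all add: contractive_functional_def)
  have Eadd: "E (a + b) = E a + E b" and Escale: "E (c *\<^sub>C a) = c *\<^sub>C E a"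
    and Tadd: "T (a + b) = T a + T b" and Tscale: "T (c *\<^sub>C a) = c *\<^sub>C T a" for a b c
    unfolding E_def T_def
    by (induction ys) (simp_all add: algebra_simps mult_scaleC_left mult_scaleC_right
        scaleC_add_right scaleC_add_left scaleC_scaleC \<phi>')
  have E: "bounded_complex_linear 2 E"
    using nE by (simp add: bounded_complex_linear_def Eadd Escale flip: E_def)
  have T: "bounded_complex_linear 2 T"
    using nT by (simp add: bounded_complex_linear_def Tadd Tscale flip: T_def)
  have ET: "bounded_complex_linear 4 (\<lambda>a. E a - T a)"
  proof -
    have "norm (E a - T a) \<le> 4 * norm a" for a
      using norm_triangle_ineq4[of "E a" "T a"] nE[of a] nT[of a] by (simp flip: E_def T_def)
    then show ?thesis
      by (simp add: bounded_complex_linear_def Eadd Escale Tadd Tscale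
          complex_vector.scale_right_diff_distrib)
  qed
  have U: "bounded_complex_linear 2 (\<lambda>a. a - a * s)"
  proof -
    have "norm (a - a * s) \<le> 2 * norm a" for a
    proof -
      have "norm (a - a * s) \<le> norm a + norm a * norm s"
        by (intro order_trans[OF norm_triangle_ineq4] add_left_mono norm_mult_ineq)
      also have "\<dots> \<le> norm a + norm a * 1"
        using n1 by (intro add_left_mono mult_left_mono) (auto simp: s_def)
      finally show ?thesis by simp
    qed
    then show ?thesis
      by (simp add: bounded_complex_linear_def algebra_simps mult_scaleC_left
          complex_vector.scale_right_diff_distrib)
  qed
  note blE = bounded_linear_left_map[OF E] and blT = bounded_linear_left_map[OF T]
    and blET = bounded_linear_left_map[OF ET] and blU = bounded_linear_left_map[OF U]
  have 1: "norm (left_map (\<lambda>a. a - a * s) z) \<le> 2 * d + t * C"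
    unfolding C_def by (rule norm_left_map_near_sum[OF U zM]) (use unit in \<open>simp add: s_def\<close>)
  have 2: "norm (left_map (\<lambda>a. E a - T a) z) \<le> 4 * d + t * C"
    unfolding C_def by (rule norm_left_map_near_sum[OF ET zM]) (use near in \<open>simp add: E_def T_def\<close>)
  have comp: "left_map (\<lambda>x. star y * x * y) z = left_map (\<lambda>x. x * (star y * y)) z" for y
  proof -
    note L = bounded_complex_linear_mult_left[of "star y"]
      and R = bounded_complex_linear_mult_right[of y]
      and R' = bounded_complex_linear_mult_right[of "star y"]
      and R'' = bounded_complex_linear_mult_right[of "star y * y"]
    note LR = bounded_complex_linear_compression[of y]
    have "left_map (\<lambda>x. star y * x * y) z = left_map (\<lambda>x. x * y) (left_map (\<lambda>x. star y * x) z)"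
      by (rule ptensor_eqI[OF bounded_linear_left_map[OF LR]
            bounded_linear_compose[OF bounded_linear_left_map[OF R] bounded_linear_left_map[OF L]]])
        (simp add: left_map[OF L] left_map[OF R] left_map[OF LR])
    also have "left_map (\<lambda>x. star y * x) z = left_map (\<lambda>x. x * star y) z"
      by (rule central_left_map_commutes[OF z])
    also have "left_map (\<lambda>x. x * y) (left_map (\<lambda>x. x * star y) z) = left_map (\<lambda>x. x * (star y * y)) z"
      by (rule ptensor_eqI[OF bounded_linear_compose[OF bounded_linear_left_map[OF R]
              bounded_linear_left_map[OF R']] bounded_linear_left_map[OF R'']])
        (simp add: left_map[OF R'] left_map[OF R] left_map[OF R''] mult.assoc)
    finally show ?thesis .
  qed
  have Ez: "left_map E z = z - left_map (\<lambda>a. a - a * s) z"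
  proof -
    note bl1 = bounded_complex_linear_compression
    have bl2: "bounded_complex_linear (norm (star y * y)) (\<lambda>x. x * (star y * y))" for y :: 'a
      by (rule bounded_complex_linear_mult_right)
    have "left_map E z = (\<Sum>y\<leftarrow>ys. left_map (\<lambda>x. star y * x * y) z)"
      by (rule ptensor_eqI[OF blE bounded_linear_sum_list[OF bounded_linear_left_map[OF bl1]]])
        (simp only: left_map[OF E] left_map[OF bl1], simp only: E_def ptensor_sum_list_left)
    also have "\<dots> = (\<Sum>y\<leftarrow>ys. left_map (\<lambda>x. x * (star y * y)) z)" by (simp only: comp)
    also have "\<dots> = z - left_map (\<lambda>a. a - a * s) z"
    proof (rule ptensor_eqI[OF bounded_linear_sum_list[OF bounded_linear_left_map[OF bl2]]
          bounded_linear_sub[OF bounded_linear_ident blU]])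
      fix a b
      have "(\<Sum>y\<leftarrow>ys. (a * (star y * y)) \<otimes>\<^sub>\<gamma> (b :: 'b)) = (a * s) \<otimes>\<^sub>\<gamma> b"
        unfolding s_def by (induction ys) (simp_all add: distrib_left ptensor_add_left)
      moreover have "a \<otimes>\<^sub>\<gamma> b - (a - a * s) \<otimes>\<^sub>\<gamma> b = (a * s) \<otimes>\<^sub>\<gamma> b"
        using ptensor_add_left[of "a - a * s" "a * s" b] by (simp add: algebra_simps)
      ultimately show "(\<Sum>y\<leftarrow>ys. left_map (\<lambda>x. x * (star y * y)) (a \<otimes>\<^sub>\<gamma> b))
          = a \<otimes>\<^sub>\<gamma> b - left_map (\<lambda>a. a - a * s) (a \<otimes>\<^sub>\<gamma> b)"
        by (simp add: left_map[OF bl2] left_map[OF U])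
    qed
    finally show ?thesis .
  qed
  have ETz: "left_map (\<lambda>a. E a - T a) z = left_map E z - left_map T z"
  proof (rule ptensor_eqI[OF blET bounded_linear_sub[OF blE blT]])
    fix a b
    show "left_map (\<lambda>a. E a - T a) (a \<otimes>\<^sub>\<gamma> b) = left_map E (a \<otimes>\<^sub>\<gamma> b) - left_map T (a \<otimes>\<^sub>\<gamma> b)"
      using ptensor_add_left[of "E a - T a" "T a" b]
      by (simp add: left_map[OF E] left_map[OF T] left_map[OF ET])
  qed
  have "z - left_map T z = left_map (\<lambda>a. E a - T a) z + left_map (\<lambda>a. a - a * s) z"
    unfolding ETz Ez by simp
  then have "norm (z - left_map T z)
      \<le> norm (left_map (\<lambda>a. E a - T a) z) + norm (left_map (\<lambda>a. a - a * s) z)"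
    by (simp only: norm_triangle_ineq)
  also have "\<dots> \<le> e" using 1 2 t(2) by (simp add: d_def)
  finally have close: "norm (left_map T z - z) \<le> e" by (simp add: norm_minus_commute)
  have bl3: "bounded_linear (\<lambda>z :: ('a, 'b) ptensor. p \<otimes>\<^sub>\<gamma> slice (\<phi> y) z)" for p :: 'a and y
  proof -
    have p: "bounded_linear (\<lambda>b :: 'b. p \<otimes>\<^sub>\<gamma> b)"
      by (rule bounded_linear_intro[of _ "norm p"])
        (auto simp: ptensor_add_right scaleR_scaleC ptensor_scaleC_right mult.commute norm_ptensor_le)
    show ?thesis by (rule bounded_linear_compose[OF p bounded_linear_slice[OF \<phi>]])
  qed
  have "left_map T z = (\<Sum>y\<leftarrow>ys. (star y * y) \<otimes>\<^sub>\<gamma> slice (\<phi> y) z)"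
    by (rule ptensor_eqI[OF blT bounded_linear_sum_list[OF bl3]])
      (simp only: left_map[OF T] slice[OF \<phi>],
        simp only: T_def ptensor_sum_list_left ptensor_scaleC_left ptensor_scaleC_right)
  also have "\<dots> \<in> complex_vector.span ?H"
    using ys
  proof (induction ys)
    case (Cons y ys)
    have "(star y * y) \<otimes>\<^sub>\<gamma> slice (\<phi> y) z \<in> ?H"
      using Cons.prems slice_center[OF z \<phi>] by (auto intro: subalgebra_intros[OF S])
    then show ?case using Cons
      by (simp add: complex_vector.span_add complex_vector.span_base)
  qed (simp add: complex_vector.span_zero)
  finally show "\<exists>x\<in>closure (complex_vector.span ?H). norm (x - z) \<le> e"
    using close closure_subset by blast
qed

lemma centerD: "z \<in> center \<Longrightarrow> z * x = x * z"
  unfolding center_def by blast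

lemma centerI: "(\<And>x. z * x = x * z) \<Longrightarrow> z \<in> center"
  unfolding center_def by blast

lemma closed_center: "closed (center :: 'a::banach_star_algebra set)"
proof -
  have "closed {z :: 'a. z * x = x * z}" for x
    by (intro closed_Collect_eq continuous_intros)
  then have "closed (\<Inter>x. {z :: 'a. z * x = x * z})" by (intro closed_INT ballI)
  moreover have "(\<Inter>x. {z :: 'a. z * x = x * z}) = center" unfolding center_def by blast
  ultimately show ?thesis by simp
qed

lemma cstar_subalgebra_center: "cstar_subalgebra (center :: 'a::banach_star_algebra set)"
proof -
  have mult: "x * y \<in> center" if "x \<in> center" "y \<in> center" for x y :: 'a
  proof -
    have "(x * y) * v = v * (x * y)" for v
    proof -
      have "(x * y) * v = x * (v * y)" by (simp only: mult.assoc centerD[OF that(2)])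
      also have "\<dots> = (v * x) * y"
        by (simp only: mult.assoc[symmetric] centerD[OF that(1), of v])
      finally show ?thesis by (simp only: mult.assoc)
    qed
    then show ?thesis by (rule centerI)
  qed
  have star: "star x \<in> center" if "x \<in> center" for x :: 'a
  proof -
    have "star x * y = y * star x" for y
    proof -
      have "star (star y * x) = star (x * star y)" by (simp only: centerD[OF that])
      then show ?thesis by (simp only: star_mult star_star)
    qed
    then show ?thesis by (rule centerI)
  qed
  have add: "x + y \<in> center" if "x \<in> center" "y \<in> center" for x y :: 'a
    by (rule centerI) (simp only: distrib_left distrib_right centerD[OF that(1)] centerD[OF that(2)])
  have scale: "c *\<^sub>C x \<in> center" if "x \<in> center" for c and x :: 'a
    by (rule centerI) (simp only: mult_scaleC_left mult_scaleC_right centerD[OF that])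
  have zero: "0 \<in> (center :: 'a set)" by (simp add: center_def)
  show ?thesis unfolding cstar_subalgebra_def
    by (intro conjI ballI allI closed_center zero add scale mult star)
qed

lemma sub_ptensor_UNIV:
  "sub_ptensor UNIV UNIV = (UNIV :: ('a::banach_star_algebra, 'b::banach_star_algebra) ptensor set)"
proof -
  let ?H = "{a \<otimes>\<^sub>\<gamma> b | (a :: 'a) (b :: 'b). a \<in> UNIV \<and> b \<in> UNIV}"
  have "embed u \<in> complex_vector.span ?H" for u :: "('a, 'b) atensor"
  proof (induction u)
    case (tensor a b)
    have "a \<otimes>\<^sub>\<gamma> b \<in> complex_vector.span ?H" by (rule complex_vector.span_base) blast
    then show ?case by (simp add: ptensor_def)
  qed (simp_all add: embed_add complex_vector.span_zero complex_vector.span_add)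
  then have "closure (range embed) \<subseteq> sub_ptensor (UNIV :: 'a set) (UNIV :: 'b set)"
    unfolding sub_ptensor_def by (intro closure_mono) auto
  then show ?thesis unfolding closure_range_embed by blast
qed

lemma sub_ptensor_center_subset:
  "sub_ptensor (center :: 'a::banach_star_algebra set) (center :: 'b::banach_star_algebra set) \<subseteq> center"
  unfolding sub_ptensor_def
proof (rule closure_minimal[OF _ closed_center])
  let ?H = "{a \<otimes>\<^sub>\<gamma> b | a b. a \<in> (center :: 'a set) \<and> b \<in> (center :: 'b set)}"
  note sub = cstar_subalgebra_center[where 'a = "('a, 'b) ptensor"]
  show "complex_vector.span ?H \<subseteq> center"
  proof
    fix w assume "w \<in> complex_vector.span ?H"
    then show "w \<in> center"
    proof (induction rule: complex_vector.span_induct_alt)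
      case base
      show ?case by (rule subalgebra_0[OF sub])
    next
      case (step c x y)
      then obtain a b where x: "x = a \<otimes>\<^sub>\<gamma> b" "a \<in> center" "b \<in> center" by blast
      have "x * v = v * x" for v
        by (rule ptensor_eqI[OF bounded_linear_mult_right bounded_linear_mult_left])
          (simp only: x(1) ptensor_mult centerD[OF x(2)] centerD[OF x(3)])
      then have "x \<in> center" by (rule centerI)
      then show ?case using step by (intro subalgebra_add[OF sub] subalgebra_scaleC[OF sub])
    qed
  qed
qed

theorem theorem5p1:
  shows "(center :: ('a::cstar_algebra, 'b::cstar_algebra) ptensor set) =
    sub_ptensor (center :: 'a set) (center :: 'b set)"
proof (rule antisym)
  show "sub_ptensor (center :: 'a set) (center :: 'b set) \<subseteq> center"
    by (rule sub_ptensor_center_subset)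
  show "(center :: ('a, 'b) ptensor set) \<subseteq> sub_ptensor center center"
  proof
    fix z :: "('a, 'b) ptensor" assume z: "z \<in> center"
    have "cstar_subalgebra (UNIV :: 'a set)" by (simp add: cstar_subalgebra_def)
    then have "z \<in> sub_ptensor UNIV center"
      by (rule central_mem_sub_ptensor[OF z]) (simp add: sub_ptensor_UNIV)
    then have "swap z \<in> sub_ptensor center UNIV" by (rule swap_sub_ptensor)
    then have "swap z \<in> sub_ptensor center center"
      by (rule central_mem_sub_ptensor[OF swap_center[OF z] cstar_subalgebra_center])
    then have "swap (swap z) \<in> sub_ptensor center center" by (rule swap_sub_ptensor)
    then show "z \<in> sub_ptensor center center" by simp
  qed
qed

end
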